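(* Let $q$ be a prime power, let $r$ be a positive integer, and let $c=(c_1,\dots,c_r)$ be nonnegative integers with $c_1+\dots+c_r=r$. Then \[\deg_{\mathrm{PG}(r,q)}\big(\gamma_{(1)_q}^{c_1}\gamma_{(2)_q}^{c_2}\cdots\gamma_{(r)_q}^{c_r}\big)=q^{\binom{r+1}{2}}A_c(q).\]
   Context: $(m)_q=1+q+\dots+q^{m-1}$ and $(m)_q!=\prod_{i=1}^m(i)_q$. $\mathrm{PG}(r,q)$ is the matroid on the ground set $E=\mathbb{P}^r(\mathbb{F}_q)$ (of size $n+1=(r+1)_q$) in which the rank of $S$ is one plus the dimension of its projective span; its rank-$k$ flats are the $(k-1)$-dimensional projective subspaces, each with $(k)_q$ elements. For a loopless matroid $M$ of rank $r+1$ on a finite set $E$ with $|E|=n+1$, the Chow ring $A^*(M)$ (real coefficients) is $\mathbb{R}[x_F : F \text{ a nonempty proper flat}]$ modulo the ideal generated by all $x_{F_1}x_{F_2}$ with $F_1,F_2$ incomparable and all $\sum_{F\ni i}x_F-\sum_{F\ni j}x_F$ for $i,j\in E$; $\deg_M:A^r(M)\to\mathbb{R}$ is the linear map with value $1$ on $x_{F_1}\cdots x_{F_r}$ for each complete flag of flats. For $S\subseteq E$, $x_S$ means the generator if $S$ is a nonempty proper flat and $0$ otherwise. Hypersimplex classes: $\gamma_k=\sum_S\left(\min(|S|,k)-\frac{k}{n+1}|S|\right)x_S$ for $1\le k\le n$ (sum over nonempty proper $S\subsetneq E$). The remixed Eulerian polynomials $A_c(q)$, for $c$ in $\mathcal{W}_r=\{(c_1,\dots,c_r)\in\mathbb{Z}_{\ge0}^r: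 c_1+\dots+c_r=r\}$, are the polynomials characterized by $A_{(1,\dots,1)}(q)=(r)_q!$ and, whenever $c_i\ge2$, $(q+1)A_c(q)=qA_{c-e_i+e_{i-1}}(q)+A_{c-e_i+e_{i+1}}(q)$, where a term whose index vector has a positive entry in position $0$ or $r+1$ is taken to be $0$. *)

theory Defs
  imports
    "HOL-Analysis.Analysis"
    "HOL-Library.Poly_Mapping"
    "HOL-Algebra.QuotRing"
    "HOL-Computational_Algebra.Polynomial"
begin

section \<open>Matroids given by their rank function\<close>

text \<open>Only the data are recorded: the constructions below are meant for loopless matroids on a
  finite ground set, but stating them does not use the matroid axioms.\<close>

record 'a matroid =
  ground :: "'a set"
  mrank :: "'a set \<Rightarrow> nat"

definition is_flat :: "'a matroid \<Rightarrow> 'a set \<Rightarrow> bool" where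
  "is_flat M F \<longleftrightarrow> F \<subseteq> ground M \<and> (\<forall>e \<in> ground M - F. mrank M F < mrank M (insert e F))"

definition proper_flats :: "'a matroid \<Rightarrow> 'a set set" where
  "proper_flats M = {F. is_flat M F \<and> F \<noteq> {} \<and> F \<noteq> ground M}"

text \<open>For a matroid of rank \<open>r + 1\<close>: the sets \<open>{F\<^sub>1, \<dots>, F\<^sub>r}\<close> of nonempty proper flats
  with \<open>F\<^sub>1 \<subset> \<dots> \<subset> F\<^sub>r\<close>.\<close>

definition complete_flags :: "'a matroid \<Rightarrow> 'a set set set" where
  "complete_flags M = {C. C \<subseteq> proper_flats M \<and> finite C \<and> card C = mrank M (ground M) - 1 \<and>
     (\<forall>F \<in> C. \<forall>G \<in> C. F \<subseteq> G \<or> G \<subseteq> F)}"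


section \<open>The Chow ring\<close>

text \<open>Polynomials over the reals in variables indexed by sets; an exponent vector is a finitely
  supported function from sets to naturals.\<close>

type_synonym 'a mpoly = "('a set \<Rightarrow>\<^sub>0 nat) \<Rightarrow>\<^sub>0 real"

definition mconst :: "real \<Rightarrow> 'a mpoly" where
  "mconst t = Poly_Mapping.single 0 t"

definition mvar :: "'a set \<Rightarrow> 'a mpoly" where
  "mvar F = Poly_Mapping.single (Poly_Mapping.single F 1) 1"

definition homogeneous :: "nat \<Rightarrow> 'a mpoly \<Rightarrow> bool" where
  "homogeneous d p \<longleftrightarrow>
     (\<forall>m \<in> Poly_Mapping.keys p. (\<Sum>F \<in> Poly_Mapping.keys m. Poly_Mapping.lookup m F) = d)"

definition flat_poly_ring :: "'a matroid \<Rightarrow> 'a mpoly ring" where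
  "flat_poly_ring M =
     \<lparr>carrier = {p. \<forall>m \<in> Poly_Mapping.keys p. Poly_Mapping.keys m \<subseteq> proper_flats M},
      monoid.mult = (*), one = 1, zero = 0, add = (+)\<rparr>"

definition chow_relations :: "'a matroid \<Rightarrow> 'a mpoly set" where
  "chow_relations M =
     {mvar F * mvar G | F G. F \<in> proper_flats M \<and> G \<in> proper_flats M \<and> \<not> F \<subseteq> G \<and> \<not> G \<subseteq> F} \<union>
     {(\<Sum>F \<in> {F \<in> proper_flats M. i \<in> F}. mvar F) - (\<Sum>F \<in> {F \<in> proper_flats M. j \<in> F}. mvar F)
       | i j. i \<in> ground M \<and> j \<in> ground M}"

definition chow_ideal :: "'a matroid \<Rightarrow> 'a mpoly set" where
  "chow_ideal M = genideal (flat_poly_ring M) (chow_relations M)"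

definition chow_ring :: "'a matroid \<Rightarrow> 'a mpoly set ring" where
  "chow_ring M = flat_poly_ring M Quot chow_ideal M"

definition chow_class :: "'a matroid \<Rightarrow> 'a mpoly \<Rightarrow> 'a mpoly set" where
  "chow_class M p = chow_ideal M +>\<^bsub>flat_poly_ring M\<^esub> p"

definition chow_graded :: "'a matroid \<Rightarrow> nat \<Rightarrow> 'a mpoly set set" where
  "chow_graded M d = chow_class M ` {p \<in> carrier (flat_poly_ring M). homogeneous d p}"

text \<open>The scalar action of \<open>t\<close> on the Chow ring is multiplication by the class of the
  constant \<open>t\<close>. Extensionality only fixes the values outside the top graded piece.\<close>

definition is_degree_map :: "'a matroid \<Rightarrow> ('a mpoly set \<Rightarrow> real) \<Rightarrow> bool" where
  "is_degree_map M d \<longleftrightarrow>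
     (let T = chow_graded M (mrank M (ground M) - 1) in
        d \<in> extensional T \<and>
        (\<forall>a \<in> T. \<forall>b \<in> T. d (a \<oplus>\<^bsub>chow_ring M\<^esub> b) = d a + d b) \<and>
        (\<forall>t. \<forall>a \<in> T. d (chow_class M (mconst t) \<otimes>\<^bsub>chow_ring M\<^esub> a) = t * d a) \<and>
        (\<forall>C \<in> complete_flags M. d (chow_class M (\<Prod>F \<in> C. mvar F)) = 1))"

definition chow_deg :: "'a matroid \<Rightarrow> 'a mpoly set \<Rightarrow> real" where
  "chow_deg M = (THE d. is_degree_map M d)"

definition flat_var :: "'a matroid \<Rightarrow> 'a set \<Rightarrow> 'a mpoly" where
  "flat_var M S = (if S \<in> proper_flats M then mvar S else 0)"

definition hypersimplex_class :: "'a matroid \<Rightarrow> nat \<Rightarrow> 'a mpoly set" where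
  "hypersimplex_class M k = chow_class M
     (\<Sum>S \<in> {S. S \<noteq> {} \<and> S \<subset> ground M}.
        mconst (real (min (card S) k) - real k / real (card (ground M)) * real (card S)) *
        flat_var M S)"


section \<open>Projective geometries\<close>

text \<open>The points are the one-dimensional subspaces of \<open>'k ^ 'n\<close>, so the projective dimension is
  \<open>CARD('n) - 1\<close>. The linear dimension of the span of a set of points is one more than
  the dimension of its projective span.\<close>

definition PG :: "('k::{field,finite} ^ 'n::finite) set matroid" where
  "PG = \<lparr>ground = {L. vec.subspace L \<and> vec.dim L = 1}, mrank = (\<lambda>S. vec.dim (\<Union>S))\<rparr>"


section \<open>Remixed Eulerian polynomials\<close>

definition q_int :: "'a::comm_semiring_1 \<Rightarrow> nat \<Rightarrow> 'a" where
  "q_int q m = (\<Sum>i<m. q ^ i)"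

definition q_fact :: "'a::comm_semiring_1 \<Rightarrow> nat \<Rightarrow> 'a" where
  "q_fact q m = (\<Prod>i=1..m. q_int q i)"

text \<open>A vector \<open>(c\<^sub>1, \<dots>, c\<^sub>r)\<close> is a function on the naturals that vanishes outside
  \<open>{1..r}\<close>.\<close>

definition weight_vectors :: "nat \<Rightarrow> (nat \<Rightarrow> nat) set" where
  "weight_vectors r = {c. (\<forall>i. i \<notin> {1..r} \<longrightarrow> c i = 0) \<and> (\<Sum>i=1..r. c i) = r}"

definition move_unit :: "(nat \<Rightarrow> nat) \<Rightarrow> nat \<Rightarrow> nat \<Rightarrow> nat \<Rightarrow> nat" where
  "move_unit c i j = (c(i := c i - 1))(j := c j + 1)"

text \<open>The first condition implements the convention on the boundary terms: moving a unit to
  position \<open>0\<close> or \<open>r + 1\<close> leads out of \<open>weight_vectors r\<close>. The polynomial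
  variable is \<open>[:0, 1:]\<close>.\<close>

definition is_remixed_eulerian :: "nat \<Rightarrow> ((nat \<Rightarrow> nat) \<Rightarrow> real poly) \<Rightarrow> bool" where
  "is_remixed_eulerian r A \<longleftrightarrow>
     (\<forall>c. c \<notin> weight_vectors r \<longrightarrow> A c = 0) \<and>
     A (\<lambda>i. if i \<in> {1..r} then 1 else 0) = q_fact [:0, 1:] r \<and>
     (\<forall>c \<in> weight_vectors r. \<forall>i \<in> {1..r}. c i \<ge> 2 \<longrightarrow>
        ([:0, 1:] + 1) * A c = [:0, 1:] * A (move_unit c i (i - 1)) + A (move_unit c i (i + 1)))"

definition remixed_eulerian :: "nat \<Rightarrow> (nat \<Rightarrow> nat) \<Rightarrow> real poly" where
  "remixed_eulerian r = (THE A. is_remixed_eulerian r A)"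

end

theory Submission
  imports Defs
begin

text \<open>The function \<open>j \<mapsto> min((j)\<^sub>q, (k)\<^sub>q) - (k)\<^sub>q (j)\<^sub>q / (r+1)\<^sub>q\<close> defining \<open>\<gamma>\<^sub>k := \<gamma>\<^bsub>(k)\<^sub>q\<^esub>\<close> is piecewise linear in
  \<open>(j)\<^sub>q\<close>, with its only break at \<open>j = k\<close>. With \<open>y\<^sub>j\<close> the sum of the \<open>x\<^sub>F\<close> over the flats \<open>F\<close> of rank
  \<open>j\<close> this gives \<open>q\<^sup>j y\<^sub>j = (q+1)\<gamma>\<^sub>j - q\<gamma>\<^bsub>j-1\<^esub> - \<gamma>\<^bsub>j+1\<^esub>\<close>. Since \<open>\<gamma>\<^sub>j x\<^sub>F = 0\<close> in the Chow ring for every flat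
  \<open>F\<close> of rank \<open>j\<close>, the product \<open>\<gamma>\<^sub>j y\<^sub>j\<close> vanishes, which is the recursion of the remixed Eulerian
  polynomials. The initial value \<open>\<gamma>\<^sub>1 \<cdots> \<gamma>\<^sub>r\<close> is computed by eliminating \<open>\<gamma>\<^sub>r\<close>, \<open>\<gamma>\<^bsub>r-1\<^esub>\<close>, \<open>\<dots>\<close> along a flag.

  Two existence statements are needed as well. The degree map is given on monomials by Eur's formula,
  which for projective geometries depends on the ranks of the flats only. The remixed Eulerian polynomials
  are \<open>(r)\<^sub>q!\<close> times the absorption probabilities of a random walk that moves surplus units; at each
  \<open>q > 0\<close> the recursion has a unique solution by a maximum principle, and gambler's ruin on the
  occupied blocks shows that the solutions are polynomial in \<open>q\<close>.\<close>

section \<open>Gaussian integers and binomial coefficients\<close>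

text \<open>Both \<open>chow_deg\<close> and \<open>remixed_eulerian\<close> are definite
  descriptions, so nothing can be computed from either before existence and uniqueness are settled.
  The recursion cannot simply be unwound: a move to the right can be undone by a move to the left,
  so it is a linear system with no evident order of elimination. At a real number q > 0 its
  coefficients become the probabilities q/(q+1) and 1/(q+1), and positivity can be used. Solving the
  system over rational functions would leave denominators; the remedy is to carry along a product of
  factorials that gains exactly the needed factor whenever a new position gets occupied. On the
  geometric side the obstacle is to show that a formula on monomials respects the linear relations;
  this is settled by comparing two points that are separated by a single flat of a chain. Gaussian
  binomials are defined by Pascal's rule and their identities are kept multiplied out, so that they
  make sense over real polynomials as well as over real numbers.\<close>

fun qbin :: "'a::comm_semiring_1 \<Rightarrow> nat \<Rightarrow> nat \<Rightarrow> 'a" where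
  "qbin q n 0 = 1"
| "qbin q 0 (Suc k) = 0"
| "qbin q (Suc n) (Suc k) = qbin q n k + q ^ Suc k * qbin q n (Suc k)"

lemma q_int_0 [simp]: "q_int q 0 = 0"
  by (simp add: q_int_def)

lemma q_int_Suc: "q_int q (Suc n) = q_int q n + q ^ n"
  by (simp add: q_int_def)

lemma q_int_Suc': "q_int q (Suc n) = 1 + q * q_int q n"
  by (simp add: q_int_def sum.lessThan_Suc_shift sum_distrib_left del: sum.lessThan_Suc)

lemma q_int_add: "q_int q (m + n) = q_int q m + q ^ m * q_int q n"
  by (induction n) (simp_all add: q_int_Suc algebra_simps power_add)

lemma q_fact_0 [simp]: "q_fact q 0 = 1"
  by (simp add: q_fact_def)

lemma q_fact_Suc: "q_fact q (Suc n) = q_fact q n * q_int q (Suc n)"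
  by (simp add: q_fact_def)

lemma q_int_pos: "n > 0 \<Longrightarrow> q > 0 \<Longrightarrow> q_int (q::real) n > 0"
  unfolding q_int_def by (rule sum_pos) auto

lemma q_fact_pos: "q > 0 \<Longrightarrow> q_fact (q::real) n > 0"
  unfolding q_fact_def by (rule prod_pos) (auto intro: q_int_pos)

lemma of_nat_q_int: "of_nat (q_int q n) = q_int (of_nat q) n"
  by (simp add: q_int_def)

lemma poly_q_int: "poly (q_int p n) x = q_int (poly p x) n"
  by (simp add: q_int_def poly_sum)

lemma poly_q_fact: "poly (q_fact p n) x = q_fact (poly p x) n"
  by (simp add: q_fact_def poly_prod poly_q_int)

lemma poly_qbin: "poly (qbin p n k) x = qbin (poly p x) n k"
  by (induction p n k rule: qbin.induct) auto

lemma qbin_eq_0: "k > n \<Longrightarrow> qbin q n k = 0"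
  by (induction q n k rule: qbin.induct) auto

lemma qbin_self [simp]: "qbin q n n = 1"
  by (induction n) (auto simp: qbin_eq_0)

lemma qbin_Suc_self: "qbin q (Suc n) n = q_int q (Suc n)"
  by (induction n) (simp_all add: q_int_Suc q_int_Suc' [of q n] algebra_simps)

text \<open>The quotient formula for Gaussian binomials without division. Pascal's rule splits the
  left side, and writing (k+1)_q = 1 + q (k)_q in the first summand lets the induction hypothesis
  apply to both summands.\<close>

lemma qbin_absorb: "q_int q (Suc k) * qbin q (Suc n) (Suc k) = q_int q (Suc n) * qbin q n k"
proof (induction n arbitrary: k)
  case 0
  then show ?case by (cases k) (auto simp: q_int_Suc)
next
  case (Suc n)
  show ?case
  proof (cases k)
    case 0
    have "qbin q m 1 = q_int q m" for m
      by (induction m) (auto simp: q_int_Suc')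
    then show ?thesis using 0 by (simp add: q_int_Suc' del: qbin.simps(3))
  next
    case (Suc j)
    have "q_int q (Suc k) * qbin q (Suc (Suc n)) (Suc k)
      = q_int q (Suc k) * qbin q (Suc n) k + q ^ Suc k * (q_int q (Suc k) * qbin q (Suc n) (Suc k))"
      by (simp add: algebra_simps)
    also have "\<dots> = (1 + q * q_int q k) * qbin q (Suc n) k + q ^ Suc k * (q_int q (Suc n) * qbin q n k)"
      by (simp only: Suc.IH) (simp only: q_int_Suc' [of q k])
    also have "\<dots> = qbin q (Suc n) k + q * (q_int q k * qbin q (Suc n) k)
       + q ^ Suc k * (q_int q (Suc n) * qbin q n k)"
      by (simp add: algebra_simps)
    also have "q_int q k * qbin q (Suc n) k = q_int q (Suc n) * qbin q n j"
      using Suc.IH[of j] Suc by simp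
    also have "qbin q (Suc n) k + q * (q_int q (Suc n) * qbin q n j)
       + q ^ Suc k * (q_int q (Suc n) * qbin q n k) = (1 + q * q_int q (Suc n)) * qbin q (Suc n) k"
      using Suc by (simp add: algebra_simps)
    finally show ?thesis by (simp only: q_int_Suc' [of q "Suc n"])
  qed
qed

lemma q_fact_add: "q_fact q (a + b) = qbin q (a + b) b * q_fact q a * q_fact q b"
proof (induction b)
  case (Suc b)
  have "q_fact q (a + Suc b) = q_int q (Suc (a + b)) * qbin q (a + b) b * q_fact q a * q_fact q b"
    by (simp add: q_fact_Suc Suc.IH mult_ac)
  also have "\<dots> = q_int q (Suc b) * qbin q (Suc (a + b)) (Suc b) * q_fact q a * q_fact q b"
    by (simp only: qbin_absorb)
  finally show ?case by (simp add: q_fact_Suc mult_ac del: qbin.simps)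
qed simp

section \<open>Remixed Eulerian polynomials\<close>

lemma finite_weight_vectors: "finite (weight_vectors r)"
proof (rule finite_subset)
  show "weight_vectors r \<subseteq> {c. \<forall>i. (i \<in> {1..r} \<longrightarrow> c i \<in> {..r}) \<and> (i \<notin> {1..r} \<longrightarrow> c i = 0)}"
  proof safe
    fix c i assume c: "c \<in> weight_vectors r" and i: "i \<in> {1..r}"
    have "c i \<le> (\<Sum>i=1..r. c i)" using i by (intro member_le_sum) auto
    then show "c i \<le> r" using c by (simp add: weight_vectors_def)
  qed (auto simp: weight_vectors_def)
  show "finite {c. \<forall>i. (i \<in> {1..r} \<longrightarrow> c i \<in> {..r}) \<and> (i \<notin> {1..r} \<longrightarrow> c i = (0::nat))}"
    by (rule finite_set_of_finite_funs) auto
qed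

definition ones :: "nat \<Rightarrow> nat \<Rightarrow> nat" where
  "ones r = (\<lambda>i. if i \<in> {1..r} then 1 else 0)"

lemma ones_weight: "ones r \<in> weight_vectors r"
  by (simp add: weight_vectors_def ones_def)

lemma weight_outside: "c \<in> weight_vectors r \<Longrightarrow> i \<notin> {1..r} \<Longrightarrow> c i = 0"
  by (auto simp: weight_vectors_def)

text \<open>The weight \<open>g\<close> serves two purposes: the constant 1 shows that a move keeps
  the total, the identity gives the change of \<open>unit_moment\<close>. Terms are added on both
  sides because subtraction of naturals truncates.\<close>

lemma sum_move_unit:
  fixes g :: "nat \<Rightarrow> nat"
  assumes "finite A" "i \<in> A" "j \<in> A" "i \<noteq> j" "c i \<ge> 1"
  shows "(\<Sum>k\<in>A. g k * move_unit c i j k) + g i = (\<Sum>k\<in>A. g k * c k) + g j"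
proof -
  have A: "A = insert i (insert j (A - {i, j}))" using assms by auto
  have "(\<Sum>k\<in>A - {i, j}. g k * move_unit c i j k) = (\<Sum>k\<in>A - {i, j}. g k * c k)"
    by (rule sum.cong) (auto simp: move_unit_def)
  moreover obtain d where "c i = Suc d"
    using assms(5) by (cases "c i") auto
  ultimately show ?thesis
    using assms by (subst (1 2) A) (simp add: move_unit_def algebra_simps)
qed

lemma move_unit_weight:
  assumes "c \<in> weight_vectors r" "i \<in> {1..r}" "j \<in> {1..r}" "i \<noteq> j" "c i \<ge> 1"
  shows "move_unit c i j \<in> weight_vectors r"
  using assms sum_move_unit[of "{1..r}" i j c "\<lambda>_. 1"]
  by (auto simp: weight_vectors_def move_unit_def)

lemma move_unit_not_weight:
  assumes "j \<notin> {1..r}"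
  shows "move_unit c i j \<notin> weight_vectors r"
  using assms by (auto simp: weight_vectors_def move_unit_def intro!: exI[of _ j])

text \<open>There are \<open>r\<close> units on \<open>r\<close> positions, so without a surplus
  every position holds exactly one. Hence \<open>ones r\<close> is the only vector at which the
  recursion imposes no equation.\<close>

lemma weight_not_ones:
  assumes "c \<in> weight_vectors r" "c \<noteq> ones r"
  shows "\<exists>i. i \<in> {1..r} \<and> c i \<ge> 2"
proof (rule ccontr)
  assume "\<not> ?thesis"
  then have "\<not> 2 \<le> c i" if "i \<in> {1..r}" for i
    using that by blast
  then have le: "c i \<le> 1" if "i \<in> {1..r}" for i
    using that by (metis One_nat_def not_less_eq_eq numeral_2_eq_2)
  have "c i = 1" if i: "i \<in> {1..r}" for i
  proof (rule ccontr)
    assume "c i \<noteq> 1"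
    then have "c i < 1" using le[OF i] by simp
    then have "(\<Sum>i=1..r. c i) < (\<Sum>i=1..r. 1)"
      using le i by (intro sum_strict_mono_ex1) auto
    then show False using assms by (simp add: weight_vectors_def)
  qed
  then have "c = ones r" using assms by (auto simp: fun_eq_iff weight_outside ones_def)
  with assms show False by simp
qed

section \<open>Uniqueness of the solution at a fixed q > 0\<close>

definition unit_moment :: "nat \<Rightarrow> (nat \<Rightarrow> nat) \<Rightarrow> nat" where
  "unit_moment r c = (\<Sum>i=1..r. i * c i)"

lemma unit_moment_left:
  assumes "c \<in> weight_vectors r" "i \<in> {1..r}" "c i \<ge> 1" "move_unit c i (i - 1) \<in> weight_vectors r"
  shows "unit_moment r (move_unit c i (i - 1)) < unit_moment r c"
proof -
  have j: "i - 1 \<in> {1..r}" using move_unit_not_weight[of "i - 1" r c i] assms(4) by blast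
  show ?thesis
    using sum_move_unit[of "{1..r}" i "i - 1" c "\<lambda>k. k"] assms j
    by (cases i) (auto simp: unit_moment_def)
qed

text \<open>Among the points where \<open>\<bar>h\<bar>\<close> is maximal, one of least \<open>\<mu>\<close> has a neighbour of smaller
  \<open>\<mu>\<close> where \<open>\<bar>h\<bar>\<close> is maximal as well.\<close>

lemma weighted_maximum_principle:
  fixes h :: "'a \<Rightarrow> real" and \<mu> :: "'a \<Rightarrow> nat"
  assumes "q > 0" "finite X"
    and step: "\<And>c. c \<in> X \<Longrightarrow> h c \<noteq> 0 \<Longrightarrow> \<exists>a b. (q + 1) * h c = q * h a + h b \<and>
      (a \<in> X \<or> h a = 0) \<and> (b \<in> X \<or> h b = 0) \<and> (a \<in> X \<longrightarrow> \<mu> a < \<mu> c)"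
    and "c \<in> X"
  shows "h c = 0"
proof (rule ccontr)
  assume hc: "h c \<noteq> 0"
  define m where "m = Max ((\<lambda>c. \<bar>h c\<bar>) ` X)"
  have le: "\<bar>h x\<bar> \<le> m" if "x \<in> X" for x
    using that \<open>finite X\<close> by (simp add: m_def)
  have m: "m > 0" using le[OF \<open>c \<in> X\<close>] hc by linarith
  have "m \<in> (\<lambda>c. \<bar>h c\<bar>) ` X"
    unfolding m_def using \<open>finite X\<close> \<open>c \<in> X\<close> by (intro Max_in) auto
  then obtain x0 where "x0 \<in> X \<and> \<bar>h x0\<bar> = m" by auto
  then obtain x where x: "x \<in> X" "\<bar>h x\<bar> = m" and least: "\<And>y. y \<in> X \<and> \<bar>h y\<bar> = m \<Longrightarrow> \<mu> x \<le> \<mu> y"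
    using ex_has_least_nat[of "\<lambda>x. x \<in> X \<and> \<bar>h x\<bar> = m" x0 \<mu>] by blast
  from step[OF x(1)] x m obtain a b where ab: "(q + 1) * h x = q * h a + h b"
      "a \<in> X \<or> h a = 0" "b \<in> X \<or> h b = 0" "a \<in> X \<longrightarrow> \<mu> a < \<mu> x"
    by fastforce
  have "\<bar>h b\<bar> \<le> m" using ab(3) le m by auto
  have "(q + 1) * m = \<bar>q * h a + h b\<bar>"
    using x \<open>q > 0\<close> by (simp flip: ab(1) add: abs_mult)
  also have "\<dots> \<le> q * \<bar>h a\<bar> + \<bar>h b\<bar>"
    using \<open>q > 0\<close> by (metis abs_mult abs_of_pos abs_triangle_ineq)
  finally have "q * m \<le> q * \<bar>h a\<bar>" using \<open>\<bar>h b\<bar> \<le> m\<close> by (simp add: algebra_simps)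
  then have "m \<le> \<bar>h a\<bar>" using \<open>q > 0\<close> by simp
  then have "a \<in> X" "\<bar>h a\<bar> = m" using ab(2) m le[of a] by auto
  then show False using ab(4) least[of a] by auto
qed

text \<open>The recursion evaluated at a number \<open>q\<close>, without the normalisation at
  \<open>ones r\<close>. The solutions then form a vector space, and uniqueness reduces to solutions
  vanishing at \<open>ones r\<close>.\<close>

definition q_harmonic :: "nat \<Rightarrow> real \<Rightarrow> ((nat \<Rightarrow> nat) \<Rightarrow> real) \<Rightarrow> bool" where
  "q_harmonic r q h \<longleftrightarrow> (\<forall>c. c \<notin> weight_vectors r \<longrightarrow> h c = 0) \<and>
     (\<forall>c \<in> weight_vectors r. \<forall>i \<in> {1..r}. c i \<ge> 2 \<longrightarrow>
        (q + 1) * h c = q * h (move_unit c i (i - 1)) + h (move_unit c i (i + 1)))"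

lemma q_harmonic_eq_0:
  assumes "q > 0" "q_harmonic r q h" "h (ones r) = 0"
  shows "h c = 0"
proof (cases "c \<in> weight_vectors r")
  case True
  show ?thesis
  proof (rule weighted_maximum_principle[where h = h and X = "weight_vectors r" and \<mu> = "unit_moment r"])
    fix c assume c: "c \<in> weight_vectors r" "h c \<noteq> 0"
    with assms have "c \<noteq> ones r" by auto
    with c obtain i where i: "i \<in> {1..r}" "c i \<ge> 2" using weight_not_ones by blast
    then show "\<exists>a b. (q + 1) * h c = q * h a + h b \<and> (a \<in> weight_vectors r \<or> h a = 0) \<and>
      (b \<in> weight_vectors r \<or> h b = 0) \<and> (a \<in> weight_vectors r \<longrightarrow> unit_moment r a < unit_moment r c)"
      using assms(2) c i unit_moment_left[of c r i]
      by (intro exI[of _ "move_unit c i (i - 1)"] exI[of _ "move_unit c i (i + 1)"])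
         (auto simp: q_harmonic_def)
  qed (use assms True finite_weight_vectors in auto)
qed (use assms in \<open>auto simp: q_harmonic_def\<close>)

lemma q_harmonic_unique:
  assumes "q > 0" "q_harmonic r q h" "q_harmonic r q h'" "h (ones r) = h' (ones r)"
  shows "h c = h' c"
proof -
  have "q_harmonic r q (\<lambda>c. h c - h' c)"
    using assms(2,3) unfolding q_harmonic_def by (auto simp: algebra_simps)
  from q_harmonic_eq_0[OF assms(1) this, of c] assms show ?thesis by simp
qed

section \<open>Existence of the solution at a fixed q > 0\<close>

lemma move_unit_commute:
  assumes "i \<noteq> j" "c i \<ge> 1" "c j \<ge> 1" "k \<noteq> j" "l \<noteq> i"
  shows "move_unit (move_unit c j k) i l = move_unit (move_unit c i l) j k"
  using assms by (auto simp: move_unit_def fun_eq_iff)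

text \<open>The recursion gives one equation for every position with a surplus. Choosing one such
  position per vector turns it into an operator; the other equations have to be recovered
  afterwards.\<close>

definition least_pile :: "nat \<Rightarrow> (nat \<Rightarrow> nat) \<Rightarrow> nat" where
  "least_pile r c = (LEAST i. i \<in> {1..r} \<and> c i \<ge> 2)"

lemma least_pile:
  assumes "c \<in> weight_vectors r" "c \<noteq> ones r"
  shows "least_pile r c \<in> {1..r}" "c (least_pile r c) \<ge> 2"
proof -
  obtain i where "i \<in> {1..r} \<and> c i \<ge> 2" using assms weight_not_ones by blast
  then have "least_pile r c \<in> {1..r} \<and> c (least_pile r c) \<ge> 2"
    unfolding least_pile_def by (rule LeastI)
  then show "least_pile r c \<in> {1..r}" "c (least_pile r c) \<ge> 2" by auto
qed

lemma least_pile_eqI: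
  assumes "i \<in> {1..r}" "c i \<ge> 2" "\<And>j. j \<in> {1..<i} \<Longrightarrow> c j < 2"
  shows "least_pile r c = i"
  unfolding least_pile_def using assms
  by (intro Least_equality) (auto, metis Suc_le_eq leI less_2_cases_iff not_less)

lemma less_least_pile: "j \<in> {1..r} \<Longrightarrow> j < least_pile r c \<Longrightarrow> c j < 2"
  unfolding least_pile_def by (metis (mono_tags, lifting) leI not_less_Least)

text \<open>One step of the walk: absorption at \<open>ones r\<close> pays 1, leaving
  \<open>{1..r}\<close> pays 0, and a surplus unit moves left or right with probabilities q/(q+1)
  and 1/(q+1).\<close>

definition spread :: "nat \<Rightarrow> real \<Rightarrow> ((nat \<Rightarrow> nat) \<Rightarrow> real) \<Rightarrow> (nat \<Rightarrow> nat) \<Rightarrow> real" where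
  "spread r q h c = (if c \<notin> weight_vectors r then 0 else if c = ones r then 1 else
     let i = least_pile r c
     in (q * h (move_unit c i (i - 1)) + h (move_unit c i (i + 1))) / (q + 1))"

lemma spread_mono: "q > 0 \<Longrightarrow> (\<And>c. h c \<le> h' c) \<Longrightarrow> spread r q h c \<le> spread r q h' c"
  unfolding spread_def Let_def
  by (auto intro!: divide_right_mono add_mono mult_left_mono)

text \<open>Iterating from 0 gives the probabilities of absorption within a bounded number of steps,
  which increase and stay at most 1. The limit is a fixed point because a value of
  \<open>spread\<close> depends on at most two values of its argument.\<close>

lemma spread_fixpoint_exists:
  assumes "q > 0"
  obtains h where "spread r q h = h"
proof -
  define H where "H n = (spread r q ^^ n) (\<lambda>_. 0)" for n
  have H_Suc: "H (Suc n) = spread r q (H n)" for n by (simp add: H_def)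
  have "H n c \<le> H (Suc n) c" for n c
  proof (induction n arbitrary: c)
    case 0
    show ?case using assms by (simp add: H_def spread_def Let_def)
  next
    case (Suc n)
    show ?case unfolding H_Suc[of "Suc n"] using spread_mono[OF assms Suc] by (simp add: H_Suc)
  qed
  then have inc: "incseq (\<lambda>n. H n c)" for c by (simp add: incseq_SucI)
  have le: "H n c \<le> 1" for n c
  proof (induction n arbitrary: c)
    case (Suc n)
    have "H (Suc n) c \<le> spread r q (\<lambda>_. 1) c"
      unfolding H_Suc using spread_mono[OF assms Suc] .
    also have "\<dots> \<le> 1" using assms by (auto simp: spread_def Let_def)
    finally show ?case .
  qed (simp add: H_def)
  have "\<exists>l. (\<lambda>n. H n c) \<longlonglongrightarrow> l" for c
    using incseq_convergent[OF inc[of c], of 1] le by metis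
  then obtain h where h: "\<And>c. (\<lambda>n. H n c) \<longlonglongrightarrow> h c" by metis
  have "spread r q h c = h c" for c
  proof (rule LIMSEQ_unique)
    show "(\<lambda>n. H (Suc n) c) \<longlonglongrightarrow> h c" using h by (rule LIMSEQ_Suc)
    show "(\<lambda>n. H (Suc n) c) \<longlonglongrightarrow> spread r q h c"
      unfolding H_Suc spread_def Let_def using assms by (auto intro!: tendsto_intros h)
  qed
  then show ?thesis using that by blast
qed

text \<open>The fixed point is harmonic for moves at the least pile. Its defect for moves at another
  pile \<open>j\<close> is again harmonic for moves at the least pile, because the two moves commute; the
  maximum principle makes this defect vanish.\<close>

lemma spread_fixpoint_harmonic:
  assumes "q > 0" and h: "spread r q h = h"
  shows "q_harmonic r q h" "h (ones r) = 1"
proof -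
  have out: "h c = 0" if "c \<notin> weight_vectors r" for c
    using that by (subst h[symmetric]) (simp add: spread_def)
  show ones: "h (ones r) = 1"
    by (subst h[symmetric]) (simp add: spread_def ones_weight)
  have rule: "(q + 1) * h c = q * h (move_unit c i (i - 1)) + h (move_unit c i (i + 1))"
    if "c \<in> weight_vectors r" "c \<noteq> ones r" "i = least_pile r c" for c i
    using that \<open>q > 0\<close> by (subst (1) h[symmetric]) (simp add: spread_def Let_def)
  have "(q + 1) * h c = q * h (move_unit c j (j - 1)) + h (move_unit c j (j + 1))"
    if c: "c \<in> weight_vectors r" and j: "j \<in> {1..r}" "c j \<ge> 2" for c j
  proof -
    define E where "E c = (q + 1) * h c - q * h (move_unit c j (j - 1)) - h (move_unit c j (j + 1))" for c
    \<comment> \<open>The defect has to vanish where \<open>j\<close> carries a surplus. Moves at a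
      smaller position \<open>i\<close> preserve this surplus, since they can only add to
      \<open>j\<close>.\<close>
    define X where "X = {c \<in> weight_vectors r. c j \<ge> 2}"
    have "E c = 0"
    proof (rule weighted_maximum_principle[where h = E and X = X and \<mu> = "unit_moment r"])
      fix c assume "c \<in> X" and Ec: "E c \<noteq> 0"
      then have c: "c \<in> weight_vectors r" "c j \<ge> 2" by (auto simp: X_def)
      have n1: "c \<noteq> ones r" using c(2) by (auto simp: ones_def split: if_splits)
      define i where "i = least_pile r c"
      have i: "i \<in> {1..r}" "c i \<ge> 2" using least_pile[OF c(1) n1] by (auto simp: i_def)
      have "i \<le> j" unfolding i_def least_pile_def by (rule Least_le) (use c j in auto)
      moreover have "i \<noteq> j" using rule[OF c(1) n1, of j] Ec by (auto simp: E_def i_def)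
      ultimately have ij: "i < j" by simp
      have below: "c k < 2" if "k \<in> {1..<i}" for k
        using that less_least_pile[of k r c] i by (auto simp: i_def)
      let ?L = "\<lambda>c. move_unit c i (i - 1)" and ?R = "\<lambda>c. move_unit c i (i + 1)"
      have r1: "(q + 1) * h c = q * h (?L c) + h (?R c)" using rule c n1 i_def by simp
      \<comment> \<open>After the move at \<open>j\<close> the least pile is still \<open>i\<close>:
        positions below \<open>i\<close> are untouched and \<open>i\<close> can only gain. If the
        move leaves \<open>{1..r}\<close>, every term is 0.\<close>
      have r2: "(q + 1) * h (move_unit c j k) = q * h (?L (move_unit c j k)) + h (?R (move_unit c j k))"
        if k: "k = j - 1 \<or> k = j + 1" for k
      proof (cases "move_unit c j k \<in> weight_vectors r")
        case True
        have "least_pile r (move_unit c j k) = i"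
        proof (rule least_pile_eqI)
          show "2 \<le> move_unit c j k i" using i ij by (auto simp: move_unit_def)
          fix l assume l: "l \<in> {1..<i}"
          then show "move_unit c j k l < 2" using below[OF l] ij k by (auto simp: move_unit_def)
        qed (use i in auto)
        moreover have "move_unit c j k \<noteq> ones r"
        proof
          assume "move_unit c j k = ones r"
          then have "move_unit c j k i = ones r i" by simp
          then show False using i ij by (auto simp: move_unit_def ones_def split: if_splits)
        qed
        ultimately show ?thesis using rule[OF True] by simp
      next
        case False
        moreover have "k \<noteq> j" using k ij by auto
        ultimately have "k \<notin> {1..r}" using move_unit_weight[of c r j k] c j by auto
        then have "move_unit (move_unit c i l) j k \<notin> weight_vectors r" for l
          by (rule move_unit_not_weight)
        then show ?thesis using out False move_unit_commute[of i j c k] i c ij k by auto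
      qed
      have com: "?L (move_unit c j k) = move_unit (?L c) j k" "?R (move_unit c j k) = move_unit (?R c) j k"
        if k: "k = j - 1 \<or> k = j + 1" for k
        using move_unit_commute[of i j c k] i c ij k by auto
      have "(q + 1) * E c = q * E (?L c) + E (?R c)"
        using r1 r2[of "j - 1"] r2[of "j + 1"] com[of "j - 1"] com[of "j + 1"]
        by (simp add: E_def algebra_simps)
      moreover have "?L c \<in> X \<or> E (?L c) = 0"
      proof (cases "?L c \<in> weight_vectors r")
        case True
        then show ?thesis using c ij by (auto simp: X_def move_unit_def)
      next
        case False
        moreover have "i \<noteq> i - 1" using i by auto
        ultimately have "i - 1 \<notin> {1..r}" using move_unit_weight[of c r i "i - 1"] c i by auto
        then have "move_unit (move_unit c j k) i (i - 1) \<notin> weight_vectors r" for k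
          by (rule move_unit_not_weight)
        then have "h (move_unit (?L c) j k) = 0" if "k = j - 1 \<or> k = j + 1" for k
          using com(1)[OF that] out by metis
        then have "E (?L c) = 0"
          using out False by (simp add: E_def)
        then show ?thesis ..
      qed
      moreover have "?R c \<in> X"
        using c i ij j move_unit_weight[of c r i "i + 1"] by (auto simp: X_def move_unit_def)
      moreover have "?L c \<in> X \<longrightarrow> unit_moment r (?L c) < unit_moment r c"
        using unit_moment_left[of c r i] c i by (auto simp: X_def)
      ultimately show "\<exists>a b. (q + 1) * E c = q * E a + E b \<and> (a \<in> X \<or> E a = 0) \<and> (b \<in> X \<or> E b = 0) \<and>
          (a \<in> X \<longrightarrow> unit_moment r a < unit_moment r c)"
        by blast
    qed (use \<open>q > 0\<close> finite_weight_vectors c j in \<open>auto simp: X_def\<close>)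
    then show ?thesis by (simp add: E_def)
  qed
  then show "q_harmonic r q h" using out by (auto simp: q_harmonic_def)
qed

section \<open>Polynomial dependence on q\<close>

lemma geometric_increments:
  fixes f :: "nat \<Rightarrow> real"
  assumes "\<And>j. p < j \<Longrightarrow> j < p + n \<Longrightarrow> (q + 1) * f j = q * f (j - 1) + f (j + 1)" and "k \<le> n"
  shows "f (p + k) = f p + q_int q k * (f (p + 1) - f p)"
proof -
  have inc: "f (p + Suc k) - f (p + k) = q ^ k * (f (p + 1) - f p)" if "Suc k \<le> n" for k
    using that
  proof (induction k)
    case (Suc k)
    have "f (p + Suc (Suc k)) - f (p + Suc k) = q * (f (p + Suc k) - f (p + k))"
      using assms(1)[of "p + Suc k"] Suc.prems by (simp add: algebra_simps)
    then show ?case using Suc by simp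
  qed simp
  show ?thesis using \<open>k \<le> n\<close>
  proof (induction k)
    case (Suc k)
    then show ?case using inc[of k] by (simp add: q_int_Suc algebra_simps)
  qed simp
qed

text \<open>This differs from \<open>move_unit\<close> only at \<open>j = i\<close>, where for
  \<open>c i > 0\<close> it returns \<open>c\<close> instead of adding a unit. The walk of a single
  unit thus becomes one function of its position.\<close>

definition pile_at :: "(nat \<Rightarrow> nat) \<Rightarrow> nat \<Rightarrow> nat \<Rightarrow> nat \<Rightarrow> nat" where
  "pile_at c i j = (let d = c(i := c i - 1) in d(j := d j + 1))"

text \<open>Gambler's ruin: a surplus unit at \<open>i\<close> leaves the occupied block \<open>{l..u}\<close> at one of its
  two ends.\<close>

lemma q_harmonic_block:
  assumes h: "q_harmonic r q h" and c: "c \<in> weight_vectors r"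
    and lu: "1 \<le> l" "l \<le> i" "i \<le> u" "u \<le> r" and pos: "\<And>j. j \<in> {l..u} \<Longrightarrow> c j \<ge> 1" and i: "c i \<ge> 2"
  shows "q_int q (u - l + 2) * h c =
    q ^ (i - l + 1) * q_int q (u + 1 - i) * h (move_unit c i (l - 1)) +
    q_int q (i - l + 1) * h (move_unit c i (u + 1))"
proof -
  define f where "f j = h (pile_at c i j)" for j
  have pile_neq: "pile_at c i j = move_unit c i j" if "j \<noteq> i" for j
    using that by (simp add: pile_at_def move_unit_def)
  have pile_eq: "pile_at c i i = c"
    using i by (simp add: pile_at_def)
  \<comment> \<open>Positions of the block are occupied, so the walking unit is a surplus wherever
    it stands in the block, and the recursion applies there.\<close>
  have rec: "(q + 1) * f j = q * f (j - 1) + f (j + 1)" if j: "l \<le> j" "j \<le> u" for j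
  proof -
    have "pile_at c i j \<in> weight_vectors r"
      using move_unit_weight[of c r i j] c i j lu pile_eq pile_neq[of j] by (cases "j = i") auto
    moreover have "pile_at c i j j \<ge> 2"
      using i pos[of j] j by (auto simp: pile_at_def Let_def)
    moreover have "move_unit (pile_at c i j) j k = pile_at c i k" if "k \<noteq> j" for k
      using that by (auto simp: move_unit_def pile_at_def Let_def fun_eq_iff)
    moreover have "(q + 1) * h d = q * h (move_unit d j (j - 1)) + h (move_unit d j (j + 1))"
      if "d \<in> weight_vectors r" "d j \<ge> 2" for d
      using h j lu that by (simp add: q_harmonic_def)
    ultimately show ?thesis
      using j lu by (simp add: f_def)
  qed
  define p where "p = l - 1"
  have l: "l = p + 1" using lu by (simp add: p_def)
  have geo: "f (p + k) = f p + q_int q k * (f (p + 1) - f p)" if "k \<le> u - p + 1" for k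
    by (rule geometric_increments[where n = "u - p + 1"]) (use that lu in \<open>auto intro!: rec[simplified] simp: l\<close>)
  have fu: "f (u + 1) = f p + q_int q (u - p + 1) * (f (p + 1) - f p)"
    using geo[of "u - p + 1"] lu l by (simp add: algebra_simps)
  have fi: "f i = f p + q_int q (i - p) * (f (p + 1) - f p)"
    using geo[of "i - p"] lu l by simp
  \<comment> \<open>Splitting the length of the walk at \<open>i\<close> eliminates the unknown
    first increment \<open>f (p + 1) - f p\<close>.\<close>
  have "u - p + 1 = (i - p) + (u + 1 - i)" using lu l by simp
  then have "q_int q (u - p + 1) = q_int q (i - p) + q ^ (i - p) * q_int q (u + 1 - i)"
    using q_int_add by metis
  then have "q_int q (u - p + 1) * f i = q ^ (i - p) * q_int q (u + 1 - i) * f p + q_int q (i - p) * f (u + 1)"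
    unfolding fi fu by (simp add: algebra_simps)
  moreover have "f p = h (move_unit c i (l - 1))" "f (u + 1) = h (move_unit c i (u + 1))" "f i = h c"
    using pile_neq[of p] pile_neq[of "u + 1"] pile_eq lu l by (auto simp: f_def)
  moreover have "u - p + 1 = u - l + 2" "i - p = i - l + 1" using lu l by auto
  ultimately show ?thesis by simp
qed

text \<open>Counting back from \<open>j\<close> to the nearest gap makes the values on a block of
  length m run through 1, ..., m, so that a product over the block becomes a q-factorial.\<close>

primrec run_length :: "nat set \<Rightarrow> nat \<Rightarrow> nat" where
  "run_length S 0 = 0"
| "run_length S (Suc j) = (if Suc j \<in> S then run_length S j + 1 else 0)"

text \<open>This is the product of the factorials of the lengths of the maximal blocks of \<open>S\<close>.\<close>

definition block_fact :: "nat set \<Rightarrow> 'a::comm_semiring_1 \<Rightarrow> 'a" where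
  "block_fact S q = (\<Prod>j\<in>S. q_int q (run_length S j))"

lemma run_length_block:
  assumes "p = 0 \<or> p \<notin> S" "\<And>j. p < j \<Longrightarrow> j \<le> p + k \<Longrightarrow> j \<in> S"
  shows "run_length S (p + k) = k"
  using assms(2)
proof (induction k)
  case 0
  show ?case using assms(1) by (cases p) auto
qed simp

lemma run_length_cong:
  assumes "\<And>j. j \<le> n \<Longrightarrow> j \<in> S \<longleftrightarrow> j \<in> S'"
  shows "run_length S n = run_length S' n"
  using assms by (induction n) auto

lemma run_length_cong_above:
  assumes "p \<notin> S" "p \<notin> S'" "\<And>j. p < j \<Longrightarrow> j \<in> S \<longleftrightarrow> j \<in> S'"
  shows "run_length S (p + n) = run_length S' (p + n)"
proof (induction n)
  case 0
  then show ?case using assms by (cases p) auto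
qed (use assms in auto)

text \<open>Filling the gap \<open>x\<close> joins a block of length \<open>a\<close> on its left
  with one of length \<open>b\<close> on its right. Run lengths change only at \<open>x\<close>,
  where the new one is \<open>a + 1\<close>, and on the right block, where all grow by
  \<open>a + 1\<close>.\<close>

lemma block_fact_insert:
  fixes q :: real
  assumes "finite S" "0 \<notin> S" "q > 0"
    and x: "x \<notin> S" "a < x" "x - a - 1 \<notin> S" "\<And>j. x - a \<le> j \<Longrightarrow> j < x \<Longrightarrow> j \<in> S"
    and b: "x + b + 1 \<notin> S" "\<And>j. x < j \<Longrightarrow> j \<le> x + b \<Longrightarrow> j \<in> S"
  shows "block_fact (insert x S) q * (q_fact q a * q_fact q b) = block_fact S q * q_fact q (a + b + 1)"
proof -
  let ?S' = "insert x S"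
  define B where "B = {x<..x + b}"
  have BS: "B \<subseteq> S" using b by (auto simp: B_def)
  have out: "run_length ?S' j = run_length S j" if "j \<in> S - B" for j
  proof (cases "j < x")
    case True
    then show ?thesis by (intro run_length_cong) auto
  next
    case False
    then have "j > x + b" using that x(1) by (cases "j = x") (auto simp: B_def)
    then have "x + b + 1 \<le> j" by simp
    then obtain n where "j = (x + b + 1) + n" by (metis le_iff_add)
    moreover have "run_length ?S' ((x + b + 1) + n) = run_length S ((x + b + 1) + n)"
      by (rule run_length_cong_above) (use b in auto)
    ultimately show ?thesis by simp
  qed
  have new: "run_length ?S' (x + k) = a + 1 + k" if "k \<le> b" for k
  proof -
    have "run_length ?S' ((x - a - 1) + (a + 1 + k)) = a + 1 + k"
    proof (rule run_length_block)
      fix j assume "x - a - 1 < j" "j \<le> x - a - 1 + (a + 1 + k)"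
      then show "j \<in> ?S'" using x(2) x(4)[of j] b(2)[of j] that by (cases j x rule: linorder_cases) auto
    qed (use x in auto)
    then show ?thesis using x(2) by (simp add: algebra_simps)
  qed
  have old: "run_length S (x + k) = k" if "k \<le> b" for k
    by (rule run_length_block) (use x b that in auto)
  have Bprod: "(\<Prod>j\<in>B. g j) = (\<Prod>k=1..b. g (x + k))" for g :: "nat \<Rightarrow> real"
    by (rule prod.reindex_bij_witness[of _ "\<lambda>k. x + k" "\<lambda>j. j - x"]) (auto simp: B_def)
  have split: "(\<Prod>j\<in>S. g j) = (\<Prod>j\<in>S - B. g j) * (\<Prod>j\<in>B. g j)" for g :: "nat \<Rightarrow> real"
    using prod.subset_diff[OF BS \<open>finite S\<close>] by simp
  have "block_fact S q = (\<Prod>j\<in>S - B. q_int q (run_length S j)) * (\<Prod>k=1..b. q_int q k)"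
    unfolding block_fact_def split Bprod using old by simp
  then have 1: "block_fact S q = (\<Prod>j\<in>S - B. q_int q (run_length S j)) * q_fact q b"
    by (simp add: q_fact_def)
  have "block_fact ?S' q = q_int q (run_length ?S' x) * (\<Prod>j\<in>S. q_int q (run_length ?S' j))"
    unfolding block_fact_def using x(1) \<open>finite S\<close> by simp
  also have "(\<Prod>j\<in>S. q_int q (run_length ?S' j)) =
     (\<Prod>j\<in>S - B. q_int q (run_length S j)) * (\<Prod>k=1..b. q_int q (a + 1 + k))"
    unfolding split Bprod using new out by simp
  finally have 2: "block_fact ?S' q = q_int q (a + 1) *
      ((\<Prod>j\<in>S - B. q_int q (run_length S j)) * (\<Prod>k=1..b. q_int q (a + 1 + k)))"
    using new[of 0] by simp
  have "q_fact q (a + b + 1) = q_fact q a * q_int q (a + 1) * (\<Prod>k=1..b. q_int q (a + 1 + k))"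
    by (induction b) (auto simp: q_fact_Suc mult_ac)
  then show ?thesis unfolding 1 2 by (simp add: mult_ac)
qed

text \<open>The quotient of the factorials is a Gaussian binomial times (a+1)_q, or another one
  times (b+1)_q. The first form is for a gap to the right of a given block, the second for a gap to
  its left; the q-integer split off is one more than the length of that block, the denominator of
  the ruin probabilities.\<close>

lemma block_fact_insert_eq:
  fixes q :: real
  assumes "finite S" "0 \<notin> S" "q > 0"
    and "x \<notin> S" "a < x" "x - a - 1 \<notin> S" "\<And>j. x - a \<le> j \<Longrightarrow> j < x \<Longrightarrow> j \<in> S"
    and "x + b + 1 \<notin> S" "\<And>j. x < j \<Longrightarrow> j \<le> x + b \<Longrightarrow> j \<in> S"
  shows "block_fact (insert x S) q = block_fact S q * q_int q (a + 1) * qbin q (a + b + 1) b"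
    and "block_fact (insert x S) q = block_fact S q * q_int q (b + 1) * qbin q (a + b + 1) a"
proof -
  have pos: "q_fact q a * q_fact q b > 0" using assms(3) by (simp add: q_fact_pos)
  note ins = block_fact_insert[OF assms]
  have 1: "q_fact q (a + b + 1) = q_int q (a + 1) * qbin q (a + b + 1) b * (q_fact q a * q_fact q b)"
    using q_fact_add[of q "a + 1" b] by (simp add: q_fact_Suc mult_ac del: qbin.simps)
  have 2: "q_fact q (a + b + 1) = q_int q (b + 1) * qbin q (a + b + 1) a * (q_fact q a * q_fact q b)"
    using q_fact_add[of q "b + 1" a] by (simp add: q_fact_Suc mult_ac add_ac del: qbin.simps)
  show "block_fact (insert x S) q = block_fact S q * q_int q (a + 1) * qbin q (a + b + 1) b"
    using ins pos unfolding 1 by (auto simp del: qbin.simps)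
  show "block_fact (insert x S) q = block_fact S q * q_int q (b + 1) * qbin q (a + b + 1) a"
    using ins pos unfolding 2 by (auto simp del: qbin.simps)
qed

lemma block_left_exists:
  assumes "0 \<notin> S" "x > (0::nat)"
  obtains a where "a < x" "x - a - 1 \<notin> S" "\<And>j. x - a \<le> j \<Longrightarrow> j < x \<Longrightarrow> j \<in> S"
proof -
  define p where "p = Max {p. p < x \<and> p \<notin> S}"
  have fin: "finite {p. p < x \<and> p \<notin> S}" by simp
  have "p \<in> {p. p < x \<and> p \<notin> S}"
    unfolding p_def using assms by (intro Max_in) auto
  then have p: "p < x" "p \<notin> S" by auto
  have "j \<in> S" if "p < j" "j < x" for j
    using Max_ge[OF fin, of j] that unfolding p_def by (metis (mono_tags, lifting) leD mem_Collect_eq)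
  then show ?thesis using p by (intro that[of "x - p - 1"]) auto
qed

lemma block_right_exists:
  assumes "finite S"
  obtains b where "x + b + 1 \<notin> S" "\<And>j. x < j \<Longrightarrow> j \<le> x + b \<Longrightarrow> j \<in> (S::nat set)"
proof -
  define b where "b = (LEAST b. x + b + 1 \<notin> S)"
  have "\<exists>b. x + b + 1 \<notin> S"
    using assms by (metis add.commute add.left_commute finite_nat_set_iff_bounded_le le_add2 less_add_one not_less trans_le_add1)
  then have "x + b + 1 \<notin> S" unfolding b_def by (rule LeastI_ex)
  moreover have "j \<in> S" if "x < j" "j \<le> x + b" for j
    using not_less_Least[of "j - x - 1" "\<lambda>b. x + b + 1 \<notin> S"] that by (auto simp: b_def)
  ultimately show ?thesis by (rule that)
qed

lemma block_fact_ones: "block_fact {1..r} q = q_fact q r"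
proof -
  have "run_length {1..r} (0 + j) = j" if "j \<le> r" for j
    by (rule run_length_block) (use that in auto)
  then show ?thesis by (auto simp: block_fact_def q_fact_def intro!: prod.cong)
qed

text \<open>Induction on the number of empty positions. Gambler's ruin on the block around
  \<open>i\<close> divides by (u-l+2)_q. Each exit within \<open>{1..r}\<close> occupies a gap
  adjacent to the block, and the block factorial of the enlarged support contains this q-integer in
  addition to the block factorial of \<open>S\<close>; an exit out of \<open>{1..r}\<close>
  contributes 0. Keeping \<open>block_fact\<close> as an explicit factor of the claim is what makes
  the division possible.\<close>

lemma q_harmonic_polynomial:
  fixes h :: "real \<Rightarrow> (nat \<Rightarrow> nat) \<Rightarrow> real"
  assumes h: "\<And>q. q > 0 \<Longrightarrow> q_harmonic r q (h q)" "\<And>q. q > 0 \<Longrightarrow> h q (ones r) = 1"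
    and c: "c \<in> weight_vectors r"
  shows "\<exists>B. \<forall>q>0. q_fact q r * h q c = block_fact {j. c j > 0} q * poly B q"
  using c
proof (induction "r - card {j. c j > 0}" arbitrary: c rule: less_induct)
  case less
  define S where "S = {j. c j > 0}"
  have Sr: "S \<subseteq> {1..r}" using less.prems by (auto simp: S_def weight_vectors_def intro: ccontr)
  then have fin: "finite S" and S0: "0 \<notin> S" by (auto intro: finite_subset)
  show ?case
  proof (cases "c = ones r")
    case True
    then have "S = {1..r}" by (auto simp: S_def ones_def split: if_splits)
    then show ?thesis using True h(2) by (intro exI[of _ 1]) (simp add: S_def block_fact_ones[unfolded One_nat_def])
  next
    case False
    then obtain i where i: "i \<in> {1..r}" "c i \<ge> 2" using weight_not_ones less.prems by blast
    then have iS: "i \<in> S" by (simp add: S_def)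
    obtain a where a: "a < i" "i - a - 1 \<notin> S" "\<And>j. i - a \<le> j \<Longrightarrow> j < i \<Longrightarrow> j \<in> S"
      using block_left_exists[OF S0, of i] i by auto
    obtain b where b: "i + b + 1 \<notin> S" "\<And>j. i < j \<Longrightarrow> j \<le> i + b \<Longrightarrow> j \<in> S"
      using block_right_exists[OF fin, of i] by blast
    define l u where "l = i - a" and "u = i + b"
    have block: "j \<in> S" if "l \<le> j" "j \<le> u" for j
      using that a(3)[of j] b(2)[of j] iS by (cases j i rule: linorder_cases) (auto simp: l_def u_def)
    have lu: "1 \<le> l" "l \<le> i" "i \<le> u" "u \<le> r" using a(1) block[of u] subsetD[OF Sr, of u] by (auto simp: l_def u_def)
    have ends: "l - 1 \<notin> S" "u + 1 \<notin> S" using a b by (auto simp: l_def u_def)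
    have gambler: "q_int q (u - l + 2) * h q c =
        q ^ (i - l + 1) * q_int q (u + 1 - i) * h q (move_unit c i (l - 1)) +
        q_int q (i - l + 1) * h q (move_unit c i (u + 1))" if "q > 0" for q
      by (rule q_harmonic_block[OF h(1)[OF that] less.prems lu])
         (use i block in \<open>auto simp: S_def Suc_le_eq\<close>)
    have step: "\<exists>B. \<forall>q>0. q_fact q r * h q (move_unit c i x) = block_fact S q * q_int q (u - l + 2) * poly B q"
      if x: "x = l - 1 \<or> x = u + 1" for x
    proof (cases "x \<in> {1..r}")
      case False
      then have "h q (move_unit c i x) = 0" if "q > 0" for q
        using h(1)[OF that] move_unit_not_weight[OF False] by (auto simp: q_harmonic_def)
      then show ?thesis by (intro exI[of _ 0]) auto
    next
      case True
      have xS: "x \<notin> S" using x ends by auto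
      then have xi: "x \<noteq> i" using iS by auto
      have supp: "{j. move_unit c i x j > 0} = insert x S"
        using i xi by (auto simp: move_unit_def S_def)
      have mw: "move_unit c i x \<in> weight_vectors r"
        using move_unit_weight[of c r i x] less.prems i True xi by auto
      have "card (insert x S) \<le> card {1..r}" using Sr True by (intro card_mono) auto
      then have "r - card (insert x S) < r - card S" using xS fin by simp
      then have "r - card {j. move_unit c i x j > 0} < r - card {j. c j > 0}"
        unfolding supp by (simp add: S_def)
      from less.hyps[OF this mw] obtain B where
        B: "\<And>q. q > 0 \<Longrightarrow> q_fact q r * h q (move_unit c i x) = block_fact (insert x S) q * poly B q"
        unfolding supp by blast
      obtain a' where a': "a' < x" "x - a' - 1 \<notin> S" "\<And>j. x - a' \<le> j \<Longrightarrow> j < x \<Longrightarrow> j \<in> S"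
        using block_left_exists[OF S0, of x] True by auto
      obtain b' where b': "x + b' + 1 \<notin> S" "\<And>j. x < j \<Longrightarrow> j \<le> x + b' \<Longrightarrow> j \<in> S"
        using block_right_exists[OF fin, of x] by blast
      note ins = block_fact_insert_eq[OF fin S0 _ xS a' b']
      show ?thesis using x
      proof
        assume xl: "x = l - 1"
        \<comment> \<open>The block to the right of \<open>x = l - 1\<close> is exactly
          \<open>{l..u}\<close>, because \<open>u + 1\<close> is a gap. Its length plus one gives
          the denominator.\<close>
        have "b' = u - l + 1"
        proof (rule ccontr)
          assume "b' \<noteq> u - l + 1"
          then consider "b' < u - l + 1" | "b' > u - l + 1" by linarith
          then show False
          proof cases
            case 1
            then have "l \<le> x + b' + 1" "x + b' + 1 \<le> u" using xl True lu by auto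
            then show False using b'(1) block by blast
          next
            case 2
            then have "x < u + 1" "u + 1 \<le> x + b'" using xl True lu by auto
            then show False using b'(2) ends by blast
          qed
        qed
        then have "b' + 1 = u - l + 2" by simp
        then show ?thesis using B ins(2)
          by (intro exI[of _ "qbin [:0, 1:] (a' + b' + 1) a' * B"]) (auto simp: poly_qbin simp del: qbin.simps)
      next
        assume xu: "x = u + 1"
        have "a' = u - l + 1"
        proof (rule ccontr)
          assume "a' \<noteq> u - l + 1"
          then consider "a' < u - l + 1" | "a' > u - l + 1" by linarith
          then show False
          proof cases
            case 1
            then have "l \<le> x - a' - 1" "x - a' - 1 \<le> u" using xu lu by auto
            then show False using a'(2) block by blast
          next
            case 2
            then have "x - a' \<le> l - 1" "l - 1 < x" using xu lu a'(1) by auto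
            then show False using a'(3) ends by blast
          qed
        qed
        then have "a' + 1 = u - l + 2" by simp
        then show ?thesis using B ins(1)
          by (intro exI[of _ "qbin [:0, 1:] (a' + b' + 1) b' * B"]) (auto simp: poly_qbin simp del: qbin.simps)
      qed
    qed
    from step[of "l - 1"] obtain B1 where B1: "\<And>q. q > 0 \<Longrightarrow>
      q_fact q r * h q (move_unit c i (l - 1)) = block_fact S q * q_int q (u - l + 2) * poly B1 q" by auto
    from step[of "u + 1"] obtain B2 where B2: "\<And>q. q > 0 \<Longrightarrow>
      q_fact q r * h q (move_unit c i (u + 1)) = block_fact S q * q_int q (u - l + 2) * poly B2 q" by auto
    define B where "B = [:0, 1:] ^ (i - l + 1) * q_int [:0, 1:] (u + 1 - i) * B1 + q_int [:0, 1:] (i - l + 1) * B2"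
    have "q_fact q r * h q c = block_fact S q * poly B q" if q: "q > 0" for q
    proof -
      have "q_int q (u - l + 2) * (q_fact q r * h q c) =
         q ^ (i - l + 1) * q_int q (u + 1 - i) * (q_fact q r * h q (move_unit c i (l - 1))) +
        q_int q (i - l + 1) * (q_fact q r * h q (move_unit c i (u + 1)))"
        using gambler[OF q] by (simp add: algebra_simps)
      also have "\<dots> = q_int q (u - l + 2) * (block_fact S q * poly B q)"
        unfolding B1[OF q] B2[OF q] B_def by (simp add: poly_q_int algebra_simps)
      finally show ?thesis using q_int_pos[of "u - l + 2" q] q by simp
    qed
    then show ?thesis by (auto simp: S_def)
  qed
qed

section \<open>From values at positive numbers to polynomials\<close>

lemma real_poly_eqI_pos:
  fixes p p' :: "real poly"
  assumes "\<And>x. x > 0 \<Longrightarrow> poly p x = poly p' x"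
  shows "p = p'"
proof (rule ccontr)
  assume "p \<noteq> p'"
  then have "finite {x. poly (p - p') x = 0}" by (intro poly_roots_finite) simp
  moreover have "{0<..} \<subseteq> {x. poly (p - p') x = 0}" using assms by auto
  ultimately have "finite {0<..(1::real)}" by (rule_tac finite_subset) (auto intro: finite_subset)
  then show False using infinite_Ioc[of 0 "1::real"] by simp
qed

lemma is_remixed_eulerian_harmonic:
  assumes "is_remixed_eulerian r A"
  shows "q_harmonic r q (\<lambda>c. poly (A c) q)" "poly (A (ones r)) q = q_fact q r"
proof -
  have eq: "([:0, 1:] + 1) * A c = [:0, 1:] * A (move_unit c i (i - 1)) + A (move_unit c i (i + 1))"
    if "c \<in> weight_vectors r" "i \<in> {1..r}" "c i \<ge> 2" for c i
    using assms that by (auto simp: is_remixed_eulerian_def)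
  have "(q + 1) * poly (A c) q = q * poly (A (move_unit c i (i - 1))) q + poly (A (move_unit c i (i + 1))) q"
    if "c \<in> weight_vectors r" "i \<in> {1..r}" "c i \<ge> 2" for c i
    using arg_cong[OF eq[OF that], of "\<lambda>p. poly p q"] by (simp add: algebra_simps)
  then show "q_harmonic r q (\<lambda>c. poly (A c) q)"
    using assms by (auto simp: q_harmonic_def is_remixed_eulerian_def)
  show "poly (A (ones r)) q = q_fact q r"
    using assms by (auto simp: is_remixed_eulerian_def ones_def poly_q_fact)
qed

text \<open>This justifies the definite description. The solutions at the separate numbers q are
  values of polynomials by \<open>q_harmonic_polynomial\<close>; the recursion and uniqueness are
  both checked at positive arguments, which determine a polynomial.\<close>

lemma is_remixed_eulerian_remixed_eulerian: "is_remixed_eulerian r (remixed_eulerian r)"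
proof -
  have "\<exists>h. q_harmonic r q h \<and> h (ones r) = 1" if "q > 0" for q
    using spread_fixpoint_exists[OF that] spread_fixpoint_harmonic[OF that] by metis
  then obtain h where h: "\<And>q. q > 0 \<Longrightarrow> q_harmonic r q (h q)" "\<And>q. q > 0 \<Longrightarrow> h q (ones r) = 1"
    by metis
  have "\<exists>A. (\<forall>q>0. q_fact q r * h q c = poly A q) \<and> (c \<notin> weight_vectors r \<longrightarrow> A = 0)" for c
  proof (cases "c \<in> weight_vectors r")
    case True
    obtain B where B: "\<And>q. q > 0 \<Longrightarrow> q_fact q r * h q c = block_fact {j. c j > 0} q * poly B q"
      using q_harmonic_polynomial[OF h True] by auto
    have "poly (block_fact {j. c j > 0} [:0, 1:]) q = block_fact {j. c j > 0} q" for q :: real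
      by (simp add: block_fact_def poly_prod poly_q_int)
    then show ?thesis using True B by (intro exI[of _ "block_fact {j. c j > 0} [:0, 1:] * B"]) auto
  next
    case False
    then show ?thesis using h(1) by (intro exI[of _ 0]) (auto simp: q_harmonic_def)
  qed
  then obtain A where A: "\<And>c q. q > 0 \<Longrightarrow> poly (A c) q = q_fact q r * h q c"
      "\<And>c. c \<notin> weight_vectors r \<Longrightarrow> A c = 0"
    by metis
  have ex: "is_remixed_eulerian r A"
    unfolding is_remixed_eulerian_def
  proof (intro conjI ballI allI impI)
    show "A (\<lambda>i. if i \<in> {1..r} then 1 else 0) = q_fact [:0, 1:] r"
      unfolding ones_def[symmetric] using h(2) by (intro real_poly_eqI_pos) (simp add: A poly_q_fact)
    fix c i assume "c \<in> weight_vectors r" "i \<in> {1..r}" "2 \<le> c i"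
    then have eq: "(x + 1) * h x c = x * h x (move_unit c i (i - 1)) + h x (move_unit c i (i + 1))" if "x > 0" for x
      using h(1)[OF that] by (auto simp: q_harmonic_def)
    show "([:0, 1:] + 1) * A c = [:0, 1:] * A (move_unit c i (i - 1)) + A (move_unit c i (i + 1))"
    proof (rule real_poly_eqI_pos)
      fix x :: real assume "x > 0"
      then show "poly (([:0, 1:] + 1) * A c) x = poly ([:0, 1:] * A (move_unit c i (i - 1)) + A (move_unit c i (i + 1))) x"
        using arg_cong[OF eq, of x "\<lambda>y. q_fact x r * y"] by (simp add: A algebra_simps)
    qed
  qed (use A in auto)
  show ?thesis
    unfolding remixed_eulerian_def
  proof (rule theI[of "is_remixed_eulerian r", OF ex])
    fix A' assume A': "is_remixed_eulerian r A'"
    have "poly (A' c) x = poly (A c) x" if "x > 0" for c x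
      using q_harmonic_unique[OF that is_remixed_eulerian_harmonic(1)[OF A'] is_remixed_eulerian_harmonic(1)[OF ex]]
      by (simp add: is_remixed_eulerian_harmonic(2)[OF A'] is_remixed_eulerian_harmonic(2)[OF ex])
    then show "A' = A" by (intro ext real_poly_eqI_pos) auto
  qed
qed

text \<open>The bridge to geometry: there q is one fixed number, and a solution of the recursion at
  that number alone can be recognised as an evaluation of the polynomials.\<close>

theorem poly_remixed_eulerian_eq:
  assumes "q > 0" "q_harmonic r q h" "h (ones r) = q_fact q r"
  shows "h c = poly (remixed_eulerian r c) q"
  using q_harmonic_unique[OF assms(1,2) is_remixed_eulerian_harmonic(1)[OF is_remixed_eulerian_remixed_eulerian]]
    is_remixed_eulerian_harmonic(2)[OF is_remixed_eulerian_remixed_eulerian] assms(3) by simp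

section \<open>Degrees of monomials supported on chains\<close>

text \<open>Here \<open>d\<close> is the exponent of a flat and \<open>g\<close> the rank gap to the
  next flat of the chain. The power of \<open>q\<close> times the Gaussian binomial is the
  elementary symmetric function of degree \<open>e\<close> in q, ..., q^(g-1), that is, an unsigned
  coefficient of the reduced characteristic polynomial of the interval. The excess \<open>e\<close>
  is an integer because it can be negative, in which case the degree must vanish.\<close>

definition chain_factor :: "real \<Rightarrow> nat \<Rightarrow> int \<Rightarrow> nat \<Rightarrow> real" where
  "chain_factor q d e g = (if e < 0 \<or> d = 0 then 0 else
     (- 1) ^ (d - 1) * of_nat ((d - 1) choose nat e) * q ^ ((nat e + 1) choose 2) * qbin q (g - 1) (nat e))"

text \<open>The summand -1 cancels the artificial entry \<open>n 0 = 1\<close>, so this compares the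
  degree spent on flats of rank at most \<open>j\<close> with \<open>j\<close> itself.\<close>

definition excess :: "(nat \<Rightarrow> nat) \<Rightarrow> nat \<Rightarrow> int" where
  "excess n j = int (\<Sum>i\<le>j. n i) - 1 - int j"

definition next_supp :: "(nat \<Rightarrow> nat) \<Rightarrow> nat \<Rightarrow> nat" where
  "next_supp n j = (LEAST t. j < t \<and> n t > 0)"

definition chain_term :: "real \<Rightarrow> (nat \<Rightarrow> nat) \<Rightarrow> nat \<Rightarrow> real" where
  "chain_term q n j = (if n j = 0 then 1 else chain_factor q (n j) (excess n j) (next_supp n j - j))"

text \<open>Eur's formula for the degree of \<open>\<Prod> x\<^bsub>F\<^sub>j\<^esub>\<^bsup>n j\<^esup>\<close>, where the flat \<open>F\<^sub>j\<close> has rank \<open>j\<close>, for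
  projective geometries, whose reduced characteristic polynomials are \<open>\<Prod>(t - q\<^sup>i)\<close>. The empty
  flat and the ground set are included with \<open>n 0 = n (r + 1) = 1\<close>.\<close>

definition chain_deg :: "real \<Rightarrow> nat \<Rightarrow> (nat \<Rightarrow> nat) \<Rightarrow> real" where
  "chain_deg q r n = (\<Prod>j=0..r. chain_term q n j)"

definition bump :: "(nat \<Rightarrow> nat) \<Rightarrow> nat \<Rightarrow> nat \<Rightarrow> nat" where
  "bump n s = n(s := n s + 1)"

lemma bump_apply: "bump n s k = (if k = s then n s + 1 else n k)"
  by (simp add: bump_def)

lemma excess_bump: "excess (bump n s) j = excess n j + (if s \<le> j then 1 else 0)"
proof (cases "s \<le> j")
  case True
  then have "{..j} = insert s ({..j} - {s})" by auto
  moreover have "(\<Sum>i\<in>{..j} - {s}. bump n s i) = (\<Sum>i\<in>{..j} - {s}. n i)"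
    by (rule sum.cong) (auto simp: bump_def)
  ultimately have "(\<Sum>i\<le>j. bump n s i) = (\<Sum>i\<le>j. n i) + 1"
    by (smt (verit, best) add.commute add.left_commute bump_def finite_atMost fun_upd_same atMost_iff
        True sum.remove)
  then show ?thesis using True by (simp add: excess_def)
next
  case False
  then have "(\<Sum>i\<le>j. bump n s i) = (\<Sum>i\<le>j. n i)"
    by (intro sum.cong) (auto simp: bump_def)
  then show ?thesis using False by (simp add: excess_def)
qed

lemma excess_skip:
  assumes "b \<le> a" "\<And>k. b < k \<Longrightarrow> k \<le> a \<Longrightarrow> n k = 0"
  shows "excess n a = excess n b - int (a - b)"
proof -
  have "{..a} = {..b} \<union> {b<..a}" using assms by auto
  moreover have "{..b} \<inter> {b<..a} = {}" by auto
  ultimately have "(\<Sum>i\<le>a. n i) = (\<Sum>i\<le>b. n i) + (\<Sum>i\<in>{b<..a}. n i)"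
    by (simp add: sum.union_disjoint)
  also have "(\<Sum>i\<in>{b<..a}. n i) = 0" using assms by auto
  finally show ?thesis using assms by (simp add: excess_def)
qed

lemma excess_next:
  assumes "b < a" "\<And>k. b < k \<Longrightarrow> k < a \<Longrightarrow> n k = 0"
  shows "excess n a = excess n b + int (n a) - int (a - b)"
proof -
  have "excess n (a - 1) = excess n b - int (a - 1 - b)"
    by (rule excess_skip) (use assms in auto)
  moreover have "excess n a = excess n (a - 1) + int (n a) - 1"
    using assms by (cases a) (auto simp: excess_def)
  ultimately show ?thesis using assms(1) by auto
qed

lemma next_supp_eqI:
  assumes "j < t" "n t > 0" "\<And>k. j < k \<Longrightarrow> k < t \<Longrightarrow> n k = 0"
  shows "next_supp n j = t"
  unfolding next_supp_def
proof (rule Least_equality)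
  fix y assume "j < y \<and> 0 < n y"
  then show "t \<le> y" using assms(3)[of y] by (cases "y < t") auto
qed (use assms in auto)

lemma next_supp_cong:
  assumes "j < t" "n t > 0" "\<And>k. j < k \<Longrightarrow> k \<le> t \<Longrightarrow> n' k > 0 \<longleftrightarrow> n k > 0"
  shows "next_supp n' j = next_supp n j"
proof -
  define u where "u = next_supp n j"
  have u: "j < u \<and> n u > 0" unfolding u_def next_supp_def by (rule LeastI[of _ t]) (use assms in simp)
  have ut: "u \<le> t" unfolding u_def next_supp_def by (rule Least_le) (use assms in simp)
  have below: "n k = 0" if "j < k" "k < u" for k
    using not_less_Least[of k "\<lambda>t. j < t \<and> n t > 0"] that by (auto simp: u_def next_supp_def)
  have "next_supp n' j = u"
  proof (rule next_supp_eqI)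
    fix k assume "j < k" "k < u"
    then show "n' k = 0" using below[of k] assms(3)[of k] ut by simp
  qed (use u ut assms(3) in auto)
  then show ?thesis by (simp add: u_def)
qed

text \<open>A flat of exponent 1 contributes only at excess 0. This is what singles out one rank in
  each sum of \<open>chain_deg_relation\<close>.\<close>

lemma chain_factor_1: "chain_factor q 1 e g = (if e = 0 then 1 else 0)"
  by (auto simp: chain_factor_def binomial_eq_0 simp flip: One_nat_def)

text \<open>At gap \<open>nat e + 1\<close> the Gaussian binomial inside the factor is 1, so this
  gap isolates the part that does not depend on \<open>g\<close>.\<close>

lemma chain_factor_gap:
  assumes "0 \<le> e"
  shows "qbin q (g - 1) (nat e) * chain_factor q d e (nat e + 1) = chain_factor q d e g"
  using assms by (simp add: chain_factor_def)

text \<open>Pascal's rule for \<open>d choose (e + 1)\<close>, combined with (e+2 choose 2) = (e+1)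
  + (e+1 choose 2) for the powers of \<open>q\<close>. For negative \<open>e\<close> the second
  summand is absent.\<close>

lemma chain_factor_pascal:
  assumes "d > 0"
  shows "chain_factor q (d + 1) (e + 1) g = - chain_factor q d (e + 1) g -
    (if 0 \<le> e then q ^ (nat e + 1) * qbin q (g - 1) (nat e + 1) * chain_factor q d e (nat e + 1) else 0)"
proof (cases "0 \<le> e")
  case True
  obtain d' where d: "d = Suc d'" using assms by (cases d) auto
  obtain m where e: "e = int m" using True nonneg_int_cases by blast
  have n: "nat (int m + 1) = Suc m" by simp
  have c: "Suc (Suc m) choose 2 = Suc m + (Suc m choose 2)"
    by (simp add: numeral_2_eq_2)
  show ?thesis
    unfolding e chain_factor_def n
    by (simp add: c d power_add ring_distribs mult_ac del: qbin.simps)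
next
  case False
  obtain d' where d: "d = Suc d'" using assms by (cases d) auto
  show ?thesis
  proof (cases "e = - 1")
    case True
    then show ?thesis by (simp add: chain_factor_def d)
  next
    case False
    then show ?thesis using \<open>\<not> 0 \<le> e\<close> by (simp add: chain_factor_def)
  qed
qed

text \<open>The numerical form of a linear relation times a monomial: \<open>a\<close> is the rank
  of a flat of the chain, \<open>b\<close> and \<open>t\<close> are the ranks of its neighbours, and
  one variable is added. The coefficients count flats below it through a given point and flats above
  it that avoid a given point. In each sum at most one rank contributes, and what remains is
  \<open>chain_factor_pascal\<close>.\<close>

lemma chain_deg_relation:
  fixes q :: real
  assumes "b < a" "a < t" "t \<le> r + 1" "n b > 0" "n a > 0" "n t > 0"
    and zba: "\<And>k. b < k \<Longrightarrow> k < a \<Longrightarrow> n k = 0" and zat: "\<And>k. a < k \<Longrightarrow> k < t \<Longrightarrow> n k = 0"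
    and top: "n (r + 1) > 0"
  shows "chain_deg q r (bump n a) =
    - (\<Sum>s\<in>{b<..<a}. qbin q (a - b - 1) (s - b - 1) * chain_deg q r (bump n s))
    - (\<Sum>s\<in>{a<..<t}. q ^ (s - a) * qbin q (t - a - 1) (s - a) * chain_deg q r (bump n s))"
proof -
  \<comment> \<open>Factors below \<open>b\<close> do not see the added variable, and those from
    \<open>t\<close> on see only that the total below them grew by 1. Both are therefore common to
    all \<open>s\<close> strictly between \<open>b\<close> and \<open>t\<close>.\<close>
  define P where "P = (\<Prod>j\<in>{0..<b}. chain_term q n j)"
  define S where "S = (\<Prod>j\<in>{t..r}. chain_term q (bump n a) j)"
  define M where "M s = (\<Prod>j\<in>{b..<t}. chain_term q (bump n s) j)" for s
  define Vb where "Vb = chain_factor q (n b) (excess n b)"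
  define e where "e = excess n a"
  have eb: "e = excess n b + int (n a) - int (a - b)"
    unfolding e_def by (rule excess_next) (use assms in auto)
  have split: "chain_deg q r (bump n s) = P * S * M s" if s: "b < s" "s < t" for s
  proof -
    have disj: "({0..<b} \<union> {b..<t}) \<inter> {t..r} = {}" "{0..<b} \<inter> {b..<t} = {}" using assms by auto
    have "{0..r} = {0..<b} \<union> {b..<t} \<union> {t..r}" using assms by auto
    then have "chain_deg q r (bump n s) = (\<Prod>j\<in>{0..<b}. chain_term q (bump n s) j) * M s *
        (\<Prod>j\<in>{t..r}. chain_term q (bump n s) j)"
      unfolding chain_deg_def M_def using disj by (simp add: prod.union_disjoint)
    moreover have "(\<Prod>j\<in>{0..<b}. chain_term q (bump n s) j) = P"
      unfolding P_def
    proof (rule prod.cong)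
      fix j assume j: "j \<in> {0..<b}"
      have "next_supp (bump n s) j = next_supp n j"
        by (rule next_supp_cong[where t = b]) (use j s assms in \<open>auto simp: bump_def\<close>)
      moreover have "bump n s j = n j" using j s by (auto simp: bump_def)
      ultimately show "chain_term q (bump n s) j = chain_term q n j"
        using j s by (simp add: chain_term_def excess_bump)
    qed simp
    moreover have "(\<Prod>j\<in>{t..r}. chain_term q (bump n s) j) = S"
      unfolding S_def
    proof (rule prod.cong)
      fix j assume j: "j \<in> {t..r}"
      have "next_supp (bump n s) j = next_supp (bump n a) j"
        by (rule next_supp_cong[where t = "r + 1"]) (use j s assms in \<open>auto simp: bump_def\<close>)
      moreover have "bump n s j = bump n a j" using j s assms by (auto simp: bump_def)
      ultimately show "chain_term q (bump n s) j = chain_term q (bump n a) j"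
        using j s assms by (simp add: chain_term_def excess_bump)
    qed simp
    ultimately show ?thesis by simp
  qed
  have term0: "chain_term q (bump n s) j = 1" if "j \<in> {b..<t}" "j \<noteq> b" "j \<noteq> a" "j \<noteq> s" for j s
    using that zba[of j] zat[of j] by (cases j a rule: linorder_cases) (auto simp: chain_term_def bump_def)
  have M_sub: "M s = (\<Prod>j\<in>T. chain_term q (bump n s) j)"
    if "T \<subseteq> {b..<t}" "b \<in> T" "a \<in> T" "s \<in> T" for s T
    unfolding M_def
  proof (rule prod.mono_neutral_right)
    show "\<forall>j\<in>{b..<t} - T. chain_term q (bump n s) j = 1" using that by (auto intro: term0)
  qed (use that in auto)
  have Ma: "M a = Vb (a - b) * chain_factor q (n a + 1) (e + 1) (t - a)"
  proof -
    have "next_supp (bump n a) b = a"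
      by (rule next_supp_eqI) (use assms in \<open>auto simp: bump_def\<close>)
    moreover have "next_supp (bump n a) a = t"
      by (rule next_supp_eqI) (use assms in \<open>auto simp: bump_def\<close>)
    moreover have "M a = (\<Prod>j\<in>{b, a}. chain_term q (bump n a) j)"
      by (rule M_sub) (use assms(1,2) in auto)
    ultimately show ?thesis
      using assms(1,4,5)
      by (simp add: chain_term_def excess_bump bump_apply Vb_def e_def)
  qed
  have Ml: "M s = Vb (s - b) * chain_factor q 1 (excess n b + 1 - int (s - b)) (a - s) * chain_factor q (n a) (e + 1) (t - a)"
    if s: "b < s" "s < a" for s
  proof -
    define x where "x = excess n b + 1 - int (s - b)"
    have "next_supp (bump n s) b = s"
      by (rule next_supp_eqI) (use s zba in \<open>auto simp: bump_def\<close>)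
    moreover have "next_supp (bump n s) s = a"
      by (rule next_supp_eqI) (use s zba assms(5) in \<open>auto simp: bump_def\<close>)
    moreover have "next_supp (bump n s) a = t"
      by (rule next_supp_eqI) (use s zat assms(2,6) in \<open>auto simp: bump_def\<close>)
    moreover have "excess n s = x - 1"
      using excess_skip[of b s n] s zba by (auto simp: x_def)
    moreover have "M s = (\<Prod>j\<in>{b, s, a}. chain_term q (bump n s) j)"
      by (rule M_sub) (use s assms(1,2) in auto)
    ultimately show ?thesis
      unfolding x_def[symmetric] using s assms(4,5) zba[OF s]
      by (simp add: chain_term_def excess_bump bump_apply Vb_def e_def mult_ac)
  qed
  have Mr: "M s = Vb (a - b) * chain_factor q (n a) e (s - a) * chain_factor q 1 (e + 1 - int (s - a)) (t - s)"
    if s: "a < s" "s < t" for s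
  proof -
    define x where "x = e + 1 - int (s - a)"
    have "next_supp (bump n s) b = a"
      by (rule next_supp_eqI) (use s zba assms(1,5) in \<open>auto simp: bump_def\<close>)
    moreover have "next_supp (bump n s) a = s"
      by (rule next_supp_eqI) (use s zat in \<open>auto simp: bump_def\<close>)
    moreover have "next_supp (bump n s) s = t"
      by (rule next_supp_eqI) (use s zat assms(6) in \<open>auto simp: bump_def\<close>)
    moreover have "excess n s = x - 1"
      using excess_skip[of a s n] s zat by (auto simp: x_def e_def)
    moreover have "M s = (\<Prod>j\<in>{b, a, s}. chain_term q (bump n s) j)"
      by (rule M_sub) (use s assms(1,2) in auto)
    ultimately show ?thesis
      unfolding x_def[symmetric] using s assms(1,4,5) zat[OF s]
      by (simp add: chain_term_def excess_bump bump_apply Vb_def e_def mult_ac)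
  qed
  have left: "(\<Sum>s\<in>{b<..<a}. qbin q (a - b - 1) (s - b - 1) * M s) = Vb (a - b) * chain_factor q (n a) (e + 1) (t - a)"
  proof (cases "0 \<le> excess n b \<and> excess n b + 1 < int (a - b)")
    case True
    \<comment> \<open>The rank at which the inserted flat has excess 0.\<close>
    define s0 where "s0 = b + nat (excess n b) + 1"
    have s0: "s0 \<in> {b<..<a}" using True by (auto simp: s0_def)
    have "(\<Sum>s\<in>{b<..<a}. qbin q (a - b - 1) (s - b - 1) * M s) = (\<Sum>s\<in>{s0}. qbin q (a - b - 1) (s - b - 1) * M s)"
      using s0 by (intro sum.mono_neutral_right) (auto simp: Ml chain_factor_1[unfolded One_nat_def] s0_def)
    also have "\<dots> = qbin q (a - b - 1) (nat (excess n b)) * Vb (nat (excess n b) + 1) * chain_factor q (n a) (e + 1) (t - a)"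
      using s0 True by (simp add: Ml chain_factor_1[unfolded One_nat_def]) (simp add: s0_def)
    also have "\<dots> = Vb (a - b) * chain_factor q (n a) (e + 1) (t - a)"
      using chain_factor_gap[of "excess n b" q "a - b" "n b"] True by (simp add: Vb_def)
    finally show ?thesis .
  next
    case False
    have 0: "M s = 0" if s: "b < s" "s < a" for s
    proof (cases "excess n b < 0")
      case True
      then show ?thesis using s by (simp add: Ml Vb_def chain_factor_def)
    next
      case False
      with \<open>\<not> (_ \<and> _)\<close> have "excess n b + 1 - int (s - b) \<noteq> 0" using s by auto
      then show ?thesis using s by (simp add: Ml chain_factor_1[unfolded One_nat_def])
    qed
    \<comment> \<open>No rank contributes on the left, so the right side must vanish by itself:
      through a negative excess, a Gaussian binomial out of range, or the binomial coefficient of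
      \<open>n a - 1\<close> over \<open>n a\<close>.\<close>
    consider "excess n b < 0" | "excess n b + 1 > int (a - b)" | "excess n b + 1 = int (a - b)"
      using False by linarith
    then have "Vb (a - b) * chain_factor q (n a) (e + 1) (t - a) = 0"
    proof cases
      case 1
      then show ?thesis by (simp add: Vb_def chain_factor_def)
    next
      case 2
      then have "nat (excess n b) > a - b - 1" using \<open>b < a\<close> by linarith
      then show ?thesis by (simp add: Vb_def chain_factor_def qbin_eq_0)
    next
      case 3
      then have "nat (e + 1) = n a" using eb by simp
      then show ?thesis using \<open>n a > 0\<close> by (simp add: chain_factor_def binomial_eq_0)
    qed
    then show ?thesis using 0 by simp
  qed
  have right: "(\<Sum>s\<in>{a<..<t}. q ^ (s - a) * qbin q (t - a - 1) (s - a) * M s) = Vb (a - b) *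
     (if 0 \<le> e then q ^ (nat e + 1) * qbin q (t - a - 1) (nat e + 1) * chain_factor q (n a) e (nat e + 1) else 0)"
  proof (cases "0 \<le> e \<and> e + 1 < int (t - a)")
    case True
    define s0 where "s0 = a + nat e + 1"
    have s0: "s0 \<in> {a<..<t}" using True by (auto simp: s0_def)
    have "(\<Sum>s\<in>{a<..<t}. q ^ (s - a) * qbin q (t - a - 1) (s - a) * M s) = (\<Sum>s\<in>{s0}. q ^ (s - a) * qbin q (t - a - 1) (s - a) * M s)"
      using s0 by (intro sum.mono_neutral_right) (auto simp: Mr chain_factor_1[unfolded One_nat_def] s0_def)
    also have "\<dots> = q ^ (nat e + 1) * qbin q (t - a - 1) (nat e + 1) * (Vb (a - b) * chain_factor q (n a) e (nat e + 1))"
      using s0 True by (simp add: Mr chain_factor_1[unfolded One_nat_def]) (simp add: s0_def)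
    finally show ?thesis using True by (simp add: mult_ac)
  next
    case False
    have 0: "M s = 0" if s: "a < s" "s < t" for s
    proof (cases "e < 0")
      case True
      then show ?thesis using s by (simp add: Mr chain_factor_def)
    next
      case False
      with \<open>\<not> (_ \<and> _)\<close> have "e + 1 - int (s - a) \<noteq> 0" using s by auto
      then show ?thesis using s by (simp add: Mr chain_factor_1[unfolded One_nat_def])
    qed
    have "qbin q (t - a - 1) (nat e + 1) = 0" if "0 \<le> e"
      using False that by (intro qbin_eq_0) linarith
    then show ?thesis using 0 by simp
  qed
  have "M a = - (\<Sum>s\<in>{b<..<a}. qbin q (a - b - 1) (s - b - 1) * M s)
    - (\<Sum>s\<in>{a<..<t}. q ^ (s - a) * qbin q (t - a - 1) (s - a) * M s)"
    unfolding left right Ma chain_factor_pascal[OF \<open>n a > 0\<close>] by (simp add: algebra_simps)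
  then have "P * S * M a = - (\<Sum>s\<in>{b<..<a}. qbin q (a - b - 1) (s - b - 1) * (P * S * M s))
    - (\<Sum>s\<in>{a<..<t}. q ^ (s - a) * qbin q (t - a - 1) (s - a) * (P * S * M s))"
    by (simp add: sum_distrib_left right_diff_distrib mult_ac)
  then show ?thesis using split assms(1,2) by simp
qed

lemma chain_deg_ones:
  assumes "\<And>j. j \<le> r + 1 \<Longrightarrow> n j = 1"
  shows "chain_deg q r n = 1"
proof -
  have "chain_term q n j = 1" if "j \<le> r" for j
  proof -
    have "(\<Sum>i\<le>j. n i) = j + 1" using assms that by (simp add: sum.cong)
    then have "excess n j = 0" by (simp add: excess_def)
    then show ?thesis using assms[of j] that by (simp add: chain_term_def chain_factor_1[unfolded One_nat_def])
  qed
  then show ?thesis by (simp add: chain_deg_def)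
qed

section \<open>A degree functional on the Chow ring\<close>

lemma poly_mapping_sum_single:
  "(\<Sum>u\<in>Poly_Mapping.keys p. Poly_Mapping.single u (Poly_Mapping.lookup p u)) = p"
proof (rule poly_mapping_eqI)
  fix k
  have "(\<Sum>u\<in>Poly_Mapping.keys p. Poly_Mapping.lookup (Poly_Mapping.single u (Poly_Mapping.lookup p u)) k)
    = (\<Sum>u\<in>Poly_Mapping.keys p. if u = k then Poly_Mapping.lookup p u else 0)"
    by (rule sum.cong) (auto simp: lookup_single when_def)
  also have "\<dots> = Poly_Mapping.lookup p k"
    by (auto simp: sum.delta' in_keys_iff)
  finally show "Poly_Mapping.lookup (\<Sum>u\<in>Poly_Mapping.keys p. Poly_Mapping.single u (Poly_Mapping.lookup p u)) k
    = Poly_Mapping.lookup p k"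
    by (simp add: lookup_sum)
qed

lemma mpoly_eq_sum_monomials:
  "(\<Sum>u\<in>Poly_Mapping.keys p. mconst (Poly_Mapping.lookup p u) * Poly_Mapping.single u 1) = p"
  using poly_mapping_sum_single[of p] by (simp add: mconst_def mult_single)

definition linear_ext :: "('b \<Rightarrow> real) \<Rightarrow> ('b \<Rightarrow>\<^sub>0 real) \<Rightarrow> real" where
  "linear_ext f p = (\<Sum>u\<in>Poly_Mapping.keys p. Poly_Mapping.lookup p u * f u)"

lemma linear_ext_superset:
  assumes "finite K" "Poly_Mapping.keys p \<subseteq> K"
  shows "linear_ext f p = (\<Sum>u\<in>K. Poly_Mapping.lookup p u * f u)"
  unfolding linear_ext_def using assms by (intro sum.mono_neutral_left) (auto simp: in_keys_iff)

lemma linear_ext_single [simp]: "linear_ext f (Poly_Mapping.single u t) = t * f u"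
  using linear_ext_superset[of "{u}" "Poly_Mapping.single u t" f] by simp

lemma linear_ext_add: "linear_ext f (p + p') = linear_ext f p + linear_ext f p'"
proof -
  let ?K = "Poly_Mapping.keys p \<union> Poly_Mapping.keys p'"
  have "linear_ext f (p + p') = (\<Sum>u\<in>?K. Poly_Mapping.lookup (p + p') u * f u)"
    by (rule linear_ext_superset) (use keys_add[of p p'] in auto)
  also have "\<dots> = (\<Sum>u\<in>?K. Poly_Mapping.lookup p u * f u) + (\<Sum>u\<in>?K. Poly_Mapping.lookup p' u * f u)"
    by (simp add: lookup_add sum.distrib algebra_simps)
  also have "\<dots> = linear_ext f p + linear_ext f p'"
    using linear_ext_superset[of ?K p f] linear_ext_superset[of ?K p' f] by simp
  finally show ?thesis .
qed

lemma linear_ext_0 [simp]: "linear_ext f 0 = 0"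
  by (simp add: linear_ext_def)

lemma linear_ext_sum: "linear_ext f (\<Sum>x\<in>X. g x) = (\<Sum>x\<in>X. linear_ext f (g x))"
  by (induction X rule: infinite_finite_induct) (auto simp: linear_ext_add)

lemma linear_ext_uminus: "linear_ext f (- p) = - linear_ext f p"
  using linear_ext_add[of f p "- p"] by simp

lemma linear_ext_diff: "linear_ext f (p - p') = linear_ext f p - linear_ext f p'"
  using linear_ext_add[of f p "- p'"] by (simp add: linear_ext_uminus)

lemma linear_ext_mconst: "linear_ext f (mconst t * p) = t * linear_ext f p"
proof -
  have "linear_ext f (mconst t * p) = linear_ext f (\<Sum>u\<in>Poly_Mapping.keys p. Poly_Mapping.single u (t * Poly_Mapping.lookup p u))"
    by (subst (1) poly_mapping_sum_single[of p, symmetric])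
       (simp add: sum_distrib_left mconst_def mult_single)
  then show ?thesis by (simp add: linear_ext_sum linear_ext_def[of f p] sum_distrib_left mult_ac)
qed

definition mon_deg :: "('a set \<Rightarrow>\<^sub>0 nat) \<Rightarrow> nat" where
  "mon_deg u = (\<Sum>F\<in>Poly_Mapping.keys u. Poly_Mapping.lookup u F)"

definition times_var :: "('a set \<Rightarrow>\<^sub>0 nat) \<Rightarrow> 'a set \<Rightarrow> ('a set \<Rightarrow>\<^sub>0 nat)" where
  "times_var u F = u + Poly_Mapping.single F 1"

lemma keys_nat_add: "Poly_Mapping.keys (u + v) = Poly_Mapping.keys u \<union> Poly_Mapping.keys (v :: 'b \<Rightarrow>\<^sub>0 nat)"
  by (auto simp: in_keys_iff lookup_add)

lemma keys_times_var: "Poly_Mapping.keys (times_var u F) = insert F (Poly_Mapping.keys u)"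
  by (auto simp: times_var_def keys_nat_add)

lemma sum_nat_mapping_superset:
  fixes u :: "'b \<Rightarrow>\<^sub>0 nat"
  assumes "finite K" "Poly_Mapping.keys u \<subseteq> K"
  shows "(\<Sum>F\<in>{F\<in>Poly_Mapping.keys u. P F}. Poly_Mapping.lookup u F) = (\<Sum>F\<in>{F\<in>K. P F}. Poly_Mapping.lookup u F)"
  using assms by (intro sum.mono_neutral_left) (auto simp: in_keys_iff)

lemma sum_nat_mapping_add:
  fixes u v :: "'b \<Rightarrow>\<^sub>0 nat"
  shows "(\<Sum>F\<in>{F\<in>Poly_Mapping.keys (u + v). P F}. Poly_Mapping.lookup (u + v) F) =
    (\<Sum>F\<in>{F\<in>Poly_Mapping.keys u. P F}. Poly_Mapping.lookup u F) +
    (\<Sum>F\<in>{F\<in>Poly_Mapping.keys v. P F}. Poly_Mapping.lookup v F)"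
proof -
  let ?K = "Poly_Mapping.keys u \<union> Poly_Mapping.keys v"
  show ?thesis
    using sum_nat_mapping_superset[of ?K u P] sum_nat_mapping_superset[of ?K v P]
    by (simp add: keys_nat_add lookup_add sum.distrib)
qed

lemma mon_deg_add: "mon_deg (u + v) = mon_deg u + mon_deg v"
  using sum_nat_mapping_add[where P = "\<lambda>_. True", of u v] by (simp add: mon_deg_def)

lemma mon_deg_times_var: "mon_deg (times_var u F) = mon_deg u + 1"
  by (simp add: mon_deg_add times_var_def) (simp add: mon_deg_def)

lemma homogeneous_iff: "homogeneous d p \<longleftrightarrow> (\<forall>u\<in>Poly_Mapping.keys p. mon_deg u = d)"
  by (simp add: homogeneous_def mon_deg_def)

lemma single_mult_mvar: "Poly_Mapping.single u t * mvar F = Poly_Mapping.single (times_var u F) t"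
  by (simp add: mvar_def mult_single times_var_def)

text \<open>The Chow ring computation uses only these counts in intervals, which keeps linear
  algebra out of it. The empty set and the ground set act as flats of ranks 0 and
  \<open>r + 1\<close>; they are inserted explicitly because \<open>proper_flats\<close> excludes
  them.\<close>

locale q_geometry =
  fixes M :: "'a matroid" and q r :: nat
  assumes finite_ground: "finite (ground M)"
    and q_pos: "q > 0"
    and rank_empty: "mrank M {} = 0"
    and rank_ground: "mrank M (ground M) = r + 1"
    and rank_strict: "A \<in> insert {} (proper_flats M) \<Longrightarrow> B \<in> insert (ground M) (proper_flats M) \<Longrightarrow>
      A \<subset> B \<Longrightarrow> mrank M A < mrank M B"
    and card_flat: "F \<in> insert (ground M) (proper_flats M) \<Longrightarrow> card F = q_int q (mrank M F)"
    and card_between: "A \<in> insert {} (proper_flats M) \<Longrightarrow> B \<in> insert (ground M) (proper_flats M) \<Longrightarrow>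
      A \<subset> B \<Longrightarrow> mrank M A < s \<Longrightarrow> s < mrank M B \<Longrightarrow>
      real (card {G \<in> proper_flats M. A \<subset> G \<and> G \<subset> B \<and> mrank M G = s}) =
        qbin (real q) (mrank M B - mrank M A) (s - mrank M A)"
    and card_between_point: "A \<in> insert {} (proper_flats M) \<Longrightarrow> B \<in> insert (ground M) (proper_flats M) \<Longrightarrow>
      A \<subset> B \<Longrightarrow> mrank M A < s \<Longrightarrow> s < mrank M B \<Longrightarrow> i \<in> B - A \<Longrightarrow>
      real (card {G \<in> proper_flats M. A \<subset> G \<and> G \<subset> B \<and> i \<in> G \<and> mrank M G = s}) =
        qbin (real q) (mrank M B - mrank M A - 1) (s - mrank M A - 1)"
begin

abbreviation flats where "flats \<equiv> proper_flats M"
abbreviation pts where "pts \<equiv> ground M"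
abbreviation rk where "rk \<equiv> mrank M"

lemma flat_psubset: "F \<in> flats \<Longrightarrow> {} \<subset> F \<and> F \<subset> pts"
  by (auto simp: proper_flats_def is_flat_def)

lemma finite_flats: "finite flats"
  by (rule finite_subset[of _ "Pow pts"]) (use flat_psubset finite_ground in auto)

lemma rk_flat: "F \<in> flats \<Longrightarrow> 1 \<le> rk F \<and> rk F \<le> r"
  using rank_strict[of "{}" F] rank_strict[of F pts] flat_psubset[of F] rank_empty rank_ground by auto

lemma rk_mono: "A \<in> flats \<Longrightarrow> B \<in> flats \<Longrightarrow> A \<subseteq> B \<Longrightarrow> rk A \<le> rk B"
  using rank_strict[of A B] by (cases "A = B") (auto simp: psubset_eq)

text \<open>Among all flats of rank \<open>s\<close> in the interval, those through \<open>i\<close>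
  account for the first summand of Pascal's rule, so those avoiding \<open>i\<close> account for the
  second.\<close>

lemma card_avoiding_point:
  assumes "A \<in> insert {} flats" "B \<in> insert pts flats" "A \<subset> B" "rk A < s" "s < rk B" "i \<in> B - A"
  shows "real (card {G \<in> flats. A \<subset> G \<and> G \<subset> B \<and> i \<notin> G \<and> rk G = s}) =
    real q ^ (s - rk A) * qbin (real q) (rk B - rk A - 1) (s - rk A)"
proof -
  obtain g where g: "rk B - rk A = Suc g" using assms by (metis Suc_diff_Suc less_trans)
  obtain k where k: "s - rk A = Suc k" using assms by (metis Suc_diff_Suc)
  let ?X = "{G \<in> flats. A \<subset> G \<and> G \<subset> B \<and> rk G = s}"
  let ?Y = "{G \<in> flats. A \<subset> G \<and> G \<subset> B \<and> i \<in> G \<and> rk G = s}"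
  let ?Z = "{G \<in> flats. A \<subset> G \<and> G \<subset> B \<and> i \<notin> G \<and> rk G = s}"
  have "?X = ?Y \<union> ?Z" "?Y \<inter> ?Z = {}" by auto
  then have "card ?X = card ?Y + card ?Z"
    using finite_flats by (metis (no_types, lifting) card_Un_disjoint finite_Un finite_subset mem_Collect_eq subsetI)
  then show ?thesis
    using card_between[OF assms(1-5)] card_between_point[OF assms] by (simp add: g k)
qed

definition chain_mon :: "('a set \<Rightarrow>\<^sub>0 nat) \<Rightarrow> bool" where
  "chain_mon u \<longleftrightarrow> Poly_Mapping.keys u \<subseteq> flats \<and>
    (\<forall>F\<in>Poly_Mapping.keys u. \<forall>G\<in>Poly_Mapping.keys u. F \<subseteq> G \<or> G \<subseteq> F)"

text \<open>On a chain at most one flat has a given rank, so the sum has at most one term. The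
  entries at 0 and \<open>r + 1\<close> follow the convention of \<open>chain_deg\<close>.\<close>

definition rank_exps :: "('a set \<Rightarrow>\<^sub>0 nat) \<Rightarrow> nat \<Rightarrow> nat" where
  "rank_exps u j = (if j = 0 \<or> j = r + 1 then 1 else
     \<Sum>F\<in>{F \<in> Poly_Mapping.keys u. rk F = j}. Poly_Mapping.lookup u F)"

definition mon_val :: "('a set \<Rightarrow>\<^sub>0 nat) \<Rightarrow> real" where
  "mon_val u = (if chain_mon u \<and> mon_deg u = r then chain_deg (real q) r (rank_exps u) else 0)"

definition val :: "'a mpoly \<Rightarrow> real" where
  "val = linear_ext mon_val"

lemma chain_mon_times_var:
  "chain_mon (times_var u G) \<longleftrightarrow> chain_mon u \<and> G \<in> flats \<and> (\<forall>F\<in>Poly_Mapping.keys u. F \<subseteq> G \<or> G \<subseteq> F)"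
proof -
  have "(\<forall>F\<in>insert G K. \<forall>F'\<in>insert G K. P F F') \<longleftrightarrow> (\<forall>F\<in>K. \<forall>F'\<in>K. P F F') \<and> (\<forall>F\<in>K. P F G)"
    if "P G G" "\<And>F F'. P F F' = P F' F" for K and P :: "'a set \<Rightarrow> 'a set \<Rightarrow> bool"
    using that by blast
  from this[of "\<lambda>F F'. F \<subseteq> F' \<or> F' \<subseteq> F"]
  show ?thesis unfolding chain_mon_def keys_times_var by auto
qed

lemma rank_exps_times_var:
  assumes "G \<in> flats"
  shows "rank_exps (times_var u G) = bump (rank_exps u) (rk G)"
proof
  fix j
  have *: "{F \<in> {G}. rk F = j} = (if rk G = j then {G} else {})" by auto
  show "rank_exps (times_var u G) j = bump (rank_exps u) (rk G) j"
    using rk_flat[OF assms] unfolding rank_exps_def bump_apply times_var_def sum_nat_mapping_add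
    by (simp only: keys_single[of G "1::nat"] one_neq_zero if_False *) auto
qed

lemma chain_neighbours:
  assumes "chain_mon u" "F \<in> Poly_Mapping.keys u"
  obtains A B where "A \<in> insert {} (Poly_Mapping.keys u)" "B \<in> insert pts (Poly_Mapping.keys u)"
    "A \<subset> F" "F \<subset> B" "\<And>G. G \<in> Poly_Mapping.keys u \<Longrightarrow> G \<subseteq> A \<or> G = F \<or> B \<subseteq> G"
proof -
  let ?K = "Poly_Mapping.keys u"
  have K: "?K \<subseteq> flats" and ch: "\<And>F G. F \<in> ?K \<Longrightarrow> G \<in> ?K \<Longrightarrow> F \<subseteq> G \<or> G \<subseteq> F"
    using assms by (auto simp: chain_mon_def)
  have ps: "{} \<subset> F" "F \<subset> pts" using K assms flat_psubset by auto
  define X where "X = insert {} {G \<in> ?K. G \<subset> F}"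
  have "finite X" "X \<noteq> {}" by (auto simp: X_def)
  then obtain A where A: "A \<in> X" "\<And>G. G \<in> X \<Longrightarrow> A \<subseteq> G \<Longrightarrow> G = A"
    by (metis finite_has_maximal)
  define Y where "Y = insert pts {G \<in> ?K. F \<subset> G}"
  have "finite Y" "Y \<noteq> {}" by (auto simp: Y_def)
  then obtain B where B: "B \<in> Y" "\<And>G. G \<in> Y \<Longrightarrow> G \<subseteq> B \<Longrightarrow> G = B"
    by (metis finite_has_minimal)
  have Xch: "G \<subseteq> G' \<or> G' \<subseteq> G" if "G \<in> X" "G' \<in> X" for G G'
    using that ch by (auto simp: X_def)
  have Ych: "G \<subseteq> G' \<or> G' \<subseteq> G" if "G \<in> Y" "G' \<in> Y" for G G'
    using that ch flat_psubset K by (auto simp: Y_def)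
  show ?thesis
  proof (rule that[of A B])
    fix G assume G: "G \<in> ?K"
    with ch[of G F] assms(2) consider "G \<in> X" | "G = F" | "G \<in> Y" by (auto simp: X_def Y_def)
    then show "G \<subseteq> A \<or> G = F \<or> B \<subseteq> G"
    proof cases
      case 1
      then show ?thesis using Xch[of G A] A by auto
    next
      case 3
      then show ?thesis using Ych[of G B] B by auto
    qed auto
  qed (use A B ps in \<open>auto simp: X_def Y_def\<close>)
qed

lemma sum_by_rank:
  assumes "\<And>G. G \<in> X \<Longrightarrow> rk G \<in> S" "finite S" "finite X"
  shows "(\<Sum>G\<in>X. f (rk G)) = (\<Sum>s\<in>S. real (card {G \<in> X. rk G = s}) * f s)"
proof -
  have "(\<Sum>G\<in>X. f (rk G)) = (\<Sum>s\<in>S. \<Sum>G\<in>{G \<in> X. rk G = s}. f (rk G))"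
    using assms by (subst sum.group) auto
  also have "\<dots> = (\<Sum>s\<in>S. real (card {G \<in> X. rk G = s}) * f s)"
    by (rule sum.cong) auto
  finally show ?thesis .
qed

lemma mon_val_times_var:
  assumes "chain_mon u" "mon_deg u + 1 = r" "G \<in> flats" "\<And>F. F \<in> Poly_Mapping.keys u \<Longrightarrow> F \<subseteq> G \<or> G \<subseteq> F"
  shows "mon_val (times_var u G) = chain_deg (real q) r (bump (rank_exps u) (rk G))"
  using assms by (simp add: mon_val_def chain_mon_times_var mon_deg_times_var rank_exps_times_var)

lemma mon_val_times_var_0:
  assumes "\<not> chain_mon u \<or> mon_deg u + 1 \<noteq> r \<or> G \<notin> flats \<or> (\<exists>F\<in>Poly_Mapping.keys u. \<not> F \<subseteq> G \<and> \<not> G \<subseteq> F)"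
  shows "mon_val (times_var u G) = 0"
  using assms by (auto simp: mon_val_def chain_mon_times_var mon_deg_times_var)

section \<open>Compatibility of the degree formula with the linear relations\<close>

definition point_val :: "('a set \<Rightarrow>\<^sub>0 nat) \<Rightarrow> 'a \<Rightarrow> real" where
  "point_val u i = (\<Sum>G\<in>{G \<in> flats. i \<in> G}. mon_val (times_var u G))"

text \<open>Let \<open>i\<close> lie just inside \<open>F\<close> and \<open>j\<close> just outside.
  In the difference only flats compatible with the chain that separate the two points survive:
  \<open>F\<close> itself, those between \<open>A\<close> and \<open>F\<close> through
  \<open>i\<close>, and those between \<open>F\<close> and \<open>B\<close> avoiding
  \<open>j\<close>. All have weight 1, and grouping them by rank leads to
  \<open>chain_deg_relation\<close>.\<close>

lemma point_val_adjacent: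
  assumes u: "chain_mon u" "mon_deg u + 1 = r" and F: "F \<in> Poly_Mapping.keys u"
    and AB: "A \<in> insert {} (Poly_Mapping.keys u)" "B \<in> insert pts (Poly_Mapping.keys u)"
      "A \<subset> F" "F \<subset> B" "\<And>G. G \<in> Poly_Mapping.keys u \<Longrightarrow> G \<subseteq> A \<or> G = F \<or> B \<subseteq> G"
    and i: "i \<in> F - A" and j: "j \<in> B - F"
  shows "point_val u i = point_val u j"
proof -
  let ?K = "Poly_Mapping.keys u" and ?m = "\<lambda>G. mon_val (times_var u G)"
  define n where "n = rank_exps u"
  have K: "?K \<subseteq> flats" using u by (auto simp: chain_mon_def)
  have Ff: "F \<in> flats" and Af: "A \<in> insert {} flats" and Bf: "B \<in> insert pts flats" using K F AB by auto
  have rks: "rk A < rk F" "rk F < rk B" "rk B \<le> r + 1"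
    using rank_strict[OF Af _ AB(3)] rank_strict[OF _ Bf AB(4)] Bf Ff rk_flat[of B] rank_ground by auto
  define L where "L = {G \<in> flats. A \<subset> G \<and> G \<subset> F \<and> i \<in> G}"
  define R where "R = {G \<in> flats. F \<subset> G \<and> G \<subset> B \<and> j \<notin> G}"
  have fin: "finite L" "finite R" using finite_flats by (auto simp: L_def R_def)
  have Bpts: "B \<subseteq> pts" using Bf flat_psubset by auto
  define w where "w G = (if i \<in> G then 1 else 0) - (if j \<in> G then 1 else (0::real))" for G
  have zero: "w G * ?m G = 0" if G: "G \<in> flats - insert F (L \<union> R)" for G
  proof (rule ccontr)
    assume *: "w G * ?m G \<noteq> 0"
    then have cmp: "F' \<subseteq> G \<or> G \<subseteq> F'" if "F' \<in> ?K" for F' using mon_val_times_var_0[of u G] that by auto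
    have GA: "A \<subseteq> G \<or> G \<subseteq> A" using AB(1) cmp by auto
    have GB: "B \<subseteq> G \<or> G \<subseteq> B" using AB(2) cmp G flat_psubset[of G] by auto
    have w: "w G \<noteq> 0" using * by auto
    have "G \<noteq> F" "G \<notin> L" "G \<notin> R" "G \<in> flats" using G by auto
    with cmp[OF F] consider "G \<subset> F" | "F \<subset> G" by auto
    then show False
    proof cases
      case 1
      then have "i \<in> G" using w j by (auto simp: w_def split: if_splits)
      then show False using GA i 1 \<open>G \<notin> L\<close> \<open>G \<in> flats\<close> by (auto simp: L_def)
    next
      case 2
      then have "j \<notin> G" using w i by (auto simp: w_def split: if_splits)
      then show False using GB j 2 \<open>G \<notin> R\<close> \<open>G \<in> flats\<close> by (auto simp: R_def)
    qed
  qed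
  have val: "?m G = chain_deg (real q) r (bump n (rk G))" if "G \<in> insert F (L \<union> R)" for G
    unfolding n_def
  proof (rule mon_val_times_var[OF u])
    show "G \<in> flats" using that Ff by (auto simp: L_def R_def)
    fix F' assume "F' \<in> ?K"
    then have "F' \<subseteq> A \<or> F' = F \<or> B \<subseteq> F'" by (rule AB(5))
    then show "F' \<subseteq> G \<or> G \<subseteq> F'" using that AB(3,4) by (auto simp: L_def R_def)
  qed
  have "point_val u i - point_val u j = (\<Sum>G\<in>flats. w G * ?m G)"
    unfolding point_val_def w_def left_diff_distrib sum_subtractf
    using finite_flats by (simp add: sum.If_cases if_distrib[of "\<lambda>x. x * _"] sum.inter_filter cong: if_cong)
  also have "\<dots> = (\<Sum>G\<in>insert F (L \<union> R). w G * ?m G)"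
    using zero Ff finite_flats by (intro sum.mono_neutral_right) (auto simp: L_def R_def)
  also have "\<dots> = w F * ?m F + ((\<Sum>G\<in>L. w G * ?m G) + (\<Sum>G\<in>R. w G * ?m G))"
  proof -
    have "F \<notin> L \<union> R" "L \<inter> R = {}" by (auto simp: L_def R_def)
    then show ?thesis using fin by (simp add: sum.union_disjoint)
  qed
  also have "w F = 1" using i j by (auto simp: w_def)
  also have "(\<Sum>G\<in>L. w G * ?m G) = (\<Sum>G\<in>L. chain_deg (real q) r (bump n (rk G)))"
    using i j val by (intro sum.cong) (auto simp: w_def L_def)
  also have "(\<Sum>G\<in>R. w G * ?m G) = (\<Sum>G\<in>R. chain_deg (real q) r (bump n (rk G)))"
    using i j val by (intro sum.cong) (auto simp: w_def R_def)
  also have "(\<Sum>G\<in>L. chain_deg (real q) r (bump n (rk G))) =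
     (\<Sum>s\<in>{rk A<..<rk F}. real (card {G \<in> L. rk G = s}) * chain_deg (real q) r (bump n s))"
    using fin Af Ff rank_strict by (intro sum_by_rank) (auto simp: L_def)
  also have "\<dots> = (\<Sum>s\<in>{rk A<..<rk F}. qbin (real q) (rk F - rk A - 1) (s - rk A - 1) * chain_deg (real q) r (bump n s))"
  proof (rule sum.cong)
    fix s assume s: "s \<in> {rk A<..<rk F}"
    have "{G \<in> L. rk G = s} = {G \<in> flats. A \<subset> G \<and> G \<subset> F \<and> i \<in> G \<and> rk G = s}" by (auto simp: L_def)
    then show "real (card {G \<in> L. rk G = s}) * chain_deg (real q) r (bump n s) =
      qbin (real q) (rk F - rk A - 1) (s - rk A - 1) * chain_deg (real q) r (bump n s)"
      using card_between_point[of A F s i] Af Ff AB i s by auto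
  qed simp
  also have "(\<Sum>G\<in>R. chain_deg (real q) r (bump n (rk G))) =
     (\<Sum>s\<in>{rk F<..<rk B}. real (card {G \<in> R. rk G = s}) * chain_deg (real q) r (bump n s))"
    using fin Bf Ff rank_strict by (intro sum_by_rank) (auto simp: R_def)
  also have "\<dots> = (\<Sum>s\<in>{rk F<..<rk B}. real q ^ (s - rk F) * qbin (real q) (rk B - rk F - 1) (s - rk F) * chain_deg (real q) r (bump n s))"
  proof (rule sum.cong)
    fix s assume s: "s \<in> {rk F<..<rk B}"
    have "{G \<in> R. rk G = s} = {G \<in> flats. F \<subset> G \<and> G \<subset> B \<and> j \<notin> G \<and> rk G = s}" by (auto simp: R_def)
    then show "real (card {G \<in> R. rk G = s}) * chain_deg (real q) r (bump n s) =
      real q ^ (s - rk F) * qbin (real q) (rk B - rk F - 1) (s - rk F) * chain_deg (real q) r (bump n s)"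
      using card_avoiding_point[of F B s j] Bf Ff AB j s by auto
  qed simp
  also have "?m F = chain_deg (real q) r (bump n (rk F))" by (rule val) simp
  also have "chain_deg (real q) r (bump n (rk F)) = 
    - (\<Sum>s\<in>{rk A<..<rk F}. qbin (real q) (rk F - rk A - 1) (s - rk A - 1) * chain_deg (real q) r (bump n s))
    - (\<Sum>s\<in>{rk F<..<rk B}. real q ^ (s - rk F) * qbin (real q) (rk B - rk F - 1) (s - rk F) * chain_deg (real q) r (bump n s))"
  proof (rule chain_deg_relation)
    have pos: "n (rk G) > 0" if "G \<in> ?K" for G
    proof -
      have "Poly_Mapping.lookup u G \<le> (\<Sum>F\<in>{F \<in> ?K. rk F = rk G}. Poly_Mapping.lookup u F)"
        using that by (intro member_le_sum) auto
      then show ?thesis using that by (auto simp: n_def rank_exps_def in_keys_iff)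
    qed
    have n0: "n 0 = 1" "n (r + 1) = 1" by (simp_all add: n_def rank_exps_def)
    show "0 < n (rk A)" using pos[of A] AB(1) n0 rank_empty by auto
    show "0 < n (rk F)" using pos F .
    show "0 < n (rk B)" using pos[of B] AB(2) n0 rank_ground by auto
    show "0 < n (r + 1)" by (simp add: n_def rank_exps_def)
    have rkK: "rk G \<le> rk A \<or> rk G = rk F \<or> rk B \<le> rk G" if G: "G \<in> ?K" for G
    proof -
      have Gf: "G \<in> flats" using G K by auto
      have "rk G \<le> rk A" if "G \<subseteq> A"
        using that AB(1) K Gf rk_mono[of G A] flat_psubset[of G] by auto
      moreover have "rk B \<le> rk G" if "B \<subseteq> G"
        using that AB(2) K Gf rk_mono[of B G] flat_psubset[of G] by auto
      ultimately show ?thesis using AB(5)[OF G] by auto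
    qed
    have zero: "n k = 0" if "rk A < k" "k < rk B" "k \<noteq> rk F" for k
    proof -
      have "{F' \<in> ?K. rk F' = k} = {}" using rkK that by fastforce
      then show ?thesis using that rks by (simp only: n_def rank_exps_def) auto
    qed
    show "n k = 0" if "rk A < k" "k < rk F" for k using zero that rks by auto
    show "n k = 0" if "rk F < k" "k < rk B" for k using zero that rks by auto
  qed (use rks in auto)
  finally show ?thesis by simp
qed

text \<open>For a point outside all flats of the chain only flats above its top \<open>A\<close>
  contribute, and their number in each rank is the same for all such points. This is the common
  value with which every other point is compared.\<close>

lemma point_val_top:
  assumes u: "chain_mon u" "mon_deg u + 1 = r" and i: "i \<in> pts" "\<And>G. G \<in> Poly_Mapping.keys u \<Longrightarrow> i \<notin> G"
    and A: "A \<in> insert {} (Poly_Mapping.keys u)" "\<And>G. G \<in> Poly_Mapping.keys u \<Longrightarrow> G \<subseteq> A"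
  shows "point_val u i = (\<Sum>s\<in>{rk A<..<r + 1}. qbin (real q) (r + 1 - rk A - 1) (s - rk A - 1) *
    chain_deg (real q) r (bump (rank_exps u) s))"
proof -
  let ?K = "Poly_Mapping.keys u" and ?m = "\<lambda>G. mon_val (times_var u G)"
  define n where "n = rank_exps u"
  have K: "?K \<subseteq> flats" using u by (auto simp: chain_mon_def)
  have Af: "A \<in> insert {} flats" using K A by auto
  have iA: "i \<notin> A" using i A by auto
  define L where "L = {G \<in> flats. A \<subset> G \<and> G \<subset> pts \<and> i \<in> G}"
  have fin: "finite L" using finite_flats by (auto simp: L_def)
  have "point_val u i = (\<Sum>G\<in>L. ?m G)"
    unfolding point_val_def
  proof (rule sum.mono_neutral_right)
    show "\<forall>G\<in>{G \<in> flats. i \<in> G} - L. ?m G = 0"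
    proof
      fix G assume G: "G \<in> {G \<in> flats. i \<in> G} - L"
      then have "\<not> A \<subset> G" using flat_psubset[of G] by (auto simp: L_def)
      then have "\<not> A \<subseteq> G" "\<not> G \<subseteq> A" using G iA by auto
      then show "?m G = 0" using A(1) by (intro mon_val_times_var_0) auto
    qed
  qed (use finite_flats in \<open>auto simp: L_def\<close>)
  also have "\<dots> = (\<Sum>G\<in>L. chain_deg (real q) r (bump n (rk G)))"
  proof (rule sum.cong)
    fix G assume "G \<in> L"
    then show "?m G = chain_deg (real q) r (bump n (rk G))"
      unfolding n_def using A(2) by (intro mon_val_times_var[OF u]) (auto simp: L_def)
  qed simp
  also have "\<dots> = (\<Sum>s\<in>{rk A<..<r + 1}. real (card {G \<in> L. rk G = s}) * chain_deg (real q) r (bump n s))"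
  proof (rule sum_by_rank)
    show "rk G \<in> {rk A<..<r + 1}" if "G \<in> L" for G
      using that Af rank_strict[of A G] rk_flat[of G] by (auto simp: L_def)
  qed (use fin in auto)
  also have "\<dots> = (\<Sum>s\<in>{rk A<..<r + 1}. qbin (real q) (r + 1 - rk A - 1) (s - rk A - 1) * chain_deg (real q) r (bump n s))"
  proof (rule sum.cong)
    fix s assume s: "s \<in> {rk A<..<r + 1}"
    have "{G \<in> L. rk G = s} = {G \<in> flats. A \<subset> G \<and> G \<subset> pts \<and> i \<in> G \<and> rk G = s}" by (auto simp: L_def)
    moreover have "A \<subset> pts" using Af flat_psubset[of A] i by auto
    ultimately show "real (card {G \<in> L. rk G = s}) * chain_deg (real q) r (bump n s) =
      qbin (real q) (r + 1 - rk A - 1) (s - rk A - 1) * chain_deg (real q) r (bump n s)"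
      using card_between_point[of A pts s i] Af i iA s rank_ground by auto
  qed simp
  finally show ?thesis by (simp add: n_def)
qed

text \<open>Induction on the number of members of the chain that contain the point. If
  \<open>F\<close> is the smallest of them, a point of the next member (or of \<open>pts\<close>)
  outside \<open>F\<close> has the same value and lies in fewer members.\<close>

lemma point_val_indep:
  assumes i: "i \<in> pts" and j: "j \<in> pts"
  shows "point_val u i = point_val u j"
proof (cases "chain_mon u \<and> mon_deg u + 1 = r")
  case False
  then have "point_val u i = 0" for i
    unfolding point_val_def by (intro sum.neutral ballI mon_val_times_var_0) auto
  then show ?thesis by simp
next
  case True
  then have u: "chain_mon u" "mon_deg u + 1 = r" by auto
  let ?K = "Poly_Mapping.keys u"
  have K: "?K \<subseteq> flats" and ch: "\<And>F G. F \<in> ?K \<Longrightarrow> G \<in> ?K \<Longrightarrow> F \<subseteq> G \<or> G \<subseteq> F"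
    using u by (auto simp: chain_mon_def)
  have "\<exists>A\<in>insert {} ?K. \<forall>G\<in>insert {} ?K. A \<subseteq> G \<longrightarrow> A = G"
    by (rule finite_has_maximal) auto
  then obtain A where A: "A \<in> insert {} ?K" "\<And>G. G \<in> insert {} ?K \<Longrightarrow> A \<subseteq> G \<Longrightarrow> G = A" by blast
  have Atop: "G \<subseteq> A" if "G \<in> ?K" for G using A that ch[of G A] by auto
  define c where "c = (\<Sum>s\<in>{rk A<..<r + 1}. qbin (real q) (r + 1 - rk A - 1) (s - rk A - 1) *
    chain_deg (real q) r (bump (rank_exps u) s))"
  have "point_val u i = c" if "i \<in> pts" for i
    using that
  proof (induction "card {G \<in> ?K. i \<in> G}" arbitrary: i rule: less_induct)
    case less
    show ?case
    proof (cases "{G \<in> ?K. i \<in> G} = {}")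
      case True
      then show ?thesis unfolding c_def by (intro point_val_top u) (use less A Atop in auto)
    next
      case False
      then obtain F where F: "F \<in> ?K" "i \<in> F" and Fmin: "\<And>G. G \<in> ?K \<Longrightarrow> i \<in> G \<Longrightarrow> G \<subseteq> F \<Longrightarrow> G = F"
        using finite_has_minimal[of "{G \<in> ?K. i \<in> G}"] by auto
      obtain A B where AB: "A \<in> insert {} ?K" "B \<in> insert pts ?K" "A \<subset> F" "F \<subset> B"
          "\<And>G. G \<in> ?K \<Longrightarrow> G \<subseteq> A \<or> G = F \<or> B \<subseteq> G"
        using chain_neighbours[OF u(1) F(1)] by blast
      have "i \<notin> A" using AB(1,3) Fmin[of A] by auto
      obtain j where j: "j \<in> B - F" using AB(4) by blast
      have "B \<subseteq> pts" using AB(2) K flat_psubset by auto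
      then have jp: "j \<in> pts" using j by auto
      have "{G \<in> ?K. j \<in> G} \<subset> {G \<in> ?K. i \<in> G}"
      proof
        show "{G \<in> ?K. j \<in> G} \<subseteq> {G \<in> ?K. i \<in> G}"
        proof safe
          fix G assume "G \<in> ?K" "j \<in> G"
          with AB(5)[of G] AB(3) j have "B \<subseteq> G" by auto
          then show "i \<in> G" using AB(4) F(2) by auto
        qed
        show "{G \<in> ?K. j \<in> G} \<noteq> {G \<in> ?K. i \<in> G}" using F j by auto
      qed
      then have "card {G \<in> ?K. j \<in> G} < card {G \<in> ?K. i \<in> G}" by (intro psubset_card_mono) auto
      then have "point_val u j = c" using less.hyps jp by blast
      moreover have "point_val u i = point_val u j"
        by (rule point_val_adjacent[OF u F(1) AB]) (use F \<open>i \<notin> A\<close> j in auto)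
      ultimately show ?thesis by simp
    qed
  qed
  then show ?thesis using i j by simp
qed

text \<open>The largest ideal of the polynomial ring inside the kernel of \<open>val\<close>.
  Congruences modulo it replace computations with cosets in the Chow ring.\<close>

definition null :: "'a mpoly set" where
  "null = {p. \<forall>p'. val (p' * p) = 0}"

lemma val_null: "p \<in> null \<Longrightarrow> val p = 0"
  unfolding null_def by (metis (mono_tags) mem_Collect_eq mult_1)

lemma val_simps:
  "val (p + p') = val p + val p'" "val (p - p') = val p - val p'" "val (- p) = - val p"
  "val (sum g X) = (\<Sum>x\<in>X. val (g x))" "val (mconst t * p) = t * val p" "val 0 = 0"
  by (simp_all add: val_def linear_ext_add linear_ext_diff linear_ext_uminus linear_ext_sum linear_ext_mconst)

lemma null_mult: "p \<in> null \<Longrightarrow> p' * p \<in> null"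
  unfolding null_def by (simp flip: mult.assoc)

lemma null_add: "p \<in> null \<Longrightarrow> p' \<in> null \<Longrightarrow> p + p' \<in> null"
  by (simp add: null_def distrib_left val_simps)

lemma null_diff: "p \<in> null \<Longrightarrow> p' \<in> null \<Longrightarrow> p - p' \<in> null"
  by (simp add: null_def right_diff_distrib val_simps)

lemma null_0: "0 \<in> null"
  by (simp add: null_def val_simps)

lemma null_sum: "(\<And>x. x \<in> X \<Longrightarrow> g x \<in> null) \<Longrightarrow> sum g X \<in> null"
  by (induction X rule: infinite_finite_induct) (auto intro: null_0 null_add)

lemma nullI_monomials:
  assumes "\<And>u. val (Poly_Mapping.single u 1 * p) = 0"
  shows "p \<in> null"
proof -
  have "val (p' * p) = 0" for p'
  proof -
    have "val (p' * p) = val (\<Sum>u\<in>Poly_Mapping.keys p'. mconst (Poly_Mapping.lookup p' u) * (Poly_Mapping.single u 1 * p))"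
      by (subst (1) mpoly_eq_sum_monomials[of p', symmetric]) (simp add: sum_distrib_right mult.assoc)
    also have "\<dots> = 0" using assms by (simp add: val_simps)
    finally show ?thesis .
  qed
  then show ?thesis by (simp add: null_def)
qed

definition point_class :: "'a \<Rightarrow> 'a mpoly" where
  "point_class i = (\<Sum>F\<in>{F \<in> flats. i \<in> F}. mvar F)"

text \<open>Well-definedness of Eur's formula. A monomial with two incomparable flats has value 0 by
  definition, and a monomial times a linear relation is a difference of two values of
  \<open>point_val\<close>.\<close>

lemma chow_relations_null: "chow_relations M \<subseteq> null"
proof
  fix p assume "p \<in> chow_relations M"
  then consider F G where "p = mvar F * mvar G" "F \<in> flats" "G \<in> flats" "\<not> F \<subseteq> G" "\<not> G \<subseteq> F"
    | i j where "p = point_class i - point_class j" "i \<in> pts" "j \<in> pts"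
    unfolding chow_relations_def point_class_def by blast
  then show "p \<in> null"
  proof cases
    case 1
    show ?thesis
    proof (rule nullI_monomials)
      fix u
      have "\<not> chain_mon (times_var (times_var u F) G)" 
        using 1 by (auto simp: chain_mon_def keys_times_var)
      then show "val (Poly_Mapping.single u 1 * p) = 0"
        by (simp add: 1 single_mult_mvar val_def mon_val_def flip: mult.assoc)
    qed
  next
    case 2
    show ?thesis
    proof (rule nullI_monomials)
      fix u
      have "val (Poly_Mapping.single u 1 * point_class i) = point_val u i" for i
        by (simp add: point_class_def sum_distrib_left single_mult_mvar val_simps point_val_def)
           (simp add: val_def)
      then show "val (Poly_Mapping.single u 1 * p) = 0"
        using point_val_indep[OF 2(2,3), of u] by (simp add: 2(1) right_diff_distrib val_simps)
    qed
  qed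
qed

lemma point_class_null: "i \<in> pts \<Longrightarrow> j \<in> pts \<Longrightarrow> point_class i - point_class j \<in> null"
  using chow_relations_null unfolding chow_relations_def point_class_def by blast

lemma incomparable_null: "F \<in> flats \<Longrightarrow> G \<in> flats \<Longrightarrow> \<not> F \<subseteq> G \<Longrightarrow> \<not> G \<subseteq> F \<Longrightarrow> mvar F * mvar G \<in> null"
  using chow_relations_null unfolding chow_relations_def by blast

end

section \<open>The Chow ring as a quotient ring\<close>

lemma carrier_flat_poly_ring:
  "p \<in> carrier (flat_poly_ring M) \<longleftrightarrow> (\<forall>u\<in>Poly_Mapping.keys p. Poly_Mapping.keys u \<subseteq> proper_flats M)"
  by (simp add: flat_poly_ring_def)

lemma flat_poly_ring_simps [simp]:
  "mult (flat_poly_ring M) = (*)" "one (flat_poly_ring M) = 1"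
  "zero (flat_poly_ring M) = 0" "add (flat_poly_ring M) = (+)"
  by (simp_all add: flat_poly_ring_def)

lemma flat_carrier_add: "p \<in> carrier (flat_poly_ring M) \<Longrightarrow> p' \<in> carrier (flat_poly_ring M) \<Longrightarrow>
    p + p' \<in> carrier (flat_poly_ring M)"
  unfolding carrier_flat_poly_ring using keys_add[of p p'] by blast

lemma flat_carrier_diff: "p \<in> carrier (flat_poly_ring M) \<Longrightarrow> p' \<in> carrier (flat_poly_ring M) \<Longrightarrow>
    p - p' \<in> carrier (flat_poly_ring M)"
  unfolding carrier_flat_poly_ring using keys_diff[of p p'] by blast

lemma flat_carrier_0: "0 \<in> carrier (flat_poly_ring M)"
  by (simp add: carrier_flat_poly_ring)

lemma flat_carrier_1: "1 \<in> carrier (flat_poly_ring M)"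
  by (simp add: carrier_flat_poly_ring)

lemma flat_carrier_uminus: "p \<in> carrier (flat_poly_ring M) \<Longrightarrow> - p \<in> carrier (flat_poly_ring M)"
  using flat_carrier_diff[OF flat_carrier_0, of p M] by simp

lemma flat_carrier_mult: "p \<in> carrier (flat_poly_ring M) \<Longrightarrow> p' \<in> carrier (flat_poly_ring M) \<Longrightarrow>
    p * p' \<in> carrier (flat_poly_ring M)"
  unfolding carrier_flat_poly_ring using keys_mult[of p p'] by (fastforce simp: keys_nat_add)

lemma flat_carrier_sum: "(\<And>x. x \<in> X \<Longrightarrow> g x \<in> carrier (flat_poly_ring M)) \<Longrightarrow>
    sum g X \<in> carrier (flat_poly_ring M)"
  by (induction X rule: infinite_finite_induct) (auto intro: flat_carrier_0 flat_carrier_add)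

lemma flat_carrier_prod: "(\<And>x. x \<in> X \<Longrightarrow> g x \<in> carrier (flat_poly_ring M)) \<Longrightarrow>
    prod g X \<in> carrier (flat_poly_ring M)"
  by (induction X rule: infinite_finite_induct) (auto intro: flat_carrier_1 flat_carrier_mult)

lemma flat_carrier_power: "p \<in> carrier (flat_poly_ring M) \<Longrightarrow> p ^ n \<in> carrier (flat_poly_ring M)"
  by (induction n) (auto intro: flat_carrier_1 flat_carrier_mult)

lemma flat_carrier_mconst: "mconst t \<in> carrier (flat_poly_ring M)"
  by (simp add: carrier_flat_poly_ring mconst_def)

lemma flat_carrier_single: "Poly_Mapping.keys u \<subseteq> proper_flats M \<Longrightarrow>
    Poly_Mapping.single u t \<in> carrier (flat_poly_ring M)"
  by (simp add: carrier_flat_poly_ring)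

lemma flat_carrier_mvar: "F \<in> proper_flats M \<Longrightarrow> mvar F \<in> carrier (flat_poly_ring M)"
  by (simp add: carrier_flat_poly_ring mvar_def)

lemmas flat_carrier_intros = flat_carrier_add flat_carrier_diff flat_carrier_0 flat_carrier_1
  flat_carrier_uminus flat_carrier_mult flat_carrier_sum flat_carrier_prod flat_carrier_power
  flat_carrier_mconst flat_carrier_single flat_carrier_mvar

lemma cring_flat_poly_ring: "cring (flat_poly_ring M)"
proof (rule cringI)
  show "abelian_group (flat_poly_ring M)"
  proof (rule abelian_groupI)
    fix p assume "p \<in> carrier (flat_poly_ring M)"
    then show "\<exists>p'\<in>carrier (flat_poly_ring M). p' \<oplus>\<^bsub>flat_poly_ring M\<^esub> p = \<zero>\<^bsub>flat_poly_ring M\<^esub>"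
      by (intro bexI[of _ "- p"]) (auto intro: flat_carrier_intros)
  qed (auto intro: flat_carrier_intros)
  show "comm_monoid (flat_poly_ring M)"
    by (rule comm_monoidI) (auto intro: flat_carrier_intros simp: mult_ac)
qed (auto simp: distrib_right)

lemma chow_relations_carrier: "chow_relations M \<subseteq> carrier (flat_poly_ring M)"
  unfolding chow_relations_def by (auto intro!: flat_carrier_intros)

lemma ideal_chow_ideal: "ideal (chow_ideal M) (flat_poly_ring M)"
  unfolding chow_ideal_def
  by (rule ring.genideal_ideal[OF cring.axioms(1)[OF cring_flat_poly_ring] chow_relations_carrier])

lemma chow_relations_ideal: "chow_relations M \<subseteq> chow_ideal M"
  unfolding chow_ideal_def
  by (rule ring.genideal_self[OF cring.axioms(1)[OF cring_flat_poly_ring] chow_relations_carrier])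

lemma chow_ideal_mult: "p \<in> chow_ideal M \<Longrightarrow> p' \<in> carrier (flat_poly_ring M) \<Longrightarrow> p' * p \<in> chow_ideal M"
  using ideal.I_l_closed[OF ideal_chow_ideal] by fastforce

lemma ring_hom_chow_class: "ring_hom_cring (flat_poly_ring M) (chow_ring M) (chow_class M)"
proof -
  have "chow_class M = (+>\<^bsub>flat_poly_ring M\<^esub>) (chow_ideal M)"
    by (auto simp: chow_class_def)
  then show ?thesis
    using ideal.rcos_ring_hom_cring[OF ideal_chow_ideal cring_flat_poly_ring] by (simp add: chow_ring_def)
qed

lemma chow_class_add:
  assumes "p \<in> carrier (flat_poly_ring M)" "p' \<in> carrier (flat_poly_ring M)"
  shows "chow_class M (p + p') = chow_class M p \<oplus>\<^bsub>chow_ring M\<^esub> chow_class M p'"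
proof -
  interpret ring_hom_cring "flat_poly_ring M" "chow_ring M" "chow_class M" by (rule ring_hom_chow_class)
  show ?thesis using hom_add[OF assms] by simp
qed

lemma chow_class_mult:
  assumes "p \<in> carrier (flat_poly_ring M)" "p' \<in> carrier (flat_poly_ring M)"
  shows "chow_class M (p * p') = chow_class M p \<otimes>\<^bsub>chow_ring M\<^esub> chow_class M p'"
proof -
  interpret ring_hom_cring "flat_poly_ring M" "chow_ring M" "chow_class M" by (rule ring_hom_chow_class)
  show ?thesis using hom_mult[OF assms] by simp
qed

lemma chow_class_power:
  assumes "p \<in> carrier (flat_poly_ring M)"
  shows "chow_class M (p ^ n) = chow_class M p [^]\<^bsub>chow_ring M\<^esub> n"
proof -
  interpret ring_hom_cring "flat_poly_ring M" "chow_ring M" "chow_class M" by (rule ring_hom_chow_class)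
  show ?thesis
  proof (induction n)
    case 0
    show ?case using hom_one by simp
  next
    case (Suc n)
    have "chow_class M (p ^ Suc n) = chow_class M (p ^ n * p)" by (simp add: mult.commute)
    then show ?case using Suc assms by (simp add: chow_class_mult flat_carrier_power)
  qed
qed

lemma chow_class_prod:
  assumes "finite X" "\<And>x. x \<in> X \<Longrightarrow> g x \<in> carrier (flat_poly_ring M)"
  shows "chow_class M (\<Prod>x\<in>X. g x) = (\<Otimes>\<^bsub>chow_ring M\<^esub>x\<in>X. chow_class M (g x))"
proof -
  interpret ring_hom_cring "flat_poly_ring M" "chow_ring M" "chow_class M" by (rule ring_hom_chow_class)
  show ?thesis using assms
  proof (induction X rule: finite_induct)
    case empty
    show ?case using hom_one by simp
  next
    case (insert x X)
    have "(\<lambda>x. chow_class M (g x)) \<in> X \<rightarrow> carrier (chow_ring M)" "chow_class M (g x) \<in> carrier (chow_ring M)"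
      using insert.prems by auto
    then show ?case using insert
      by (simp add: chow_class_mult flat_carrier_prod S.finprod_insert)
  qed
qed

lemma chow_class_eq_0:
  assumes "p \<in> chow_ideal M"
  shows "chow_class M p = chow_class M 0"
proof -
  interpret ideal "chow_ideal M" "flat_poly_ring M" by (rule ideal_chow_ideal)
  have "0 \<in> chow_ideal M" using additive_subgroup.zero_closed[OF is_additive_subgroup] by simp
  then show ?thesis using assms by (simp add: chow_class_def a_rcos_const)
qed

lemma chow_class_eqD:
  assumes "p \<in> carrier (flat_poly_ring M)" "chow_class M p = chow_class M p'"
  shows "\<exists>h\<in>chow_ideal M. p = h + p'"
proof -
  interpret ideal "chow_ideal M" "flat_poly_ring M" by (rule ideal_chow_ideal)
  have "p \<in> chow_class M p" unfolding chow_class_def using assms(1) by (rule a_rcos_self)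
  then have "p \<in> chow_class M p'" using assms(2) by simp
  then show ?thesis by (auto simp: chow_class_def a_r_coset_def')
qed

lemma prod_mvar: "finite C \<Longrightarrow> (\<Prod>F\<in>C. mvar F) = Poly_Mapping.single (\<Sum>F\<in>C. Poly_Mapping.single F 1) 1"
  by (induction C rule: finite_induct) (auto simp: mvar_def mult_single)

lemma times_var_exists:
  assumes "F \<in> Poly_Mapping.keys u"
  shows "\<exists>v. u = times_var v F"
proof (rule exI[of _ "u - Poly_Mapping.single F 1"], rule poly_mapping_eqI)
  fix k
  show "Poly_Mapping.lookup u k = Poly_Mapping.lookup (times_var (u - Poly_Mapping.single F 1) F) k"
    using assms by (auto simp: times_var_def lookup_add lookup_minus lookup_single when_def in_keys_iff)
qed

section \<open>Homogeneous polynomials\<close>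

lemma homogeneous_single: "homogeneous d (Poly_Mapping.single u t) \<longleftrightarrow> t = 0 \<or> mon_deg u = d"
  by (auto simp: homogeneous_iff)

lemma homogeneous_add: "homogeneous d p \<Longrightarrow> homogeneous d p' \<Longrightarrow> homogeneous d (p + p')"
  unfolding homogeneous_iff using keys_add[of p p'] by blast

lemma homogeneous_0: "homogeneous d 0"
  by (simp add: homogeneous_iff)

lemma homogeneous_sum: "(\<And>x. x \<in> X \<Longrightarrow> homogeneous d (g x)) \<Longrightarrow> homogeneous d (sum g X)"
  by (induction X rule: infinite_finite_induct) (auto intro: homogeneous_add homogeneous_0)

lemma homogeneous_mult: "homogeneous d p \<Longrightarrow> homogeneous d' p' \<Longrightarrow> homogeneous (d + d') (p * p')"
  unfolding homogeneous_iff using keys_mult[of p p'] by (fastforce simp: mon_deg_add)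

lemma homogeneous_mconst: "homogeneous 0 (mconst t)"
  by (simp add: homogeneous_iff mconst_def mon_deg_def)

lemma homogeneous_mconst_mult: "homogeneous d p \<Longrightarrow> homogeneous d (mconst t * p)"
  using homogeneous_mult[OF homogeneous_mconst] by fastforce

lemma homogeneous_mvar: "homogeneous 1 (mvar F)"
  by (simp add: homogeneous_iff mvar_def mon_deg_def)

lemma homogeneous_1: "homogeneous 0 1"
  by (simp add: homogeneous_iff mon_deg_def)

lemma homogeneous_power: "homogeneous 1 p \<Longrightarrow> homogeneous n (p ^ n)"
  by (induction n) (auto simp: homogeneous_1 dest: homogeneous_mult)

lemma homogeneous_prod: "finite X \<Longrightarrow> (\<And>x. x \<in> X \<Longrightarrow> homogeneous (d x) (g x)) \<Longrightarrow>
    homogeneous (\<Sum>x\<in>X. d x) (prod g X)"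
  by (induction X rule: finite_induct) (auto simp: homogeneous_1 intro: homogeneous_mult)

context q_geometry
begin

text \<open>Since \<open>null\<close> lives in the polynomial ring in variables for all sets, it is
  cut down to the carrier before the minimality of the generated ideal is used.\<close>

lemma chow_ideal_null: "chow_ideal M \<subseteq> null"
proof -
  let ?R = "flat_poly_ring M"
  interpret cring ?R by (rule cring_flat_poly_ring)
  have "ideal (null \<inter> carrier ?R) ?R"
  proof (rule idealI)
    show "subgroup (null \<inter> carrier ?R) (add_monoid ?R)"
    proof
      fix p assume p: "p \<in> null \<inter> carrier ?R"
      then have "inv\<^bsub>add_monoid ?R\<^esub> p = - p"
        using a_inv_def[of ?R] minus_equality[of "- p" p] by (auto intro: flat_carrier_uminus)
      moreover have "- p \<in> null" using null_diff[OF null_0, of p] p by simp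
      ultimately show "inv\<^bsub>add_monoid ?R\<^esub> p \<in> null \<inter> carrier ?R" using p by (auto intro: flat_carrier_uminus)
    qed (auto intro: null_add null_0 flat_carrier_intros)
    fix p p' assume "p \<in> null \<inter> carrier ?R" "p' \<in> carrier ?R"
    then show "p' \<otimes>\<^bsub>?R\<^esub> p \<in> null \<inter> carrier ?R" "p \<otimes>\<^bsub>?R\<^esub> p' \<in> null \<inter> carrier ?R"
      using null_mult[of p p'] by (auto intro: flat_carrier_intros simp: mult.commute[of p p'])
  qed (rule ring_axioms)
  then have "chow_ideal M \<subseteq> null \<inter> carrier ?R"
    unfolding chow_ideal_def
    by (rule genideal_minimal) (use chow_relations_null chow_relations_carrier in blast)
  then show ?thesis by blast
qed

lemma incomparable_ideal:
  "F \<in> flats \<Longrightarrow> G \<in> flats \<Longrightarrow> \<not> F \<subseteq> G \<Longrightarrow> \<not> G \<subseteq> F \<Longrightarrow> mvar F * mvar G \<in> chow_ideal M"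
  using chow_relations_ideal[of M] unfolding chow_relations_def by blast

lemma point_class_ideal: "i \<in> pts \<Longrightarrow> j \<in> pts \<Longrightarrow> point_class i - point_class j \<in> chow_ideal M"
  using chow_relations_ideal[of M] unfolding chow_relations_def point_class_def by blast

section \<open>Existence and uniqueness of the degree map\<close>

lemma complete_flag_rank_bij:
  assumes "C \<in> complete_flags M"
  shows "bij_betw rk C {1..r}"
proof -
  have C: "C \<subseteq> flats" "finite C" "card C = r" "\<And>F G. F \<in> C \<Longrightarrow> G \<in> C \<Longrightarrow> F \<subseteq> G \<or> G \<subseteq> F"
    using assms rank_ground by (auto simp: complete_flags_def)
  have "inj_on rk C"
  proof (rule inj_onI)
    fix F G assume FG: "F \<in> C" "G \<in> C" "rk F = rk G"
    then show "F = G" using C(4)[OF FG(1,2)] rank_strict[of F G] rank_strict[of G F] C(1)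
      by (auto simp: psubset_eq)
  qed
  moreover have "rk ` C \<subseteq> {1..r}" using C(1) rk_flat by auto
  moreover have "card (rk ` C) = card {1..r}" using \<open>inj_on rk C\<close> C by (simp add: card_image)
  ultimately show ?thesis unfolding bij_betw_def by (intro conjI card_subset_eq) auto
qed

text \<open>Every rank from 0 to \<open>r + 1\<close> has exponent 1, so all excesses are 0 and all
  factors of the formula are 1.\<close>

lemma val_flag:
  assumes "C \<in> complete_flags M"
  shows "val (\<Prod>F\<in>C. mvar F) = 1"
proof -
  have C: "C \<subseteq> flats" "finite C" "card C = r" "\<And>F G. F \<in> C \<Longrightarrow> G \<in> C \<Longrightarrow> F \<subseteq> G \<or> G \<subseteq> F"
    using assms rank_ground by (auto simp: complete_flags_def)
  define u where "u = (\<Sum>F\<in>C. Poly_Mapping.single F (1::nat))"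
  have look: "Poly_Mapping.lookup u F = (if F \<in> C then 1 else 0)" for F
    using C(2) by (simp add: u_def lookup_sum lookup_single when_def)
  have keys: "Poly_Mapping.keys u = C" by (auto simp: in_keys_iff look split: if_splits)
  have "chain_mon u" using C by (simp add: chain_mon_def keys)
  moreover have "mon_deg u = r" using C by (simp add: mon_deg_def keys look)
  moreover have "rank_exps u j = 1" if "j \<le> r + 1" for j
  proof (cases "j = 0 \<or> j = r + 1")
    case False
    then have "j \<in> rk ` C" using complete_flag_rank_bij[OF assms] that by (auto simp: bij_betw_def)
    then obtain F where F: "F \<in> C" "rk F = j" by auto
    then have "{F \<in> C. rk F = j} = {F}"
      using complete_flag_rank_bij[OF assms] by (auto simp: bij_betw_def inj_on_def)
    then show ?thesis using False F by (simp add: rank_exps_def keys look)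
  qed (simp add: rank_exps_def)
  then have "chain_deg (real q) r (rank_exps u) = 1" by (rule chain_deg_ones)
  ultimately show ?thesis
    using prod_mvar[OF C(2)] by (simp add: val_def mon_val_def u_def)
qed

abbreviation top_forms where
  "top_forms \<equiv> {p \<in> carrier (flat_poly_ring M). homogeneous r p}"

lemma chow_graded_top: "chow_graded M (mrank M (ground M) - 1) = chow_class M ` top_forms"
  by (simp add: chow_graded_def rank_ground)

lemma flag_top_form:
  assumes "C \<in> complete_flags M"
  shows "(\<Prod>F\<in>C. mvar F) \<in> top_forms"
proof -
  have C: "C \<subseteq> flats" "finite C" "card C = r"
    using assms rank_ground by (auto simp: complete_flags_def)
  then show ?thesis
    using homogeneous_prod[of C "\<lambda>_. 1" mvar] by (auto intro!: flat_carrier_intros homogeneous_mvar[unfolded One_nat_def])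
qed

text \<open>In a monomial divisible by \<open>x\<^sub>F\<^sup>2\<close>, a linear relation separating \<open>F\<close> from the rest of the
  chain trades one factor \<open>x\<^sub>F\<close> for variables outside the chain, which increases the support.\<close>

lemma top_functional_zero:
  fixes L :: "'a mpoly \<Rightarrow> real"
  assumes add: "\<And>p p'. p \<in> top_forms \<Longrightarrow> p' \<in> top_forms \<Longrightarrow> L (p + p') = L p + L p'"
    and scale: "\<And>t p. p \<in> top_forms \<Longrightarrow> L (mconst t * p) = t * L p"
    and ideal: "\<And>p. p \<in> top_forms \<Longrightarrow> p \<in> chow_ideal M \<Longrightarrow> L p = 0"
    and flag: "\<And>C. C \<in> complete_flags M \<Longrightarrow> L (\<Prod>F\<in>C. mvar F) = 0"
    and p: "p \<in> top_forms"
  shows "L p = 0"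
proof -
  have L0: "L 0 = 0" using add[of 0 0] by (simp add: flat_carrier_0 homogeneous_0)
  have Lsum: "L (sum g X) = (\<Sum>x\<in>X. L (g x))" if "\<And>x. x \<in> X \<Longrightarrow> g x \<in> top_forms" for g X
    using that
  proof (induction X rule: infinite_finite_induct)
    case (insert x X)
    then have "sum g X \<in> top_forms" by (auto intro!: flat_carrier_sum homogeneous_sum)
    then show ?case using insert by (simp add: add)
  qed (auto simp: L0)
  have mon: "L (Poly_Mapping.single u 1) = 0" if "Poly_Mapping.keys u \<subseteq> flats" "mon_deg u = r" for u
    using that
  proof (induction "r - card (Poly_Mapping.keys u)" arbitrary: u rule: less_induct)
    case less
    let ?K = "Poly_Mapping.keys u"
    have top: "Poly_Mapping.single v 1 \<in> top_forms" if "Poly_Mapping.keys v \<subseteq> flats" "mon_deg v = r" for v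
      using that by (auto simp: homogeneous_single intro: flat_carrier_single)
    have pos: "1 \<le> Poly_Mapping.lookup u F" if "F \<in> ?K" for F using that by (auto simp: in_keys_iff)
    have le: "card ?K \<le> r"
      using sum_mono[of ?K "\<lambda>_. 1" "Poly_Mapping.lookup u"] pos less.prems(2) by (simp add: mon_deg_def)
    show ?case
    proof (cases "chain_mon u")
      case False
      then obtain F G where FG: "F \<in> ?K" "G \<in> ?K" "\<not> F \<subseteq> G" "\<not> G \<subseteq> F"
        using less.prems by (auto simp: chain_mon_def)
      obtain v where v: "u = times_var v F" using times_var_exists FG by blast
      have "G \<in> Poly_Mapping.keys v" using FG v by (auto simp: keys_times_var)
      then obtain w where w: "v = times_var w G" using times_var_exists by blast
      have eq: "Poly_Mapping.single u 1 = Poly_Mapping.single w 1 * (mvar G * mvar F)"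
        unfolding v w by (simp add: single_mult_mvar flip: mult.assoc)
      have "mvar G * mvar F \<in> chow_ideal M"
        using less.prems(1) FG by (intro incomparable_ideal) auto
      moreover have "Poly_Mapping.single w 1 \<in> carrier (flat_poly_ring M)"
        using less.prems v w by (intro flat_carrier_single) (auto simp: keys_times_var)
      ultimately have "Poly_Mapping.single u 1 \<in> chow_ideal M"
        unfolding eq by (rule chow_ideal_mult)
      then show ?thesis using ideal top less.prems by blast
    next
      case True
      show ?thesis
      proof (cases "card ?K = r")
        case cr: True
        have one: "Poly_Mapping.lookup u F = 1" if "F \<in> ?K" for F
        proof (rule ccontr)
          assume "Poly_Mapping.lookup u F \<noteq> 1"
          then have "1 < Poly_Mapping.lookup u F" using pos[OF that] by linarith
          then have "(\<Sum>F\<in>?K. 1) < (\<Sum>F\<in>?K. Poly_Mapping.lookup u F)"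
            using that pos by (intro sum_strict_mono_ex1 ballI bexI[of _ F]) auto
          then show False using cr less.prems by (simp add: mon_deg_def)
        qed
        have "?K \<in> complete_flags M"
          using True cr rank_ground by (auto simp: complete_flags_def chain_mon_def)
        moreover have "u = (\<Sum>F\<in>?K. Poly_Mapping.single F 1)"
          using poly_mapping_sum_single[of u] one by (metis (no_types, lifting) sum.cong)
        then have "Poly_Mapping.single u 1 = (\<Prod>F\<in>?K. mvar F)"
          using prod_mvar[of ?K] by simp
        ultimately show ?thesis using flag by simp
      next
        case False
        then have "(\<Sum>F\<in>?K. 1) < (\<Sum>F\<in>?K. Poly_Mapping.lookup u F)"
          using le less.prems by (simp add: mon_deg_def)
        then obtain F where F: "F \<in> ?K" "1 < Poly_Mapping.lookup u F"
          using sum_mono[of ?K "Poly_Mapping.lookup u" "\<lambda>_. 1"] by (meson not_le)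
        obtain v where v: "u = times_var v F" using times_var_exists F by blast
        have Fv: "F \<in> Poly_Mapping.keys v"
          using F v by (auto simp: in_keys_iff times_var_def lookup_add lookup_single)
        then have kv: "Poly_Mapping.keys v = ?K" using v by (auto simp: keys_times_var)
        have chv: "chain_mon v" using True kv by (simp add: chain_mon_def)
        obtain A B where AB: "A \<in> insert {} ?K" "B \<in> insert pts ?K" "A \<subset> F" "F \<subset> B"
            "\<And>G. G \<in> ?K \<Longrightarrow> G \<subseteq> A \<or> G = F \<or> B \<subseteq> G"
          using chain_neighbours[OF chv Fv] kv by metis
        obtain i j where ij: "i \<in> F" "i \<notin> A" "j \<in> B" "j \<notin> F" using AB(3,4) by blast
        have "B \<subseteq> pts" "F \<subseteq> pts" using AB(2) F less.prems flat_psubset by auto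
        then have ijp: "i \<in> pts" "j \<in> pts" using ij by auto
        \<comment> \<open>Of the flats already in the chain only \<open>F\<close> separates
          \<open>i\<close> from \<open>j\<close>: smaller members contain neither point, larger ones
          contain both. All other terms have a larger support.\<close>
        define w where "w G = (if i \<in> G then 1 else 0) - (if j \<in> G then 1 else (0::real))" for G
        have degv: "mon_deg v + 1 = r" using less.prems v by (simp add: mon_deg_times_var)
        define g where "g = Poly_Mapping.single v 1 * (point_class i - point_class j)"
        have mc: "mconst 1 * p = p" "mconst 0 * p = 0" "mconst (a - b) * p = mconst a * p - mconst b * p" for a b and p :: "'a mpoly"
          by (simp_all add: mconst_def single_diff left_diff_distrib)
        have pc: "Poly_Mapping.single v 1 * point_class i = (\<Sum>G\<in>flats. mconst (if i \<in> G then 1 else 0) * Poly_Mapping.single (times_var v G) 1)" for i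
          unfolding point_class_def sum_distrib_left single_mult_mvar
          using finite_flats by (simp add: sum.inter_filter if_distrib[of mconst] if_distrib[of "\<lambda>x. x * _"] mc cong: if_cong)
        have g: "g = (\<Sum>G\<in>flats. mconst (w G) * Poly_Mapping.single (times_var v G) 1)"
          unfolding g_def right_diff_distrib pc by (simp add: w_def mc sum_subtractf)
        have gI: "g \<in> chow_ideal M"
          unfolding g_def
        proof (rule chow_ideal_mult)
          show "point_class i - point_class j \<in> chow_ideal M"
            using ijp by (rule point_class_ideal)
          show "Poly_Mapping.single v 1 \<in> carrier (flat_poly_ring M)"
            using less.prems kv by (intro flat_carrier_single) auto
        qed
        have tv: "Poly_Mapping.single (times_var v G) 1 \<in> top_forms" if "G \<in> flats" for G
          using that degv less.prems kv by (intro top) (auto simp: keys_times_var mon_deg_times_var)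
        have tvc: "mconst (w G) * Poly_Mapping.single (times_var v G) 1 \<in> top_forms" if "G \<in> flats" for G
          using tv[OF that] by (auto intro: flat_carrier_intros homogeneous_mconst_mult)
        then have "g \<in> top_forms" unfolding g by (auto intro!: flat_carrier_sum homogeneous_sum)
        then have "0 = L g" using ideal gI by simp
        also have "\<dots> = (\<Sum>G\<in>flats. w G * L (Poly_Mapping.single (times_var v G) 1))"
          unfolding g using tvc tv by (simp add: Lsum scale)
        also have "\<dots> = (\<Sum>G\<in>{F}. w G * L (Poly_Mapping.single (times_var v G) 1))"
        proof (rule sum.mono_neutral_right)
          show "\<forall>G\<in>flats - {F}. w G * L (Poly_Mapping.single (times_var v G) 1) = 0"
          proof
            fix G assume G: "G \<in> flats - {F}"
            show "w G * L (Poly_Mapping.single (times_var v G) 1) = 0"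
            proof (cases "G \<in> ?K")
              case True
              with AB(5)[OF True] G consider "G \<subseteq> A" | "B \<subseteq> G" by auto
              then have "w G = 0"
              proof cases
                case 1
                then show ?thesis using ij AB(3) by (auto simp: w_def)
              next
                case 2
                then show ?thesis using ij AB(4) by (auto simp: w_def)
              qed
              then show ?thesis by simp
            next
              case False
              have k: "Poly_Mapping.keys (times_var v G) = insert G ?K" by (simp add: keys_times_var kv)
              have "L (Poly_Mapping.single (times_var v G) 1) = 0"
              proof (rule less.hyps)
                show "r - card (Poly_Mapping.keys (times_var v G)) < r - card ?K"
                  unfolding k using False le \<open>card ?K \<noteq> r\<close> by simp
                show "Poly_Mapping.keys (times_var v G) \<subseteq> flats" using k G less.prems by auto
                show "mon_deg (times_var v G) = r" using degv by (simp add: mon_deg_times_var)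
              qed
              then show ?thesis by simp
            qed
          qed
        qed (use F less.prems finite_flats in auto)
        also have "\<dots> = L (Poly_Mapping.single u 1)"
          using ij v by (simp add: w_def)
        finally show ?thesis by simp
      qed
    qed
  qed
  have keys: "Poly_Mapping.keys u \<subseteq> flats" "mon_deg u = r" if "u \<in> Poly_Mapping.keys p" for u
    using p that by (auto simp: carrier_flat_poly_ring homogeneous_iff)
  have top: "Poly_Mapping.single u 1 \<in> top_forms" if "u \<in> Poly_Mapping.keys p" for u
    using keys[OF that] by (auto simp: homogeneous_single intro: flat_carrier_single)
  then have topc: "mconst t * Poly_Mapping.single u 1 \<in> top_forms" if "u \<in> Poly_Mapping.keys p" for u t
    using that by (auto intro: flat_carrier_intros homogeneous_mconst_mult)
  have "L p = L (\<Sum>u\<in>Poly_Mapping.keys p. mconst (Poly_Mapping.lookup p u) * Poly_Mapping.single u 1)"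
    by (simp only: mpoly_eq_sum_monomials)
  also have "\<dots> = 0" using top topc mon keys by (simp add: Lsum scale)
  finally show ?thesis .
qed

text \<open>The difference of the two functionals is linear and vanishes on flags and on top forms
  in the Chow ideal, so \<open>top_functional_zero\<close> applies.\<close>

lemma degree_map_eq_val:
  assumes d: "is_degree_map M d" and p: "p \<in> top_forms"
  shows "d (chow_class M p) = val p"
proof -
  have d_add: "d (chow_class M p \<oplus>\<^bsub>chow_ring M\<^esub> chow_class M p') = d (chow_class M p) + d (chow_class M p')"
    and d_scale: "d (chow_class M (mconst t) \<otimes>\<^bsub>chow_ring M\<^esub> chow_class M p) = t * d (chow_class M p)"
    if "p \<in> top_forms" "p' \<in> top_forms" for p p' t
    using d that unfolding is_degree_map_def chow_graded_top Let_def by blast+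
  have d_flag: "d (chow_class M (\<Prod>F\<in>C. mvar F)) = 1" if "C \<in> complete_flags M" for C
    using d that unfolding is_degree_map_def Let_def by blast
  have d_plus: "d (chow_class M (p + p')) = d (chow_class M p) + d (chow_class M p')"
    if "p \<in> top_forms" "p' \<in> top_forms" for p p'
    using d_add[OF that] that by (simp add: chow_class_add)
  have "d (chow_class M p) - val p = 0"
  proof (rule top_functional_zero[where L = "\<lambda>p. d (chow_class M p) - val p"])
    fix p assume p: "p \<in> top_forms" "p \<in> chow_ideal M"
    have "0 \<in> top_forms" by (simp add: flat_carrier_0 homogeneous_0)
    then have "d (chow_class M 0) = 0" using d_plus[of 0 0] by simp
    then show "d (chow_class M p) - val p = 0"
      using chow_class_eq_0[OF p(2)] chow_ideal_null p val_null by auto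
  next
    fix t p assume p: "p \<in> top_forms"
    then show "d (chow_class M (mconst t * p)) - val (mconst t * p) = t * (d (chow_class M p) - val p)"
      using d_scale[OF p p, of t] by (simp add: chow_class_mult flat_carrier_mconst val_simps right_diff_distrib)
  qed (use p d_plus d_flag val_flag in \<open>auto simp: val_simps\<close>)
  then show ?thesis by simp
qed

text \<open>As \<open>val\<close> is defined on polynomials, a representative of each class has to
  be chosen. Two homogeneous representatives differ by an element of the Chow ideal, on which
  \<open>val\<close> is 0.\<close>

lemma degree_map_exists: "\<exists>d. is_degree_map M d"
proof -
  define T where "T = chow_class M ` top_forms"
  define d where "d = restrict (\<lambda>X. val (SOME p. p \<in> top_forms \<and> chow_class M p = X)) T"
  have d: "d (chow_class M p) = val p" if p: "p \<in> top_forms" for p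
  proof -
    define p' where "p' = (SOME p'. p' \<in> top_forms \<and> chow_class M p' = chow_class M p)"
    have "p' \<in> top_forms \<and> chow_class M p' = chow_class M p"
      unfolding p'_def by (rule someI[of _ p]) (use p in auto)
    then obtain h where "h \<in> chow_ideal M" "p' = h + p" using chow_class_eqD[of p' M p] by auto
    then have "val p' = val p" using chow_ideal_null val_null by (auto simp: val_simps)
    moreover have "d (chow_class M p) = val p'" using p by (simp add: d_def T_def p'_def)
    ultimately show ?thesis by simp
  qed
  have "is_degree_map M d"
    unfolding is_degree_map_def chow_graded_top Let_def
  proof (intro conjI ballI allI)
    show "d \<in> extensional (chow_class M ` top_forms)" by (simp add: d_def T_def)
    show "d (chow_class M (\<Prod>F\<in>C. mvar F)) = 1" if "C \<in> complete_flags M" for C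
      using d[OF flag_top_form[OF that]] val_flag[OF that] by simp
    fix a assume "a \<in> chow_class M ` top_forms"
    then obtain p where p: "a = chow_class M p" "p \<in> top_forms" by blast
    have "mconst t * p \<in> top_forms" for t
      using p by (auto intro: flat_carrier_intros homogeneous_mconst_mult)
    then show "d (chow_class M (mconst t) \<otimes>\<^bsub>chow_ring M\<^esub> a) = t * d a" for t
      using p d by (simp add: flat_carrier_mconst val_simps flip: chow_class_mult)
    fix b assume "b \<in> chow_class M ` top_forms"
    then obtain p' where p': "b = chow_class M p'" "p' \<in> top_forms" by blast
    have "p + p' \<in> top_forms"
      using p p' by (auto intro: flat_carrier_add homogeneous_add)
    then show "d (a \<oplus>\<^bsub>chow_ring M\<^esub> b) = d a + d b"
      using p p' d by (simp add: val_simps flip: chow_class_add)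
  qed
  then show ?thesis by blast
qed

text \<open>Extensionality fixes a degree map off the top graded piece, so agreement with
  \<open>val\<close> on that piece makes it unique and the definite description denotes it.\<close>

theorem chow_deg_eq_val:
  assumes "p \<in> top_forms"
  shows "chow_deg M (chow_class M p) = val p"
proof -
  obtain d where d: "is_degree_map M d" using degree_map_exists by blast
  have unique: "d' = d" if d': "is_degree_map M d'" for d'
  proof (rule extensionalityI)
    show "d' \<in> extensional (chow_class M ` top_forms)" "d \<in> extensional (chow_class M ` top_forms)"
      using d d' unfolding is_degree_map_def chow_graded_top Let_def by simp_all
    fix a assume "a \<in> chow_class M ` top_forms"
    then obtain x where "a = chow_class M x" "x \<in> top_forms" by blast
    then show "d' a = d a" using degree_map_eq_val[OF d] degree_map_eq_val[OF d'] by simp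
  qed
  have "chow_deg M = d" unfolding chow_deg_def using d unique by (rule the_equality)
  then show ?thesis using degree_map_eq_val[OF d assms] by simp
qed

end

section \<open>Intersection numbers of hypersimplex classes\<close>

lemma mconst_add: "mconst (a + b) = mconst a + mconst b"
  by (simp add: mconst_def single_add)

lemma mconst_mult: "mconst (a * b) = mconst a * mconst b"
  by (simp add: mconst_def mult_single)

lemma mconst_0: "mconst 0 = 0"
  by (simp add: mconst_def)

lemma mconst_sum: "mconst (sum g X) = (\<Sum>x\<in>X. mconst (g x))"
  by (induction X rule: infinite_finite_induct) (auto simp: mconst_add mconst_0)

context q_geometry
begin

abbreviation qi :: "nat \<Rightarrow> real" where "qi \<equiv> q_int (real q)"

lemma qi_pos: "j > 0 \<Longrightarrow> qi j > 0"
  using q_pos by (simp add: q_int_pos)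

lemma qi_mono: "i \<le> j \<Longrightarrow> qi i \<le> qi j"
proof (induction rule: dec_induct)
  case (step n)
  then show ?case by (simp add: q_int_Suc add_increasing2)
qed simp

lemma card_qi: "F \<in> insert pts flats \<Longrightarrow> real (card F) = qi (rk F)"
  using card_flat[of F] of_nat_q_int[of q "rk F", where 'a = real] by simp

definition lin_form :: "('a set \<Rightarrow> real) \<Rightarrow> 'a mpoly" where
  "lin_form f = (\<Sum>F\<in>flats. mconst (f F) * mvar F)"

lemma lin_form_cong: "(\<And>F. F \<in> flats \<Longrightarrow> f F = g F) \<Longrightarrow> lin_form f = lin_form g"
  by (auto simp: lin_form_def intro: sum.cong)

lemma lin_form_add: "lin_form (\<lambda>F. f F + g F) = lin_form f + lin_form g"
  by (simp add: lin_form_def mconst_add distrib_right sum.distrib)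

lemma lin_form_scale: "lin_form (\<lambda>F. t * f F) = mconst t * lin_form f"
  by (simp add: lin_form_def mconst_mult sum_distrib_left mult.assoc)

lemma lin_form_sum: "finite X \<Longrightarrow> lin_form (\<lambda>F. \<Sum>x\<in>X. g x F) = (\<Sum>x\<in>X. lin_form (g x))"
proof (induction X rule: finite_induct)
  case empty
  then show ?case by (simp add: lin_form_def mconst_0)
qed (simp add: lin_form_add)

lemma lin_form_carrier: "lin_form f \<in> carrier (flat_poly_ring M)"
  unfolding lin_form_def by (intro flat_carrier_intros) auto

lemma lin_form_homogeneous: "homogeneous 1 (lin_form f)"
  unfolding lin_form_def by (intro homogeneous_sum homogeneous_mconst_mult homogeneous_mvar)

lemma lin_form_indicator: "lin_form (\<lambda>F. if P F then 1 else 0) = (\<Sum>F\<in>{F \<in> flats. P F}. mvar F)"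
proof -
  have "mconst 1 * p = p" for p :: "'a mpoly" by (simp add: mconst_def)
  then show ?thesis
    using finite_flats
    by (simp add: lin_form_def sum.inter_filter if_distrib[of mconst] if_distrib[of "\<lambda>x. x * _"] mconst_0 cong: if_cong)
qed

text \<open>Weights of total 0 turn the form into a combination of the differences
  \<open>point_class e - point_class e0\<close>.\<close>

lemma lin_form_modular_null:
  assumes "(\<Sum>e\<in>pts. a e) = 0"
  shows "lin_form (\<lambda>F. \<Sum>e\<in>F. a e) \<in> null"
proof (cases "pts = {}")
  case True
  then have "flats = {}" using flat_psubset by auto
  then show ?thesis by (simp add: lin_form_def null_0)
next
  case False
  then obtain e0 where e0: "e0 \<in> pts" by auto
  have "(\<Sum>e\<in>F. a e) = (\<Sum>e\<in>pts. a e * (if e \<in> F then 1 else 0))" if "F \<in> flats" for F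
  proof -
    have "(\<Sum>e\<in>pts. a e * (if e \<in> F then 1 else 0)) = (\<Sum>e\<in>{e \<in> pts. e \<in> F}. a e)"
      using finite_ground by (simp add: sum.inter_filter if_distrib[of "\<lambda>x. _ * x"] cong: if_cong)
    also have "{e \<in> pts. e \<in> F} = F" using flat_psubset[OF that] by auto
    finally show ?thesis by simp
  qed
  then have "lin_form (\<lambda>F. \<Sum>e\<in>F. a e) = lin_form (\<lambda>F. \<Sum>e\<in>pts. a e * (if e \<in> F then 1 else 0))"
    by (rule lin_form_cong)
  also have "\<dots> = (\<Sum>e\<in>pts. mconst (a e) * point_class e)"
    using finite_ground by (simp add: lin_form_sum lin_form_scale lin_form_indicator point_class_def)
  also have "\<dots> = (\<Sum>e\<in>pts. mconst (a e) * (point_class e - point_class e0)) + mconst (\<Sum>e\<in>pts. a e) * point_class e0"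
    by (simp add: mconst_sum right_diff_distrib sum_subtractf sum_distrib_right)
  also have "\<dots> = (\<Sum>e\<in>pts. mconst (a e) * (point_class e - point_class e0))"
    by (simp add: assms mconst_0)
  also have "\<dots> \<in> null" by (intro null_sum null_mult point_class_null e0)
  finally show ?thesis .
qed

text \<open>A representative of the hypersimplex class of index (k)_q, written in terms of ranks. At
  \<open>k = 0\<close> and \<open>k = r + 1\<close> it is 0, in accordance with the boundary
  convention of the recursion.\<close>

definition gam :: "nat \<Rightarrow> 'a mpoly" where
  "gam k = lin_form (\<lambda>F. min (qi (rk F)) (qi k) - qi k / qi (r + 1) * qi (rk F))"

definition rank_class :: "nat \<Rightarrow> 'a mpoly" where
  "rank_class j = (\<Sum>F\<in>{F \<in> flats. rk F = j}. mvar F)"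

lemma gam_0: "gam 0 = 0"
proof -
  have "min (qi (rk F)) (qi 0) = 0" for F using qi_mono[of 0 "rk F"] by simp
  then show ?thesis by (simp add: gam_def lin_form_def mconst_0)
qed

lemma gam_top: "gam (r + 1) = 0"
proof -
  have "min (qi (rk F)) (qi (r + 1)) - qi (r + 1) / qi (r + 1) * qi (rk F) = 0" if "F \<in> flats" for F
    using qi_mono[of "rk F" "r + 1"] rk_flat[OF that] qi_pos[of "r + 1"] by simp
  then have "gam (r + 1) = lin_form (\<lambda>F. 0)" unfolding gam_def by (rule lin_form_cong)
  then show ?thesis by (simp add: lin_form_def mconst_0)
qed

text \<open>Modulo the linear form of the weights \<open>[e \<in> F] - \<bar>F\<bar> / \<bar>E\<bar>\<close>, whose total is \<open>0\<close>, the class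
  \<open>\<gamma>\<close> only involves flats incomparable to \<open>F\<close>.\<close>

lemma gam_mvar_null:
  assumes F: "F \<in> flats"
  shows "gam (rk F) * mvar F \<in> null"
proof -
  define a where "a e = (if e \<in> F then 1 else 0) - qi (rk F) / qi (r + 1)" for e
  have fin: "finite G" if "G \<in> insert pts flats" for G
    using that flat_psubset finite_ground by (auto intro: finite_subset)
  have asum: "(\<Sum>e\<in>G. a e) = real (card (G \<inter> F)) - qi (rk F) / qi (r + 1) * qi (rk G)" if "G \<in> insert pts flats" for G
    using fin[OF that] card_qi[OF that] by (simp add: a_def sum_subtractf sum.If_cases)
  have "pts \<inter> F = F" using flat_psubset[OF F] by auto
  then have "(\<Sum>e\<in>pts. a e) = 0"
    using asum[of pts] card_qi[of F] F qi_pos[of "r + 1"] rank_ground by simp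
  then have 1: "lin_form (\<lambda>G. \<Sum>e\<in>G. a e) \<in> null" by (rule lin_form_modular_null)
  \<comment> \<open>For comparable flats the intersection is the smaller of the two, so its size is
    the minimum and \<open>b G\<close> is 0.\<close>
  define b where "b G = min (qi (rk G)) (qi (rk F)) - real (card (G \<inter> F))" for G
  have "gam (rk F) = lin_form (\<lambda>G. b G + (\<Sum>e\<in>G. a e))"
    unfolding gam_def by (rule lin_form_cong) (simp add: b_def asum)
  then have "gam (rk F) * mvar F = (\<Sum>G\<in>flats. mconst (b G) * mvar G) * mvar F + mvar F * lin_form (\<lambda>G. \<Sum>e\<in>G. a e)"
    by (simp add: lin_form_add distrib_right lin_form_def[of b] mult.commute[of "lin_form _"])
  moreover have "(\<Sum>G\<in>flats. mconst (b G) * mvar G) * mvar F \<in> null"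
    unfolding sum_distrib_right
  proof (rule null_sum)
    fix G assume G: "G \<in> flats"
    show "mconst (b G) * mvar G * mvar F \<in> null"
    proof (cases "G \<subseteq> F \<or> F \<subseteq> G")
      case True
      then have "b G = 0"
      proof
        assume "G \<subseteq> F"
        then show ?thesis using rk_mono[OF G F] qi_mono card_qi[of G] G
          by (simp add: b_def Int_absorb2)
      next
        assume "F \<subseteq> G"
        then show ?thesis using rk_mono[OF F G] qi_mono card_qi[of F] F
          by (simp add: b_def Int_absorb1 min_absorb2)
      qed
      then show ?thesis by (simp add: mconst_0 null_0)
    next
      case False
      then show ?thesis unfolding mult.assoc using G F by (intro null_mult incomparable_null) auto
    qed
  qed
  ultimately show ?thesis using 1 by (simp add: null_add null_mult)
qed

lemma gam_rank_class_null: "gam j * rank_class j \<in> null"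
  unfolding rank_class_def sum_distrib_left by (intro null_sum) (auto intro: gam_mvar_null)

lemma gam_second_difference:
  assumes "1 \<le> j" "j \<le> r"
  shows "mconst (real q + 1) * gam j - mconst (real q) * gam (j - 1) - gam (j + 1) = mconst (real q ^ j) * rank_class j"
proof -
  obtain i where j: "j = Suc i" using assms by (cases j) auto
  have x: "qi j = qi i + real q ^ i" "qi (j + 1) = qi i + real q ^ i + real q * real q ^ i"
    by (simp_all add: j q_int_Suc)
  have "mconst (real q + 1) * gam j = mconst (real q) * gam (j - 1) + (gam (j + 1) + mconst (real q ^ j) * rank_class j)"
    unfolding gam_def rank_class_def lin_form_indicator[symmetric] lin_form_scale[symmetric] lin_form_add[symmetric]
  proof (rule lin_form_cong)
    fix F assume "F \<in> flats"
    define m where "m = rk F"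
    define t where "t = qi m / qi (r + 1)"
    have lin: "qi k / qi (r + 1) * qi m = qi k * t" for k by (simp add: t_def)
    have qq: "real q ^ i > 0" using q_pos by simp
    have "(real q + 1) * min (qi m) (qi j) = real q * min (qi m) (qi i) + min (qi m) (qi (j + 1)) + (if m = j then real q ^ j else 0)"
    proof (cases m j rule: linorder_cases)
      case less
      then have "qi m \<le> qi i" "qi m \<le> qi j" "qi m \<le> qi (j + 1)" using qi_mono j by simp_all
      then show ?thesis using less by (simp add: min_absorb1 distrib_right)
    next
      case equal
      then show ?thesis using qq x j q_pos by (simp add: algebra_simps)
    next
      case greater
      then have "qi i \<le> qi m" "qi j \<le> qi m" "qi (j + 1) \<le> qi m" using qi_mono j by simp_all
      then have "min (qi m) (qi i) = qi i" "min (qi m) (qi j) = qi j" "min (qi m) (qi (j + 1)) = qi (j + 1)"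
        by simp_all
      then show ?thesis using greater x by (simp add: algebra_simps)
    qed
    moreover have "(real q + 1) * (qi j * t) = real q * (qi i * t) + qi (j + 1) * t"
      unfolding x by (simp add: algebra_simps)
    ultimately show "(real q + 1) * (min (qi (rk F)) (qi j) - qi j / qi (r + 1) * qi (rk F)) =
         real q * (min (qi (rk F)) (qi (j - 1)) - qi (j - 1) / qi (r + 1) * qi (rk F)) +
         (min (qi (rk F)) (qi (j + 1)) - qi (j + 1) / qi (r + 1) * qi (rk F) +
          real q ^ j * (if rk F = j then 1 else 0))"
      unfolding m_def[symmetric] lin using j by (simp add: right_diff_distrib)
  qed
  then show ?thesis by (simp add: algebra_simps)
qed

text \<open>The ratio \<open>qi k / qi (k + 1)\<close> makes the two truncations agree at all ranks
  above \<open>k\<close>, and the linear parts scale by the same ratio. Only flats of rank at most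
  \<open>k\<close> are left over.\<close>

lemma gam_reduce:
  assumes "k \<le> r"
  shows "gam k = mconst (qi k / qi (k + 1)) * gam (k + 1) +
    (\<Sum>F\<in>{F \<in> flats. rk F \<le> k}. mconst (qi (rk F) * (real q ^ k / qi (k + 1))) * mvar F)"
proof -
  have x: "qi (k + 1) = qi k + real q ^ k" by (simp add: q_int_Suc)
  have pos: "qi (k + 1) > 0" by (simp add: qi_pos)
  have "gam k = lin_form (\<lambda>F. qi k / qi (k + 1) * (min (qi (rk F)) (qi (k + 1)) - qi (k + 1) / qi (r + 1) * qi (rk F))
     + (if rk F \<le> k then qi (rk F) * (real q ^ k / qi (k + 1)) else 0))"
    unfolding gam_def
  proof (rule lin_form_cong)
    fix F assume "F \<in> flats"
    define m where "m = rk F"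
    have "min (qi m) (qi k) = qi k / qi (k + 1) * min (qi m) (qi (k + 1)) + (if m \<le> k then qi m * (real q ^ k / qi (k + 1)) else 0)"
    proof (cases "m \<le> k")
      case True
      then have "qi m \<le> qi k" "qi m \<le> qi (k + 1)" using qi_mono by auto
      then have "min (qi m) (qi k) = qi m" "min (qi m) (qi (k + 1)) = qi m" by auto
      moreover have "qi m = qi k / qi (k + 1) * qi m + qi m * (real q ^ k / qi (k + 1))"
      proof -
        have "qi k / qi (k + 1) * qi m + qi m * (real q ^ k / qi (k + 1)) = qi m * ((qi k + real q ^ k) / qi (k + 1))"
          by (simp only: add_divide_distrib distrib_left mult.commute)
        then show ?thesis using pos x by simp
      qed
      ultimately show ?thesis using True by simp
    next
      case False
      then have "qi k \<le> qi m" "qi (k + 1) \<le> qi m" using qi_mono by auto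
      then show ?thesis using False pos by (simp add: min_absorb2)
    qed
    then show "min (qi (rk F)) (qi k) - qi k / qi (r + 1) * qi (rk F) =
      qi k / qi (k + 1) * (min (qi (rk F)) (qi (k + 1)) - qi (k + 1) / qi (r + 1) * qi (rk F))
     + (if rk F \<le> k then qi (rk F) * (real q ^ k / qi (k + 1)) else 0)"
      using pos by (simp add: m_def right_diff_distrib)
  qed
  also have "\<dots> = mconst (qi k / qi (k + 1)) * gam (k + 1) + lin_form (\<lambda>F. if rk F \<le> k then qi (rk F) * (real q ^ k / qi (k + 1)) else 0)"
    by (simp only: lin_form_add lin_form_scale gam_def)
  also have "lin_form (\<lambda>F. if rk F \<le> k then qi (rk F) * (real q ^ k / qi (k + 1)) else 0) =
      (\<Sum>F\<in>{F \<in> flats. rk F \<le> k}. mconst (qi (rk F) * (real q ^ k / qi (k + 1))) * mvar F)"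
    using finite_flats
    by (simp add: lin_form_def sum.inter_filter if_distrib[of mconst] if_distrib[of "\<lambda>x. x * _"] mconst_0 cong: if_cong)
  finally show ?thesis .
qed

text \<open>For \<open>k > 0\<close> the factor \<open>gam k\<close> is rewritten by
  \<open>gam_reduce\<close>. Its term in \<open>gam (k + 1)\<close> dies against the flat of rank
  \<open>k + 1\<close> in \<open>C\<close>, or is 0 at the top; flats of rank below \<open>k\<close>
  die against the other factors \<open>gam i\<close>. What remains are the flats of rank
  \<open>k\<close> that extend the chain, and their number (k+1)_q cancels the denominator.\<close>

lemma val_gam_flag:
  assumes "k \<le> r" "C \<subseteq> flats" "\<And>F G. F \<in> C \<Longrightarrow> G \<in> C \<Longrightarrow> F \<subseteq> G \<or> G \<subseteq> F" "bij_betw rk C {k + 1..r}"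
  shows "val ((\<Prod>i=1..k. gam i) * (\<Prod>F\<in>C. mvar F)) = real q ^ ((k + 1) choose 2) * q_fact (real q) k"
  using assms
proof (induction k arbitrary: C)
  case 0
  have "finite C" using 0(2) finite_flats by (rule finite_subset)
  moreover have "card C = r" using bij_betw_same_card[OF 0(4)] by simp
  moreover have "\<forall>F\<in>C. \<forall>G\<in>C. F \<subseteq> G \<or> G \<subseteq> F" using 0(3) by blast
  ultimately have "C \<in> complete_flags M" using 0(2) rank_ground by (simp add: complete_flags_def)
  then show ?case using val_flag by (simp add: numeral_2_eq_2)
next
  case (Suc k)
  have finC: "finite C" using Suc.prems(2) finite_flats by (rule finite_subset)
  define P where "P = (\<Prod>i=1..k. gam i)"
  define X where "X = (\<Prod>F\<in>C. mvar F)"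
  have rkC: "rk G \<ge> Suc k + 1" if "G \<in> C" for G using Suc.prems(4) that by (auto simp: bij_betw_def)
  \<comment> \<open>The least member of \<open>C\<close>, or the whole ground set if
    \<open>C\<close> is empty; it bounds the flats by which the chain can be extended.\<close>
  obtain B where B: "B \<in> insert pts flats" "rk B = Suc k + 1" "\<And>G. G \<in> C \<Longrightarrow> B \<subseteq> G" "B \<in> C \<or> Suc k = r \<and> C = {} \<and> B = pts"
  proof (cases "Suc k = r")
    case True
    then have "C = {}" using Suc.prems(4) by (simp add: bij_betw_def)
    then show ?thesis using that[of pts] True rank_ground by auto
  next
    case False
    then have "Suc k + 1 \<in> rk ` C" using Suc.prems by (auto simp: bij_betw_def)
    then obtain B where "B \<in> C" "rk B = Suc k + 1" by auto
    moreover have "B \<subseteq> G" if "G \<in> C" for G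
      using Suc.prems(3)[OF \<open>B \<in> C\<close> that] rank_strict[of G B] rkC[OF that] \<open>B \<in> C\<close> \<open>rk B = _\<close> Suc.prems(2) that
      by (auto simp: psubset_eq)
    ultimately show ?thesis using that[of B] Suc.prems(2) by auto
  qed
  have top0: "val (P * X * (mconst t * gam (Suc k + 1))) = 0" for t
    using B(4)
  proof
    assume BC: "B \<in> C"
    have "X = mvar B * (\<Prod>F\<in>C - {B}. mvar F)" unfolding X_def using finC BC by (rule prod.remove)
    then have "P * X * (mconst t * gam (Suc k + 1)) = (P * (\<Prod>F\<in>C - {B}. mvar F) * mconst t) * (gam (rk B) * mvar B)"
      using B(2) by (simp add: mult_ac)
    also have "\<dots> \<in> null" using BC Suc.prems(2) by (intro null_mult gam_mvar_null) auto
    finally show ?thesis by (rule val_null)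
  next
    assume "Suc k = r \<and> C = {} \<and> B = pts"
    then have "gam (Suc k + 1) = 0" using gam_top by simp
    then show ?thesis by (simp add: val_simps)
  qed
  have low: "val (P * X * mvar F) = 0" if F: "F \<in> flats" "rk F \<le> k" for F
  proof -
    have "rk F \<in> {1..k}" using F rk_flat by auto
    then have "P = gam (rk F) * (\<Prod>i\<in>{1..k} - {rk F}. gam i)" unfolding P_def by (intro prod.remove) auto
    then have "P * X * mvar F = ((\<Prod>i\<in>{1..k} - {rk F}. gam i) * X) * (gam (rk F) * mvar F)"
      by (simp add: mult_ac)
    also have "\<dots> \<in> null" using F by (intro null_mult gam_mvar_null)
    finally show ?thesis by (rule val_null)
  qed
  have eq: "val (P * X * mvar F) = (if F \<subset> B then real q ^ ((k + 1) choose 2) * q_fact (real q) k else 0)"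
    if F: "F \<in> flats" "rk F = Suc k" for F
  proof (cases "F \<subset> B")
    case True
    have "F \<notin> C" using rkC[of F] F by auto
    have "val (P * (\<Prod>F\<in>insert F C. mvar F)) = real q ^ ((k + 1) choose 2) * q_fact (real q) k"
      unfolding P_def
    proof (rule Suc.IH)
      show "k \<le> r" "insert F C \<subseteq> flats" using Suc.prems F by auto
      show "G \<subseteq> G' \<or> G' \<subseteq> G" if "G \<in> insert F C" "G' \<in> insert F C" for G G'
        using that Suc.prems(3)[of G G'] B(3) True by auto
      have "{k + 1..r} = insert (Suc k) {Suc k + 1..r}" using Suc.prems by auto
      then show "bij_betw rk (insert F C) {k + 1..r}"
        using Suc.prems(4) F \<open>F \<notin> C\<close> by (auto simp: bij_betw_def)
    qed
    moreover have "P * (\<Prod>F\<in>insert F C. mvar F) = P * X * mvar F"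
      using \<open>F \<notin> C\<close> finC by (simp add: X_def mult_ac)
    ultimately show ?thesis using True by simp
  next
    case False
    have "F \<subset> pts" using F flat_psubset by auto
    then have BC: "B \<in> C" using B(4) False by auto
    have "\<not> F \<subseteq> B" using False F B(2) by auto
    moreover have "\<not> B \<subseteq> F" using rk_mono[of B F] BC Suc.prems(2) F B(2) by auto
    ultimately have "mvar F * mvar B \<in> null" using F BC Suc.prems(2) by (intro incomparable_null) auto
    moreover have "X = mvar B * (\<Prod>F\<in>C - {B}. mvar F)" unfolding X_def using finC BC by (rule prod.remove)
    then have "P * X * mvar F = (P * (\<Prod>F\<in>C - {B}. mvar F)) * (mvar F * mvar B)" by (simp add: mult_ac)
    ultimately have "P * X * mvar F \<in> null" using null_mult by simp
    then show ?thesis using False val_null by simp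
  qed
  let ?S = "{F \<in> flats. rk F \<le> Suc k}" and ?w = "\<lambda>F. qi (rk F) * (real q ^ Suc k / qi (Suc k + 1))"
  let ?T = "{F \<in> flats. {} \<subset> F \<and> F \<subset> B \<and> rk F = Suc k}"
  have "val ((\<Prod>i=1..Suc k. gam i) * (\<Prod>F\<in>C. mvar F)) = val (P * X * gam (Suc k))"
    by (simp add: P_def X_def mult_ac)
  also have "\<dots> = val (P * X * (mconst (qi (Suc k) / qi (Suc k + 1)) * gam (Suc k + 1))) +
      val (P * X * (\<Sum>F\<in>?S. mconst (?w F) * mvar F))"
    using gam_reduce[of "Suc k"] Suc.prems(1) by (simp add: distrib_left val_simps)
  also have "\<dots> = (\<Sum>F\<in>?S. ?w F * val (P * X * mvar F))"
  proof -
    have "val (P * X * (mconst t * p)) = t * val (P * X * p)" for t p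
      using val_simps(5)[of t "P * X * p"] by (simp add: mult_ac)
    then show ?thesis unfolding top0 sum_distrib_left val_simps(4) by simp
  qed
  also have "\<dots> = (\<Sum>F\<in>?T. ?w F * val (P * X * mvar F))"
  proof (rule sum.mono_neutral_right)
    show "\<forall>F\<in>?S - ?T. ?w F * val (P * X * mvar F) = 0"
    proof
      fix F assume F: "F \<in> ?S - ?T"
      then have "rk F \<le> k \<or> rk F = Suc k \<and> \<not> F \<subset> B" using flat_psubset[of F] by auto
      then have "val (P * X * mvar F) = 0" using low[of F] eq[of F] F by (auto split: if_splits)
      then show "?w F * val (P * X * mvar F) = 0" by simp
    qed
  qed (use finite_flats in auto)
  also have "\<dots> = (\<Sum>F\<in>?T. qi (Suc k) * (real q ^ Suc k / qi (Suc k + 1)) * (real q ^ ((k + 1) choose 2) * q_fact (real q) k))"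
    by (rule sum.cong) (auto simp: eq)
  also have "\<dots> = real (card ?T) * (qi (Suc k) * (real q ^ Suc k / qi (Suc k + 1)) * (real q ^ ((k + 1) choose 2) * q_fact (real q) k))"
    by simp
  also have "real (card ?T) = qi (Suc k + 1)"
  proof -
    have "{} \<subset> B" using B(1,2) flat_psubset[of B] rank_empty by (cases "B = {}") auto
    then show ?thesis
      using card_between[of "{}" B "Suc k"] B(1,2) rank_empty qbin_Suc_self[of "real q" "Suc k"]
      by (simp del: qbin.simps)
  qed
  also have "qi (Suc k + 1) * (qi (Suc k) * (real q ^ Suc k / qi (Suc k + 1)) * (real q ^ ((k + 1) choose 2) * q_fact (real q) k))
     = real q ^ (Suc k + ((k + 1) choose 2)) * (q_fact (real q) k * qi (Suc k))"
    using qi_pos[of "Suc k + 1"] by (simp add: power_add)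
  also have "Suc k + ((k + 1) choose 2) = (Suc k + 1) choose 2"
    by (simp add: numeral_2_eq_2)
  finally show ?case by (simp only: q_fact_Suc)
qed

definition gam_mon :: "(nat \<Rightarrow> nat) \<Rightarrow> 'a mpoly" where
  "gam_mon c = (\<Prod>k=1..r. gam k ^ c k)"

lemma gam_mon_Suc:
  assumes "j \<in> {1..r}"
  shows "gam_mon (d(j := d j + 1)) = gam j * gam_mon d"
proof -
  have "(\<Prod>k\<in>{1..r} - {j}. gam k ^ (d(j := d j + 1)) k) = (\<Prod>k\<in>{1..r} - {j}. gam k ^ d k)"
    by (rule prod.cong) auto
  then show ?thesis
    using assms unfolding gam_mon_def by (simp add: prod.remove[of _ j] mult_ac)
qed

lemma gam_mon_ones: "val (gam_mon (ones r)) = real q ^ ((r + 1) choose 2) * q_fact (real q) r"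
proof -
  have "gam_mon (ones r) = (\<Prod>i=1..r. gam i) * (\<Prod>F\<in>{}. mvar F)"
    by (simp add: gam_mon_def ones_def)
  then show ?thesis using val_gam_flag[of r "{}"] by (simp add: bij_betw_def)
qed

text \<open>Of the two factors \<open>gam i\<close> available when \<open>c i\<close> \<ge> 2, one
  is expanded by \<open>gam_second_difference\<close> and the other kills the resulting
  \<open>rank_class i\<close>. A move out of \<open>{1..r}\<close> gives 0 because
  \<open>gam 0\<close> and \<open>gam (r + 1)\<close> are 0. Dividing by the power of
  \<open>q\<close> makes the value at \<open>ones r\<close> the q-factorial.\<close>

lemma val_gam_harmonic:
  "q_harmonic r (real q) (\<lambda>c. if c \<in> weight_vectors r then val (gam_mon c) / real q ^ ((r + 1) choose 2) else 0)"
proof -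
  let ?a = "\<lambda>c. if c \<in> weight_vectors r then val (gam_mon c) / real q ^ ((r + 1) choose 2) else 0"
  have "(real q + 1) * ?a c = real q * ?a (move_unit c i (i - 1)) + ?a (move_unit c i (i + 1))"
    if c: "c \<in> weight_vectors r" and i: "i \<in> {1..r}" "2 \<le> c i" for c i
  proof -
    define d where "d = c(i := c i - 1)"
    have cd: "c = d(i := d i + 1)" using i by (simp add: d_def fun_eq_iff)
    have mon: "?a (move_unit c i j) = val (gam_mon d * gam j) / real q ^ ((r + 1) choose 2)"
      if "j = i - 1 \<or> j = i + 1" for j
    proof (cases "j \<in> {1..r}")
      case True
      have ij: "i \<noteq> j" using that i by auto
      then have "move_unit c i j = d(j := d j + 1)" by (auto simp: move_unit_def d_def)
      moreover have "move_unit c i j \<in> weight_vectors r"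
        using move_unit_weight[OF c i(1) True ij] i by simp
      ultimately show ?thesis using gam_mon_Suc[OF True, of d] by (simp add: mult.commute)
    next
      case False
      then have "j = 0 \<or> j = r + 1" using that i by auto
      then have "gam j = 0" using gam_0 gam_top by auto
      then show ?thesis using move_unit_not_weight[OF False] by (simp add: val_simps)
    qed
    have gc: "gam_mon c = gam_mon d * gam i"
      by (subst cd, subst gam_mon_Suc[OF i(1)]) (simp add: mult.commute)
    define d' where "d' = d(i := d i - 1)"
    have "d = d'(i := d' i + 1)" using i by (simp add: d'_def d_def fun_eq_iff)
    then have gd: "gam_mon d = gam i * gam_mon d'" using gam_mon_Suc[OF i(1)] by metis
    have "val (gam_mon d * (mconst (real q + 1) * gam i - mconst (real q) * gam (i - 1) - gam (i + 1))) =
        val ((mconst (real q ^ i) * gam_mon d') * (gam i * rank_class i))"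
      using gam_second_difference[of i] i by (simp add: gd mult_ac)
    also have "\<dots> = 0" by (intro val_null null_mult gam_rank_class_null)
    finally have "(real q + 1) * val (gam_mon d * gam i) = real q * val (gam_mon d * gam (i - 1)) + val (gam_mon d * gam (i + 1))"
    proof -
      have "val (gam_mon d * (mconst t * p)) = t * val (gam_mon d * p)" for t p
        using val_simps(5)[of t "gam_mon d * p"] by (simp add: mult_ac)
      moreover assume "val (gam_mon d * (mconst (real q + 1) * gam i - mconst (real q) * gam (i - 1) - gam (i + 1))) = 0"
      ultimately show ?thesis by (simp add: right_diff_distrib val_simps)
    qed
    then show ?thesis using c mon[of "i - 1"] mon[of "i + 1"] by (simp add: gc flip: add_divide_distrib)
  qed
  then show ?thesis by (auto simp: q_harmonic_def)
qed

lemma hypersimplex_class_gam: "hypersimplex_class M (q_int q k) = chow_class M (gam k)"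
proof -
  let ?f = "\<lambda>S. real (min (card S) (q_int q k)) - real (q_int q k) / real (card pts) * real (card S)"
  have "(\<Sum>S\<in>{S. S \<noteq> {} \<and> S \<subset> pts}. mconst (?f S) * flat_var M S) = (\<Sum>S\<in>flats. mconst (?f S) * flat_var M S)"
    using finite_ground flat_psubset
    by (intro sum.mono_neutral_right) (auto simp: flat_var_def intro: finite_subset[of _ "Pow pts"])
  also have "\<dots> = lin_form ?f"
    unfolding lin_form_def by (rule sum.cong) (auto simp: flat_var_def)
  also have "\<dots> = gam k"
    unfolding gam_def
  proof (rule lin_form_cong)
    fix F assume F: "F \<in> flats"
    have k: "real (q_int q k) = qi k" by (rule of_nat_q_int)
    show "?f F = min (qi (rk F)) (qi k) - qi k / qi (r + 1) * qi (rk F)"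
      unfolding of_nat_min k using card_qi[of F] card_qi[of pts] F rank_ground by simp
  qed
  finally show ?thesis by (simp add: hypersimplex_class_def)
qed

theorem chow_deg_hypersimplex:
  assumes c: "c \<in> weight_vectors r"
  shows "chow_deg M (\<Otimes>\<^bsub>chow_ring M\<^esub>k\<in>{1..r}. hypersimplex_class M (q_int q k) [^]\<^bsub>chow_ring M\<^esub> c k)
    = real q ^ ((r + 1) choose 2) * poly (remixed_eulerian r c) (real q)"
proof -
  have gc: "gam k \<in> carrier (flat_poly_ring M)" "homogeneous 1 (gam k)" for k
    unfolding gam_def by (rule lin_form_carrier, rule lin_form_homogeneous)
  have "(\<Otimes>\<^bsub>chow_ring M\<^esub>k\<in>{1..r}. hypersimplex_class M (q_int q k) [^]\<^bsub>chow_ring M\<^esub> c k) =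
      (\<Otimes>\<^bsub>chow_ring M\<^esub>k\<in>{1..r}. chow_class M (gam k ^ c k))"
    using gc by (simp add: hypersimplex_class_gam chow_class_power)
  also have "\<dots> = chow_class M (gam_mon c)"
    unfolding gam_mon_def using gc by (intro chow_class_prod[symmetric] flat_carrier_power) auto
  finally have "chow_deg M (\<Otimes>\<^bsub>chow_ring M\<^esub>k\<in>{1..r}. hypersimplex_class M (q_int q k) [^]\<^bsub>chow_ring M\<^esub> c k) =
      chow_deg M (chow_class M (gam_mon c))" by simp
  also have "\<dots> = val (gam_mon c)"
  proof (rule chow_deg_eq_val)
    have "homogeneous (\<Sum>k=1..r. c k) (gam_mon c)"
      unfolding gam_mon_def using gc by (intro homogeneous_prod homogeneous_power) auto
    then show "gam_mon c \<in> top_forms"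
      using c gc by (auto simp: weight_vectors_def gam_mon_def intro!: flat_carrier_prod flat_carrier_power)
  qed
  also have "\<dots> = real q ^ ((r + 1) choose 2) * poly (remixed_eulerian r c) (real q)"
  proof -
    have "q_fact (real q) r = val (gam_mon (ones r)) / real q ^ ((r + 1) choose 2)"
      unfolding gam_mon_ones using q_pos by simp
    then show ?thesis
      using poly_remixed_eulerian_eq[OF _ val_gam_harmonic, of c] q_pos c ones_weight by (simp add: field_simps)
  qed
  finally show ?thesis .
qed

end

section \<open>Subspaces over a finite field\<close>

lemma card_span_independent:
  fixes S :: "('k::{field,finite} ^ 'n::finite) set"
  assumes "vec.independent S"
  shows "card (vec.span S) = CARD('k) ^ card S"
proof -
  have "finite S" by simp
  then show ?thesis using assms
  proof (induction S rule: finite_induct)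
    case empty
    show ?case by simp
  next
    case (insert x S)
    have x: "x \<notin> vec.span S" and S: "vec.independent S"
      using insert.prems insert.hyps by (auto simp: vec.independent_insert)
    let ?f = "\<lambda>(k, y). k *s x + y"
    have "vec.span (insert x S) = ?f ` (UNIV \<times> vec.span S)"
    proof
      show "vec.span (insert x S) \<subseteq> ?f ` (UNIV \<times> vec.span S)"
      proof
        fix y assume "y \<in> vec.span (insert x S)"
        then obtain k where "y - k *s x \<in> vec.span S" by (auto simp: vec.span_insert)
        then show "y \<in> ?f ` (UNIV \<times> vec.span S)" by (intro image_eqI[of _ _ "(k, y - k *s x)"]) auto
      qed
      show "?f ` (UNIV \<times> vec.span S) \<subseteq> vec.span (insert x S)"
      proof clarify
        fix k y assume "y \<in> vec.span S"
        then show "k *s x + y \<in> vec.span (insert x S)"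
          unfolding vec.span_insert by (intro CollectI exI[of _ k]) simp
      qed
    qed
    moreover have "inj_on ?f (UNIV \<times> vec.span S)"
    proof (rule inj_onI, clarify)
      fix k y k' y' assume y: "y \<in> vec.span S" "y' \<in> vec.span S" and eq: "k *s x + y = k' *s x + y'"
      have "(k - k') *s x = y' - y" using eq by (simp add: vec.scale_left_diff_distrib algebra_simps)
      then have "(k - k') *s x \<in> vec.span S" using y by (simp add: vec.span_diff)
      then have "inverse (k - k') *s ((k - k') *s x) \<in> vec.span S" by (rule vec.span_scale)
      then have "k = k'" using x by (cases "k = k'") (simp_all only: vec.scale_scale, simp_all)
      then show "k = k' \<and> y = y'" using eq by simp
    qed
    ultimately have "card (vec.span (insert x S)) = CARD('k) * card (vec.span S)"
      by (simp add: card_image card_cartesian_product)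
    then show ?case using insert S by simp
  qed
qed

lemma card_subspace:
  fixes W :: "('k::{field,finite} ^ 'n::finite) set"
  assumes "vec.subspace W"
  shows "card W = CARD('k) ^ vec.dim W"
proof -
  obtain S where S: "S \<subseteq> W" "vec.independent S" "W \<subseteq> vec.span S" "card S = vec.dim W"
    using vec.basis_exists by metis
  then have "vec.span S = W" using assms by (metis vec.span_subspace)
  then show ?thesis using card_span_independent[OF S(2)] S(4) by simp
qed

lemma card_field_ge_2: "CARD('k::{field,finite}) \<ge> 2"
proof -
  have "card {0, 1 :: 'k} \<le> CARD('k)" by (rule card_mono) auto
  then show ?thesis by simp
qed

lemma q_int_geometric: "(q - 1) * q_int q n = q ^ n - (1 :: 'a :: comm_ring_1)"
  by (induction n) (simp_all add: q_int_Suc algebra_simps)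

lemma subspace_psubset_dim:
  fixes A B :: "('k::field ^ 'n::finite) set"
  shows "vec.subspace A \<Longrightarrow> vec.subspace B \<Longrightarrow> A \<subset> B \<Longrightarrow> vec.dim A < vec.dim B"
  using vec.dim_psubset[of A B] by (simp add: vec.span_eq_iff[THEN iffD2])

text \<open>Double counting of pairs of a subspace \<open>G\<close> and a vector of
  \<open>G - A\<close>. For a fixed vector these \<open>G\<close> are the subspaces above the span
  of \<open>A\<close> and that vector, which has one dimension more, so the induction hypothesis
  applies; the resulting identity is solved by \<open>qbin_absorb\<close>.\<close>

lemma card_subspaces_between:
  fixes A B :: "('k::{field,finite} ^ 'n::finite) set"
  assumes "vec.subspace A" "vec.subspace B" "A \<subseteq> B"
  shows "real (card {G. vec.subspace G \<and> A \<subseteq> G \<and> G \<subseteq> B \<and> vec.dim G = vec.dim A + s}) =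
    qbin (real CARD('k)) (vec.dim B - vec.dim A) s"
  using assms
proof (induction s arbitrary: A)
  case 0
  have "{G. vec.subspace G \<and> A \<subseteq> G \<and> G \<subseteq> B \<and> vec.dim G = vec.dim A + 0} = {A}"
    using 0 vec.subspace_dim_equal[of A] by force
  then show ?case by simp
next
  case (Suc s)
  define q where "q = real CARD('k)"
  define a b where "a = vec.dim A" and "b = vec.dim B"
  have q: "q > 1" using card_field_ge_2[where 'k = 'k] by (simp add: q_def)
  have ab: "a \<le> b" using Suc.prems by (simp add: a_def b_def vec.dim_subset)
  define X where "X = {G. vec.subspace G \<and> A \<subseteq> G \<and> G \<subseteq> B \<and> vec.dim G = a + Suc s}"
  define Y where "Y v = {G. vec.subspace G \<and> A \<subseteq> G \<and> G \<subseteq> B \<and> vec.dim G = a + Suc s \<and> v \<in> G}" for v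
  have cd: "real (card (G - A)) = q ^ vec.dim G - q ^ a" if "vec.subspace G" "A \<subseteq> G" for G
  proof -
    have "card (G - A) = card G - card A" using that by (intro card_Diff_subset) auto
    moreover have "card A \<le> card G" using that by (intro card_mono) auto
    ultimately show ?thesis
      using that Suc.prems(1) by (simp add: card_subspace q_def a_def of_nat_diff)
  qed
  have Yv: "real (card (Y v)) = qbin q (b - (a + 1)) s" if v: "v \<in> B - A" for v
  proof -
    let ?A = "vec.span (insert v A)"
    have dimA: "vec.dim ?A = a + 1"
      using v Suc.prems(1) by (simp add: vec.dim_insert a_def vec.span_eq_iff[THEN iffD2])
    have "vec.subspace G \<Longrightarrow> A \<subseteq> G \<and> v \<in> G \<longleftrightarrow> ?A \<subseteq> G" for G
      by (metis insert_subset vec.span_minimal vec.span_superset subset_trans)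
    then have "Y v = {G. vec.subspace G \<and> ?A \<subseteq> G \<and> G \<subseteq> B \<and> vec.dim G = vec.dim ?A + s}"
      unfolding Y_def dimA by auto
    moreover have "?A \<subseteq> B" using v Suc.prems by (intro vec.span_minimal) auto
    ultimately show ?thesis
      using Suc.IH[of ?A] Suc.prems(2) unfolding dimA q_def b_def by simp
  qed
  have "(\<Sum>G\<in>X. card {v \<in> B - A. v \<in> G}) = (\<Sum>v\<in>B - A. card {G \<in> X. v \<in> G})"
    using sum.swap_restrict[of X "B - A" "\<lambda>_ _. 1::nat" "\<lambda>G v. v \<in> G"] by simp
  moreover have "{v \<in> B - A. v \<in> G} = G - A" if "G \<in> X" for G using that by (auto simp: X_def)
  moreover have "{G \<in> X. v \<in> G} = Y v" for v by (auto simp: X_def Y_def)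
  ultimately have "(\<Sum>G\<in>X. card (G - A)) = (\<Sum>v\<in>B - A. card (Y v))" by simp
  then have "(\<Sum>G\<in>X. real (card (G - A))) = (\<Sum>v\<in>B - A. real (card (Y v)))"
    by (metis of_nat_sum)
  moreover have "(\<Sum>G\<in>X. real (card (G - A))) = (\<Sum>G\<in>X. q ^ (a + Suc s) - q ^ a)"
    by (rule sum.cong) (auto simp: X_def cd)
  moreover have "(\<Sum>v\<in>B - A. real (card (Y v))) = (\<Sum>v\<in>B - A. qbin q (b - (a + 1)) s)"
    by (rule sum.cong) (auto simp: Yv)
  ultimately have "real (card X) * (q ^ (a + Suc s) - q ^ a) = (q ^ b - q ^ a) * qbin q (b - (a + 1)) s"
    using cd[OF Suc.prems(2,3)] by (simp add: b_def)
  also have "q ^ (a + Suc s) - q ^ a = q ^ a * ((q - 1) * q_int q (Suc s))"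
    by (simp only: q_int_geometric power_add right_diff_distrib mult_1_right)
  also have "q ^ b - q ^ a = q ^ a * ((q - 1) * q_int q (b - a))"
    using ab by (simp add: q_int_geometric right_diff_distrib flip: power_add)
  finally have "(q ^ a * (q - 1)) * (q_int q (Suc s) * real (card X)) =
      (q ^ a * (q - 1)) * (q_int q (b - a) * qbin q (b - (a + 1)) s)" by (simp add: mult_ac)
  then have "q_int q (Suc s) * real (card X) = q_int q (b - a) * qbin q (b - (a + 1)) s"
    using q by simp
  also have "\<dots> = q_int q (Suc s) * qbin q (b - a) (Suc s)"
  proof (cases "b - a")
    case (Suc m)
    then have "b - (a + 1) = m" by simp
    then show ?thesis using qbin_absorb[of q s m] Suc by (simp only:)
  qed simp
  finally show ?case
    using q_int_pos[of "Suc s" q] q by (simp add: X_def q_def a_def b_def del: qbin.simps)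
qed

section \<open>Projective geometries\<close>

definition points_in :: "('k::field ^ 'n::finite) set \<Rightarrow> ('k ^ 'n) set set" where
  "points_in W = {L. vec.subspace L \<and> vec.dim L = 1 \<and> L \<subseteq> W}"

lemma point_span:
  fixes v :: "'k::field ^ 'n::finite"
  shows "v \<noteq> 0 \<Longrightarrow> vec.subspace (vec.span {v}) \<and> vec.dim (vec.span {v}) = 1"
  by (simp add: vec.dim_insert vec.span_empty)

text \<open>Every nonzero vector of \<open>W\<close> spans a point of \<open>W\<close>. A subspace
  is thus recovered from its points, which makes \<open>points_in\<close> an order
  embedding.\<close>

lemma span_Union_points_in:
  fixes W :: "('k::field ^ 'n::finite) set"
  assumes "vec.subspace W"
  shows "vec.span (\<Union>(points_in W)) = W"
proof
  show "vec.span (\<Union>(points_in W)) \<subseteq> W"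
    using assms by (intro vec.span_minimal) (auto simp: points_in_def)
  show "W \<subseteq> vec.span (\<Union>(points_in W))"
  proof
    fix v assume v: "v \<in> W"
    show "v \<in> vec.span (\<Union>(points_in W))"
    proof (cases "v = 0")
      case False
      have "vec.span {v} \<subseteq> W" using v assms by (intro vec.span_minimal) auto
      then have "vec.span {v} \<in> points_in W" using point_span[OF False] by (auto simp: points_in_def)
      then have "v \<in> \<Union>(points_in W)" using vec.span_base[of v "{v}"] by auto
      then show ?thesis by (rule vec.span_base)
    qed (simp add: vec.span_zero)
  qed
qed

lemma dim_Union_points_in:
  fixes W :: "('k::field ^ 'n::finite) set"
  shows "vec.subspace W \<Longrightarrow> vec.dim (\<Union>(points_in W)) = vec.dim W"
  by (metis span_Union_points_in vec.dim_span)

lemma points_in_subset_iff: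
  fixes W W' :: "('k::field ^ 'n::finite) set"
  assumes "vec.subspace W" "vec.subspace W'"
  shows "points_in W \<subseteq> points_in W' \<longleftrightarrow> W \<subseteq> W'"
proof
  assume "points_in W \<subseteq> points_in W'"
  then have "vec.span (\<Union>(points_in W)) \<subseteq> vec.span (\<Union>(points_in W'))" by (intro vec.span_mono) auto
  then show "W \<subseteq> W'" using assms by (simp add: span_Union_points_in)
qed (auto simp: points_in_def)

lemma points_in_psubset_iff:
  fixes W W' :: "('k::field ^ 'n::finite) set"
  assumes "vec.subspace W" "vec.subspace W'"
  shows "points_in W \<subset> points_in W' \<longleftrightarrow> W \<subset> W'"
  using points_in_subset_iff[OF assms] points_in_subset_iff[OF assms(2,1)] by (simp only: less_le_not_le)

lemma points_in_inj: "inj_on points_in {W :: ('k::field ^ 'n::finite) set. vec.subspace W}"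
  by (rule inj_onI) (metis mem_Collect_eq span_Union_points_in)

lemma ground_PG: "ground (PG :: ('k::{field,finite} ^ 'n::finite) set matroid) = points_in UNIV"
  by (simp add: PG_def points_in_def)

lemma mrank_PG: "mrank (PG :: ('k::{field,finite} ^ 'n::finite) set matroid) S = vec.dim (\<Union>S)"
  by (simp add: PG_def)

lemma mrank_points_in:
  "vec.subspace W \<Longrightarrow> mrank (PG :: ('k::{field,finite} ^ 'n::finite) set matroid) (points_in W) = vec.dim W"
  by (simp add: mrank_PG dim_Union_points_in)

text \<open>A point in the span of a flat would not raise the rank, so the flat already contains it
  and consists of all points of its span.\<close>

lemma is_flat_PG:
  "is_flat (PG :: ('k::{field,finite} ^ 'n::finite) set matroid) F \<longleftrightarrow> (\<exists>W. vec.subspace W \<and> F = points_in W)"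
proof
  assume F: "is_flat (PG :: ('k ^ 'n) set matroid) F"
  have pts: "L \<in> F \<Longrightarrow> vec.subspace L \<and> vec.dim L = 1" for L
    using F by (auto simp: is_flat_def ground_PG points_in_def)
  have "F = points_in (vec.span (\<Union>F))"
  proof
    show "F \<subseteq> points_in (vec.span (\<Union>F))"
      using pts by (auto simp: points_in_def intro: vec.span_base)
    show "points_in (vec.span (\<Union>F)) \<subseteq> F"
    proof (rule ccontr)
      assume "\<not> points_in (vec.span (\<Union>F)) \<subseteq> F"
      then obtain L where L: "L \<in> points_in (vec.span (\<Union>F))" "L \<notin> F" by auto
      then have "vec.dim (\<Union>F) < vec.dim (\<Union>(insert L F))"
        using F by (auto simp: is_flat_def ground_PG mrank_PG points_in_def)
      moreover have "\<Union>(insert L F) \<subseteq> vec.span (\<Union>F)"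
        using L by (auto simp: points_in_def intro: vec.span_base)
      then have "vec.dim (\<Union>(insert L F)) \<le> vec.dim (\<Union>F)"
        by (metis vec.dim_span vec.dim_subset)
      ultimately show False by simp
    qed
  qed
  then show "\<exists>W. vec.subspace W \<and> F = points_in W" using vec.subspace_span by blast
next
  assume "\<exists>W. vec.subspace W \<and> F = points_in W"
  then obtain W where W: "vec.subspace W" "F = points_in W" by auto
  have "vec.dim (\<Union>F) < vec.dim (\<Union>(insert L F))" if L: "L \<in> points_in UNIV - F" for L
  proof (rule vec.dim_psubset)
    have "\<not> L \<subseteq> W" using L W by (auto simp: points_in_def)
    moreover have "L \<subseteq> vec.span (\<Union>(insert L F))" by (auto intro: vec.span_base)
    moreover have "vec.span (\<Union>F) \<subseteq> vec.span (\<Union>(insert L F))" by (intro vec.span_mono) auto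
    ultimately show "vec.span (\<Union>F) \<subset> vec.span (\<Union>(insert L F))"
      using span_Union_points_in[OF W(1)] W(2) by auto
  qed
  then show "is_flat (PG :: ('k ^ 'n) set matroid) F"
    using W by (auto simp: is_flat_def ground_PG mrank_PG points_in_def)
qed

text \<open>The points partition the nonzero vectors of \<open>W\<close>, with one less than the
  field order of them in each point.\<close>

lemma card_points_in:
  fixes W :: "('k::{field,finite} ^ 'n::finite) set"
  assumes W: "vec.subspace W"
  shows "card (points_in W) = q_int CARD('k) (vec.dim W)"
proof -
  let ?q = "CARD('k)"
  have un: "W - {0} = (\<Union>L\<in>points_in W. L - {0})"
  proof
    show "W - {0} \<subseteq> (\<Union>L\<in>points_in W. L - {0})"
    proof
      fix v assume v: "v \<in> W - {0}"
      then have "vec.span {v} \<subseteq> W" using W by (intro vec.span_minimal) auto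
      then have "vec.span {v} \<in> points_in W" using point_span[of v] v by (auto simp: points_in_def)
      moreover have "v \<in> vec.span {v} - {0}" using v by (auto intro: vec.span_base)
      ultimately show "v \<in> (\<Union>L\<in>points_in W. L - {0})" by blast
    qed
  qed (auto simp: points_in_def)
  have disj: "(L - {0}) \<inter> (L' - {0}) = {}" if L: "L \<in> points_in W" "L' \<in> points_in W" "L \<noteq> L'" for L L'
  proof (rule ccontr)
    assume "(L - {0}) \<inter> (L' - {0}) \<noteq> {}"
    then obtain v where v: "v \<in> L" "v \<in> L'" "v \<noteq> 0" by auto
    have "vec.span {v} = L''" if "L'' \<in> points_in W" "v \<in> L''" for L''
    proof (rule vec.subspace_dim_equal)
      show "vec.span {v} \<subseteq> L''" using that by (intro vec.span_minimal) (auto simp: points_in_def)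
    qed (use that point_span[OF v(3)] in \<open>auto simp: points_in_def\<close>)
    then show False using L v by metis
  qed
  have "card (W - {0}) = (\<Sum>L\<in>points_in W. card (L - {0}))"
    unfolding un by (rule card_UN_disjoint) (use disj in auto)
  also have "\<dots> = (\<Sum>L\<in>points_in W. ?q - 1)"
  proof (rule sum.cong)
    fix L assume "L \<in> points_in W"
    then have "vec.subspace L" "vec.dim L = 1" by (auto simp: points_in_def)
    then show "card (L - {0}) = ?q - 1" using card_subspace[of L] by (simp add: vec.subspace_0)
  qed simp
  finally have "?q ^ vec.dim W - 1 = card (points_in W) * (?q - 1)"
    using W card_subspace[OF W] by (simp add: vec.subspace_0)
  then have "real (?q ^ vec.dim W - 1) = real (card (points_in W) * (?q - 1))" by simp
  then have "real ?q ^ vec.dim W - 1 = real (card (points_in W)) * (real ?q - 1)"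
    using card_field_ge_2[where 'k = 'k] by (simp add: of_nat_diff)
  then have "(real ?q - 1) * real (card (points_in W)) = (real ?q - 1) * q_int (real ?q) (vec.dim W)"
    by (simp add: q_int_geometric mult.commute)
  then have "real (card (points_in W)) = real (q_int ?q (vec.dim W))"
    using card_field_ge_2[where 'k = 'k] by (simp add: of_nat_q_int)
  then show ?thesis by simp
qed

text \<open>Flats are handled through their subspaces. Those through a point \<open>i\<close> are
  the ones above the span of the lower subspace and \<open>i\<close>, which has one dimension more,
  so the count through a point is an instance of the plain count.\<close>

lemma q_geometry_PG:
  assumes "CARD('n) = r + 1"
  shows "q_geometry (PG :: ('k::{field,finite} ^ 'n::finite) set matroid) CARD('k) r"
proof -
  let ?M = "PG :: ('k ^ 'n) set matroid"
  have dimU: "vec.dim (UNIV :: ('k ^ 'n) set) = r + 1" using assms by (simp only: vec_dim_card)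
  have dimle: "vec.dim W \<le> r + 1" for W :: "('k ^ 'n) set"
    using vec.dim_subset[of W UNIV] dimU by simp
  have empty: "points_in {0 :: 'k ^ 'n} = {}"
    using span_Union_points_in[of "{0 :: 'k ^ 'n}"] vec.dim_subset
    by (fastforce simp: points_in_def vec.subspace_single_0 dest: vec.dim_subset)
  have empty_iff: "points_in W = {} \<longleftrightarrow> W = {0}" if "vec.subspace W" for W :: "('k ^ 'n) set"
    using span_Union_points_in[OF that] empty by (metis Union_empty vec.span_empty)
  have pts_iff: "points_in W = points_in UNIV \<longleftrightarrow> W = UNIV" if "vec.subspace W" for W :: "('k ^ 'n) set"
    using span_Union_points_in[OF that] span_Union_points_in[of "UNIV :: ('k ^ 'n) set"] by (auto simp: vec.subspace_UNIV)
  have flats: "proper_flats ?M = points_in ` {W. vec.subspace W \<and> W \<noteq> {0} \<and> W \<noteq> UNIV}"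
    unfolding proper_flats_def is_flat_PG ground_PG using empty_iff pts_iff by auto
  have low: "\<exists>W. vec.subspace W \<and> A = points_in W" if "A \<in> insert {} (proper_flats ?M)" for A
  proof (cases "A = {}")
    case True
    then have "A = points_in {0}" using empty by simp
    then show ?thesis using vec.subspace_single_0 by blast
  next
    case False
    then show ?thesis using that unfolding flats by auto
  qed
  have upp: "\<exists>W. vec.subspace W \<and> B = points_in W" if "B \<in> insert (ground ?M) (proper_flats ?M)" for B
    using that unfolding flats ground_PG by (auto intro: vec.subspace_UNIV)
  \<comment> \<open>The strict bounds on \<open>s\<close> make both inclusions strict and exclude
    \<open>{0}\<close> and \<open>UNIV\<close>, so the flats are proper automatically. The predicate
    \<open>Q\<close> is trivial for one count and membership of a point for the other.\<close>
  have between: "{G \<in> proper_flats ?M. points_in A \<subset> G \<and> G \<subset> points_in B \<and> Q G \<and> mrank ?M G = s} =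
      points_in ` {W. vec.subspace W \<and> A \<subseteq> W \<and> W \<subseteq> B \<and> Q (points_in W) \<and> vec.dim W = s}"
    if A: "vec.subspace A" and B: "vec.subspace B" and s: "vec.dim A < s" "s < vec.dim B" for A B s Q
  proof
    show "{G \<in> proper_flats ?M. points_in A \<subset> G \<and> G \<subset> points_in B \<and> Q G \<and> mrank ?M G = s} \<subseteq>
      points_in ` {W. vec.subspace W \<and> A \<subseteq> W \<and> W \<subseteq> B \<and> Q (points_in W) \<and> vec.dim W = s}"
    proof
      fix G assume G: "G \<in> {G \<in> proper_flats ?M. points_in A \<subset> G \<and> G \<subset> points_in B \<and> Q G \<and> mrank ?M G = s}"
      then obtain W where W: "G = points_in W" "vec.subspace W" unfolding flats by blast
      then have "A \<subset> W" "W \<subset> B" "Q (points_in W)" "vec.dim W = s"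
        using G A B by (simp_all add: points_in_psubset_iff mrank_points_in)
      then show "G \<in> points_in ` {W. vec.subspace W \<and> A \<subseteq> W \<and> W \<subseteq> B \<and> Q (points_in W) \<and> vec.dim W = s}"
        using W by blast
    qed
    show "points_in ` {W. vec.subspace W \<and> A \<subseteq> W \<and> W \<subseteq> B \<and> Q (points_in W) \<and> vec.dim W = s} \<subseteq>
      {G \<in> proper_flats ?M. points_in A \<subset> G \<and> G \<subset> points_in B \<and> Q G \<and> mrank ?M G = s}"
    proof
      fix G assume "G \<in> points_in ` {W. vec.subspace W \<and> A \<subseteq> W \<and> W \<subseteq> B \<and> Q (points_in W) \<and> vec.dim W = s}"
      then obtain W where W: "G = points_in W" "vec.subspace W" "A \<subseteq> W" "W \<subseteq> B" "Q (points_in W)" "vec.dim W = s" by auto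
      have neq: "W \<noteq> A" "W \<noteq> B" using W s by auto
      moreover have "W \<noteq> {0}" using W s by auto
      moreover have "W \<noteq> UNIV" using W(4) neq(2) by auto
      ultimately show "G \<in> {G \<in> proper_flats ?M. points_in A \<subset> G \<and> G \<subset> points_in B \<and> Q G \<and> mrank ?M G = s}"
        using W A B by (simp add: flats points_in_psubset_iff mrank_points_in) blast
    qed
  qed
  have card_im: "card (points_in ` {W :: ('k ^ 'n) set. vec.subspace W \<and> P W}) = card {W :: ('k ^ 'n) set. vec.subspace W \<and> P W}" for P
    by (rule card_image) (rule inj_on_subset[OF points_in_inj], auto)
  show ?thesis
  proof
    show "finite (ground ?M)" by simp
    show "0 < CARD('k)" by simp
    show "mrank ?M {} = 0" by (simp add: mrank_PG)
    show "mrank ?M (ground ?M) = r + 1" by (simp only: ground_PG mrank_points_in vec.subspace_UNIV dimU)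
  next
    fix A B assume A: "A \<in> insert {} (proper_flats ?M)" and B: "B \<in> insert (ground ?M) (proper_flats ?M)" and AB: "A \<subset> B"
    obtain A' where A': "vec.subspace A'" "A = points_in A'" using low[OF A] by auto
    obtain B' where B': "vec.subspace B'" "B = points_in B'" using upp[OF B] by auto
    have AB': "A' \<subset> B'" using AB A' B' points_in_psubset_iff by auto
    show "mrank ?M A < mrank ?M B"
      using A' B' AB' subspace_psubset_dim by (simp add: mrank_points_in)
    fix s assume s: "mrank ?M A < s" "s < mrank ?M B"
    then have s': "vec.dim A' < s" "s < vec.dim B'" using A' B' by (auto simp: mrank_points_in)
    show "real (card {G \<in> proper_flats ?M. A \<subset> G \<and> G \<subset> B \<and> mrank ?M G = s}) =
        qbin (real CARD('k)) (mrank ?M B - mrank ?M A) (s - mrank ?M A)"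
      using between[OF A'(1) B'(1) s', of "\<lambda>_. True"] card_im[of "\<lambda>W. A' \<subseteq> W \<and> W \<subseteq> B' \<and> vec.dim W = s"]
        card_subspaces_between[OF A'(1) B'(1), of "s - vec.dim A'"] A' B' AB' s'
      by (simp add: mrank_points_in psubset_imp_subset)
    fix i assume i: "i \<in> B - A"
    then have iL: "vec.subspace i" "vec.dim i = 1" "i \<subseteq> B'" "\<not> i \<subseteq> A'" using A' B' by (auto simp: points_in_def)
    define C where "C = vec.span (A' \<union> i)"
    have C: "vec.subspace C" "A' \<subseteq> C" "i \<subseteq> C" by (auto simp: C_def intro: vec.span_base)
    have CB: "C \<subseteq> B'" unfolding C_def using AB' iL B' by (intro vec.span_minimal) auto
    have dimC: "vec.dim C = vec.dim A' + 1"
    proof -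
      obtain v where v: "v \<in> i" "v \<notin> A'" using iL by auto
      then have "v \<noteq> 0" using A' vec.subspace_0 by auto
      then have iv: "vec.span {v} = i"
        using point_span[of v] iL v vec.span_minimal[of "{v}" i] by (intro vec.subspace_dim_equal) auto
      have "C = vec.span (insert v A')"
      proof
        show "vec.span (insert v A') \<subseteq> C" unfolding C_def using v by (intro vec.span_mono) auto
        have "i \<subseteq> vec.span (insert v A')" unfolding iv[symmetric] by (intro vec.span_mono) auto
        then show "C \<subseteq> vec.span (insert v A')"
          unfolding C_def by (intro vec.span_minimal) (auto intro: vec.span_base)
      qed
      then show ?thesis using v A' by (simp add: vec.dim_insert vec.span_eq_iff[THEN iffD2])
    qed
    have "{W. vec.subspace W \<and> A' \<subseteq> W \<and> W \<subseteq> B' \<and> i \<in> points_in W \<and> vec.dim W = s} =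
        {W. vec.subspace W \<and> C \<subseteq> W \<and> W \<subseteq> B' \<and> vec.dim W = vec.dim C + (s - vec.dim A' - 1)}"
    proof -
      have "vec.subspace W \<Longrightarrow> A' \<subseteq> W \<and> i \<in> points_in W \<longleftrightarrow> C \<subseteq> W" for W
        using iL C vec.span_minimal[of "A' \<union> i" W] unfolding C_def[symmetric] by (auto simp: points_in_def)
      then show ?thesis using s' by (auto simp: dimC)
    qed
    then show "real (card {G \<in> proper_flats ?M. A \<subset> G \<and> G \<subset> B \<and> i \<in> G \<and> mrank ?M G = s}) =
        qbin (real CARD('k)) (mrank ?M B - mrank ?M A - 1) (s - mrank ?M A - 1)"
      using between[OF A'(1) B'(1) s', of "\<lambda>G. i \<in> G"] card_im[of "\<lambda>W. A' \<subseteq> W \<and> W \<subseteq> B' \<and> i \<in> points_in W \<and> vec.dim W = s"]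
        card_subspaces_between[OF C(1) B'(1) CB, of "s - vec.dim A' - 1"] A' B'
      by (simp add: mrank_points_in dimC)
  next
    fix F assume "F \<in> insert (ground ?M) (proper_flats ?M)"
    then obtain W where "vec.subspace W" "F = points_in W" using upp by blast
    then show "card F = q_int CARD('k) (mrank ?M F)" by (simp add: card_points_in mrank_points_in)
  qed
qed

text \<open>Prime powers are exactly the orders of finite fields, and the order determines the field
  up to isomorphism; so \<open>q\<close> enters as the cardinality of the scalar type.\<close>

theorem theorem7p9:
  fixes q r :: nat and c :: "nat \<Rightarrow> nat"
    and M :: "('k::{field,finite} ^ 'n::finite) set matroid"
  assumes "CARD('k) = q"
    and "CARD('n) = r + 1"
    and "r > 0"
    and "c \<in> weight_vectors r"
    and "M = PG"
  shows "chow_deg M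
      (\<Otimes>\<^bsub>chow_ring M\<^esub>k\<in>{1..r}. hypersimplex_class M (q_int q k) [^]\<^bsub>chow_ring M\<^esub> c k)
    = real q ^ ((r + 1) choose 2) * poly (remixed_eulerian r c) (real q)"
proof -
  interpret q_geometry M q r
    using q_geometry_PG[where 'k = 'k and 'n = 'n, OF assms(2)] assms(1,5) by simp
  show ?thesis using assms(4) by (rule chow_deg_hypersimplex)
qed

end
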